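(* Let $f\in\mathcal{A}$. Then $f$ has the bounded backward contraction property: there is a constant $K>0$ such that for every $\delta_0>0$ there exists $\delta\in(0,\delta_0)$ with the following property. For every $x\in M$ for which $n=\min\{i\ge0: f^i(x)\in N_\delta\}$ is finite, one has $|Df^n(x)|\ge K$, where $Df^0:=1$.
   Context: Let $M=[0,1]$. The class $\mathcal{A}$ consists of maps $f:M\to M$ with the following properties. (1) Piecewise structure. There is a finite set $C\subset M$ such that $f$ restricted to each connected component of $M\setminus C$ is a $C^1$ diffeomorphism onto its image, and the one-sided limits $f(c\pm)$ exist for every $c\in C$. Each $c\in C$ is regarded as two points $c\pm$. We write $f^n(c)=f^{n-1}(f(c\pm))$. (2) Orders. For each $c\in C$ and each side there is $l(c\pm)\in[1,\infty)$ such that, on the corresponding one-sided neighbourhood of $c$, $$|Df(x)|\approx|x-c|^{l(c\pm)-1},\qquad |f(x)-f(c\pm)|\approx|x-c|^{l(c\pm)}.$$ Here $\approx$ means the ratio is bounded above and below by positive constants. (3) Negative Schwarzian derivative. The function $|f'|^{-1/2}$ is convex on each component of $M\setminus C$. (4) First summability condition. For every $c\in C$ (each side), $$\sum_{n\ge1}\Big(\frac{|f^n(c)-\tilde c|^{l(\tilde c)}}{|f^n(c)-\tilde c|^{l(c)}|Df^n(f(c))|}\Big)^{1/l(c)}<\infty,$$ where $\tilde c\in C$ is the point of $C$ closest to $f^n(c)$, with orders taken on the relevant sides. In particular, critical orbits never hit $C$. (5) Second summability condition. For every $c\in C$ (each side), $$\sum_{n\ge1}|Df^n(f(c))|^{-1/l(c)}<\infty.$$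 Neighbourhoods of critical points. For small $\delta>0$ and $c\in C$, let $N_\delta(c)$ be the neighbourhood of $c$ consisting of $c$ together with the points $x$ in the small one-sided neighbourhoods of $c$ such that $|f(x)-f(c\pm)|<\delta$, with the sign matching the side of $x$. Let $N_\delta=\bigcup_{c\in C}N_\delta(c)$. *)

theory Defs
  imports "HOL-Analysis.Analysis"
begin

text \<open>M = [0,1]. A side of a point c is encoded by a boolean r: True = right (c+), False = left (c-).\<close>

definition side_ok :: "real \<Rightarrow> bool \<Rightarrow> bool" where
  "side_ok c r = (if r then c < 1 else 0 < c)"

definition at_side :: "real \<Rightarrow> bool \<Rightarrow> real filter" where
  "at_side c r = (if r then at_right c else at_left c)"

definition side_lim :: "(real \<Rightarrow> real) \<Rightarrow> real \<Rightarrow> bool \<Rightarrow> real" where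
  "side_lim f c r = Lim (at_side c r) f"

definition side_nbhd :: "real \<Rightarrow> bool \<Rightarrow> real \<Rightarrow> real set" where
  "side_nbhd c r e = (if r then {c<..<c+e} else {c-e<..<c})"

text \<open>Derivative of the n-th iterate via the chain rule: Df^n(x) = prod_{i<n} Df(f^i x); Df^0 = 1.\<close>
definition Dfn :: "(real \<Rightarrow> real) \<Rightarrow> (real \<Rightarrow> real) \<Rightarrow> nat \<Rightarrow> real \<Rightarrow> real" where
  "Dfn f Df n x = (\<Prod>i<n. Df ((f ^^ i) x))"

definition nearest :: "real set \<Rightarrow> real \<Rightarrow> real" where
  "nearest C y = (SOME c'. c' \<in> C \<and> (\<forall>c''\<in>C. \<bar>y - c'\<bar> \<le> \<bar>y - c''\<bar>))"

definition classA :: "(real \<Rightarrow> real) \<Rightarrow> (real \<Rightarrow> real) \<Rightarrow> real set \<Rightarrow> (real \<Rightarrow> bool \<Rightarrow> real) \<Rightarrow> bool" where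
  "classA f Df C l \<longleftrightarrow>
     (\<forall>x\<in>{0..1}. f x \<in> {0..1}) \<and>
     finite C \<and> C \<subseteq> {0..1} \<and>
     \<comment> \<open>(1) piecewise C^1 diffeomorphism on the components of M - C\<close>
     (\<forall>x\<in>{0..1} - C. (f has_real_derivative Df x) (at x within {0..1})) \<and>
     (\<forall>x\<in>{0..1} - C. inj_on f (connected_component_set ({0..1} - C) x) \<and>
                      continuous_on (connected_component_set ({0..1} - C) x) Df \<and>
                      (\<forall>y\<in>connected_component_set ({0..1} - C) x. Df y \<noteq> 0)) \<and>
     (\<forall>c\<in>C. \<forall>r. side_ok c r \<longrightarrow> (\<exists>L. (f \<longlongrightarrow> L) (at_side c r))) \<and>
     \<comment> \<open>(2) orders\<close>
     (\<forall>c\<in>C. \<forall>r. side_ok c r \<longrightarrow> l c r \<ge> 1 \<and>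
        (\<exists>e>0. \<exists>A>0. \<exists>B>0. \<forall>x\<in>side_nbhd c r e \<inter> {0..1}.
            A * \<bar>x - c\<bar> powr (l c r - 1) \<le> \<bar>Df x\<bar> \<and> \<bar>Df x\<bar> \<le> B * \<bar>x - c\<bar> powr (l c r - 1) \<and>
            A * \<bar>x - c\<bar> powr (l c r) \<le> \<bar>f x - side_lim f c r\<bar> \<and>
            \<bar>f x - side_lim f c r\<bar> \<le> B * \<bar>x - c\<bar> powr (l c r))) \<and>
     \<comment> \<open>(3) negative Schwarzian: |f'|^(-1/2) convex on each component of M - C\<close>
     (\<forall>x\<in>{0..1} - C. convex_on (connected_component_set ({0..1} - C) x)
                         (\<lambda>y. \<bar>Df y\<bar> powr (-1/2))) \<and>
     \<comment> \<open>(4) first summability condition (critical orbits avoid C); f^n(c) = f^(n-1)(f(c+-))\<close>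
     (\<forall>c\<in>C. \<forall>r. side_ok c r \<longrightarrow>
        (\<forall>n. (f ^^ n) (side_lim f c r) \<notin> C) \<and>
        summable (\<lambda>m. let n = Suc m; y = (f ^^ m) (side_lim f c r);
                              ct = nearest C y in
            (\<bar>y - ct\<bar> powr (l ct (ct < y)) /
              (\<bar>y - ct\<bar> powr (l c r) * \<bar>Dfn f Df n (side_lim f c r)\<bar>)) powr (1 / l c r))) \<and>
     \<comment> \<open>(5) second summability condition\<close>
     (\<forall>c\<in>C. \<forall>r. side_ok c r \<longrightarrow>
        summable (\<lambda>m. \<bar>Dfn f Df (Suc m) (side_lim f c r)\<bar> powr (- 1 / l c r)))"

text \<open>N_delta(c): c together with the points x of the components of M - C adjacent to c
  (on either side) with |f x - f(c+-)| < delta, sign matching the side of x.\<close>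
definition Nbhd :: "(real \<Rightarrow> real) \<Rightarrow> real set \<Rightarrow> real \<Rightarrow> real \<Rightarrow> real set" where
  "Nbhd f C \<delta> c = {c} \<union>
     {x\<in>{0..1}. c < x \<and> (\<forall>c'\<in>C. \<not> (c < c' \<and> c' \<le> x)) \<and> \<bar>f x - side_lim f c True\<bar> < \<delta>} \<union>
     {x\<in>{0..1}. x < c \<and> (\<forall>c'\<in>C. \<not> (x \<le> c' \<and> c' < c)) \<and> \<bar>f x - side_lim f c False\<bar> < \<delta>}"

definition Nset :: "(real \<Rightarrow> real) \<Rightarrow> real set \<Rightarrow> real \<Rightarrow> real set" where
  "Nset f C \<delta> = (\<Union>c\<in>C. Nbhd f C \<delta> c)"

end

theory Submission
  imports Defs
begin

text \<open>Negative Schwarzian derivative is used through two inequalities that are stable under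
  composition: \<open>|g'(u) g'(v)| \<le> ((g u - g v) / (u - v))\<^sup>2\<close>, and, for \<open>x\<close> between \<open>a\<close> and \<open>b\<close>,
  \<open>1/|x - a| + 1/|x - b| \<le> |g'(x)| (1/|g x - g a| + 1/|g x - g b|)\<close>.

  Write \<open>x\<^sub>j = f\<^sup>j(x)\<close>, let \<open>\<rho>\<^sub>j\<close> be the distance of \<open>x\<^sub>j\<close> to \<open>C\<close>, and let \<open>n\<close> be a time at which the orbit is
  closer to \<open>C\<close> (in distance or in depth \<open>|f(x\<^sub>j) - f(c)|\<close>) than before. One proves
  \<open>|Df\<^sup>n(x)| \<ge> min(1, K/\<rho>\<^sub>0)\<close> by induction on \<open>n\<close>. Let \<open>(a,b)\<close> be the maximal interval around \<open>x\<close> on which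
  \<open>f\<^sup>n\<close> is monotone. An end \<open>b\<close> is mapped to some \<open>c \<in> C\<close> at a time \<open>i < n\<close>, so \<open>f\<^sup>n(b)\<close> lies on a critical
  orbit. Either \<open>f\<^sup>n(b)\<close> is far from \<open>x\<^sub>n\<close>; or it is close, and since the terms of the two summability
  series tend to \<open>0\<close> the derivative along the critical orbit is so large that the first inequality
  makes the slope of \<open>f\<^sup>n\<close> between \<open>x\<close> and \<open>b\<close> large. In both cases the second inequality yields the
  bound, except when some \<open>\<rho>\<^sub>i\<close> is very small; then the orbit is cut at its closest approach \<open>q\<close>, and
  the induction hypothesis applies to both pieces, the second one giving the bound \<open>1\<close>.

  An end of \<open>(a,b)\<close> may also be an end point of \<open>[0,1]\<close>, whose orbit is not controlled. If that orbit
  accumulates at \<open>C\<close>, the end point and its images are separated by preimages of \<open>C\<close>, and the argument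
  is carried out at \<open>f(x)\<close> or \<open>f\<^sup>2(x)\<close> instead of \<open>x\<close>.\<close>

section \<open>Negative Schwarzian derivative\<close>

text \<open>The bound has to survive cutting. A plain bound by K would lose a factor K at every cut,
  whereas the truncated one equals 1 for a piece that starts within K of \<open>C\<close>, so a cut
  there costs nothing. It also feeds itself at an end b sent to \<open>C\<close> at time i < n: the
  induction hypothesis at b bounds \<open>D i b\<close>, a factor needed in the first inequality.
  The contradiction is quantitative. If the bound fails at x, put 1/mu = 1/|x - a| + 1/|x - b|; the
  images of both ends are then at distance at least 4 mu |Df^n(x)| from x_n, and the second
  inequality would give 1/mu <= 1/(2 mu). Far from \<open>C\<close>, on a branch that reaches a bad
  end point, passing to an image costs a fixed factor, which must not be lost anew each time. So
  these points get a smaller target constant than the others; the orbit leaves them within two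
  steps, and the larger constant found there pays for the loss.\<close>

lemma nondecreasing_if_deriv_within_nonneg:
  fixes g :: "real \<Rightarrow> real"
  assumes "u \<le> v"
    and der: "\<And>t. t \<in> {u..v} \<Longrightarrow> (g has_real_derivative g' t) (at t within {u..v})"
    and nonneg: "\<And>t. t \<in> {u..v} \<Longrightarrow> 0 \<le> g' t"
  shows "g u \<le> g v"
proof -
  have "\<exists>t\<in>{u..v}. g v - g u = (\<lambda>h. h * g' t) (v - u)"
    using \<open>u \<le> v\<close>
  proof (rule mvt_very_simple)
    fix t assume "u \<le> t" "t \<le> v"
    then show "(g has_derivative (\<lambda>h. h * g' t)) (at t within {u..v})"
      using der[of t] by (simp add: has_field_derivative_def mult.commute[of _ "g' t"])
  qed
  then show ?thesis using nonneg \<open>u \<le> v\<close>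
    by (metis diff_ge_0_iff_ge mult_nonneg_nonneg)
qed

text \<open>The Moebius maps, those with affine |g'|^(-1/2) and zero Schwarzian derivative, are the
  comparison maps for both inequalities. With m(t) = p + k (t - x), this one is the primitive of
  1/m^2 that vanishes at x.\<close>

lemma mobius_has_derivative:
  fixes p k x t :: real
  assumes "p + k * (t - x) > 0" "p > 0"
  shows "((\<lambda>t. (t - x) / (p * (p + k * (t - x)))) has_real_derivative 1 / (p + k * (t - x))^2)
          (at t within S)"
proof -
  define q where "q = p + k * (t - x)"
  have q: "q > 0" using assms by (simp add: q_def)
  have d1: "((\<lambda>t. t - x) has_real_derivative 1) (at t within S)"
    by (auto intro!: derivative_eq_intros)
  have d2: "((\<lambda>t. p * (p + k * (t - x))) has_real_derivative p * k) (at t within S)"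
    by (auto intro!: derivative_eq_intros)
  have "((\<lambda>t. (t - x) / (p * (p + k * (t - x)))) has_real_derivative
      (1 * (p * q) - (t - x) * (p * k)) / (p * q * (p * q))) (at t within S)"
    unfolding q_def by (rule DERIV_divide[OF d1 d2]) (use assms in simp)
  moreover have "1 * (p * q) - (t - x) * (p * k) = p * p" by (simp add: q_def algebra_simps)
  then have "(1 * (p * q) - (t - x) * (p * k)) / (p * q * (p * q)) = 1 / q^2"
    using q assms(2) by (simp add: power2_eq_square)
  ultimately show ?thesis by (simp add: q_def)
qed

lemma abs_deriv_powr_half:
  fixes z :: real
  assumes "z > 0"
  shows "z = 1 / (z powr (-1/2))^2" "z powr (-1/2) > 0"
proof -
  show "z powr (-1/2) > 0" using assms by simp
  have "(z powr (-1/2))^2 = z powr (-1)"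
    using assms by (simp add: powr_powr flip: powr_numeral)
  also have "\<dots> = 1 / z" using assms by (simp add: powr_minus field_simps)
  finally show "z = 1 / (z powr (-1/2))^2" using assms by simp
qed

text \<open>Convexity puts \<open>|g'|\<^sup>-\<^sup>1\<^sup>/\<^sup>2\<close> below its chord; integrating the resulting lower bound for \<open>g'\<close> (a
  Moebius derivative) gives the two-point form of negative Schwarzian derivative, which
  is stable under composition.\<close>
lemma two_point_increasing:
  fixes g :: "real \<Rightarrow> real"
  assumes "u < v"
    and der: "\<And>t. t \<in> {u..v} \<Longrightarrow> (g has_real_derivative g' t) (at t within {u..v})"
    and pos: "\<And>t. t \<in> {u..v} \<Longrightarrow> 0 < g' t"
    and conv: "convex_on {u..v} (\<lambda>t. g' t powr (-1/2))"
  shows "(u - v)^2 * (g' u * g' v) \<le> (g u - g v)^2"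
proof -
  define \<phi> where "\<phi> = (\<lambda>t. g' t powr (-1/2))"
  have \<phi>pos: "\<phi> t > 0" "g' t = 1 / (\<phi> t)^2" if "t \<in> {u..v}" for t
    using abs_deriv_powr_half[OF pos[OF that]] by (simp_all add: \<phi>_def)
  define k where "k = (\<phi> v - \<phi> u) / (v - u)"
  define m where "m = (\<lambda>t. \<phi> u + k * (t - u))"
  have u: "u \<in> {u..v}" and v: "v \<in> {u..v}" using \<open>u < v\<close> by auto
  have mv: "m v = \<phi> v" using \<open>u < v\<close> by (simp add: m_def k_def)
  have le: "\<phi> t \<le> m t" if "t \<in> {u..v}" for t
    using convex_onD_Icc'[OF conv that] unfolding m_def k_def \<phi>_def by simp
  have mpos: "m t > 0" if "t \<in> {u..v}" for t
    using le[OF that] \<phi>pos(1)[OF that] by linarith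
  define P where "P = (\<lambda>t. (t - u) / (\<phi> u * (\<phi> u + k * (t - u))))"
  have derP: "(P has_real_derivative 1 / (m t)^2) (at t within {u..v})" if "t \<in> {u..v}" for t
    unfolding P_def m_def
    by (rule mobius_has_derivative) (use mpos[OF that] \<phi>pos(1)[OF u] in \<open>auto simp: m_def\<close>)
  have "g u - P u \<le> g v - P v"
  proof (rule nondecreasing_if_deriv_within_nonneg[of u v "\<lambda>t. g t - P t" "\<lambda>t. g' t - 1 / (m t)^2"])
    show "u \<le> v" using \<open>u < v\<close> by simp
    fix t assume t: "t \<in> {u..v}"
    show "((\<lambda>t. g t - P t) has_real_derivative g' t - 1 / (m t)^2) (at t within {u..v})"
      by (rule DERIV_diff[OF der[OF t] derP[OF t]])
    have "(\<phi> t)^2 \<le> (m t)^2" using le[OF t] \<phi>pos(1)[OF t] by (intro power_mono) auto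
    then show "0 \<le> g' t - 1 / (m t)^2"
      using \<phi>pos[OF t] by (simp add: frac_le)
  qed
  then have ge: "(v - u) / (\<phi> u * \<phi> v) \<le> g v - g u"
    using mv by (simp add: P_def m_def)
  have "(u - v)^2 * (g' u * g' v) = ((v - u) / (\<phi> u * \<phi> v))^2"
    using \<phi>pos[OF u] \<phi>pos[OF v] by (simp add: power_divide power_mult_distrib power2_commute)
  also have "\<dots> \<le> (g v - g u)^2"
    using ge \<open>u < v\<close> \<phi>pos(1)[OF u] \<phi>pos(1)[OF v] by (intro power_mono) auto
  finally show ?thesis by (simp add: power2_commute)
qed

text \<open>A supporting line m at x lies below |g'|^(-1/2), so integrating g' <= 1/m^2 gives |g y -
  g x| <= |y - x| / (p m(y)) with p = m(x); reciprocals then separate a term linear in k. As x may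
  be either end of the interval, both sides of a point are covered.\<close>

lemma mobius_upper_bound_increasing:
  fixes g :: "real \<Rightarrow> real"
  assumes st: "s < t" and x: "x = s \<or> x = t" and y: "y = s \<or> y = t" "y \<noteq> x"
    and der: "\<And>\<tau>. \<tau> \<in> {s..t} \<Longrightarrow> (g has_real_derivative g' \<tau>) (at \<tau> within {s..t})"
    and pos: "\<And>\<tau>. \<tau> \<in> {s..t} \<Longrightarrow> 0 < g' \<tau>"
    and sup: "\<And>\<tau>. \<tau> \<in> {s..t} \<Longrightarrow> g' x powr (-1/2) + k * (\<tau> - x) \<le> g' \<tau> powr (-1/2)"
  shows "1 / (g' x * \<bar>y - x\<bar>) + k * g' x powr (-1/2) * sgn (y - x) \<le> 1 / \<bar>g y - g x\<bar>"
proof -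
  define p where "p = g' x powr (-1/2)"
  have xin: "x \<in> {s..t}" and yin: "y \<in> {s..t}" using x y st by auto
  have p: "p > 0" "g' x = 1 / p^2"
    using abs_deriv_powr_half[OF pos[OF xin]] by (simp_all add: p_def)
  define m where "m = (\<lambda>\<tau>. p + k * (\<tau> - x))"
  have yx: "\<bar>y - x\<bar> > 0" using y by simp
  have lhs: "1 / (g' x * \<bar>y - x\<bar>) + k * p * sgn (y - x) = p * m y / \<bar>y - x\<bar>"
  proof -
    have "sgn (y - x) = (y - x) / \<bar>y - x\<bar>" using yx
      by (rule_tac real_sgn_eq)
    then show ?thesis using yx p by (simp add: m_def power2_eq_square add_divide_distrib ring_distribs)
  qed
  have gne: "\<bar>g y - g x\<bar> \<ge> 0" by simp
  show ?thesis
  proof (cases "m y > 0")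
    \<comment> \<open>The affine minorant may reach zero before y, where the comparison map blows
      up; the left side is then nonpositive and nothing has to be compared.\<close>
    case False
    then have "p * m y / \<bar>y - x\<bar> \<le> 0" using p yx by (simp add: divide_nonpos_pos mult_nonneg_nonpos)
    moreover have "0 \<le> 1 / \<bar>g y - g x\<bar>" by simp
    ultimately show ?thesis using lhs unfolding p_def by linarith
  next
    case True
    have mx: "m x > 0" using p by (simp add: m_def)
    have mpos: "m \<tau> > 0" if "\<tau> \<in> {s..t}" for \<tau>
    proof -
      have "m \<tau> \<ge> min (m s) (m t)"
      proof (cases "k \<ge> 0")
        case True
        then have "k * (s - x) \<le> k * (\<tau> - x)" using that by (intro mult_left_mono) auto
        then show ?thesis by (simp add: m_def)
      next
        case False
        then have "k * (t - x) \<le> k * (\<tau> - x)" using that by (intro mult_left_mono_neg) auto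
        then show ?thesis by (simp add: m_def)
      qed
      then show ?thesis using True mx x y by auto
    qed
    define P where "P = (\<lambda>\<tau>. (\<tau> - x) / (p * (p + k * (\<tau> - x))))"
    have derP: "(P has_real_derivative 1 / (m \<tau>)^2) (at \<tau> within {s..t})" if "\<tau> \<in> {s..t}" for \<tau>
      unfolding P_def m_def
      by (rule mobius_has_derivative) (use mpos[OF that] p in \<open>auto simp: m_def\<close>)
    have "P s - g s \<le> P t - g t"
    proof (rule nondecreasing_if_deriv_within_nonneg[of s t "\<lambda>\<tau>. P \<tau> - g \<tau>" "\<lambda>\<tau>. 1 / (m \<tau>)^2 - g' \<tau>"])
      show "s \<le> t" using st by simp
      fix \<tau> assume \<tau>: "\<tau> \<in> {s..t}"
      show "((\<lambda>\<tau>. P \<tau> - g \<tau>) has_real_derivative 1 / (m \<tau>)^2 - g' \<tau>) (at \<tau> within {s..t})"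
        by (rule DERIV_diff[OF derP[OF \<tau>] der[OF \<tau>]])
      have "(m \<tau>)^2 \<le> (g' \<tau> powr (-1/2))^2"
        using sup[OF \<tau>] mpos[OF \<tau>] by (intro power_mono) (auto simp: m_def p_def)
      then show "0 \<le> 1 / (m \<tau>)^2 - g' \<tau>"
        using abs_deriv_powr_half(1)[OF pos[OF \<tau>]] mpos[OF \<tau>]
          frac_le[of 1 1 "(m \<tau>)^2" "(g' \<tau> powr (-1/2))^2"] by simp
    qed
    moreover have "g s \<le> g t"
      by (rule nondecreasing_if_deriv_within_nonneg[OF _ der]) (use st pos less_imp_le in auto)
    ultimately have bnd: "\<bar>g y - g x\<bar> \<le> \<bar>P y - P x\<bar>" using x y by auto
    have "\<bar>P y - P x\<bar> = \<bar>y - x\<bar> / (p * m y)"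
      using True p by (simp add: P_def m_def abs_mult)
    moreover have "g y \<noteq> g x"
    proof -
      have "\<exists>\<tau>\<in>{s..t}. g t - g s = (\<lambda>h. h * g' \<tau>) (t - s)"
      proof (rule mvt_very_simple)
        show "s \<le> t" using st by simp
        fix \<tau> assume "s \<le> \<tau>" "\<tau> \<le> t"
        then show "(g has_derivative (\<lambda>h. h * g' \<tau>)) (at \<tau> within {s..t})"
          using der[of \<tau>] by (simp add: has_field_derivative_def mult.commute[of _ "g' \<tau>"])
      qed
      then have "g t - g s > 0" using pos st by (metis diff_gt_0_iff_gt mult_pos_pos)
      then show ?thesis using x y by auto
    qed
    ultimately have "1 / (\<bar>y - x\<bar> / (p * m y)) \<le> 1 / \<bar>g y - g x\<bar>"
      using bnd True p yx by (intro divide_left_mono) (auto intro!: divide_pos_pos mult_pos_pos)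
    then show ?thesis using lhs by (simp add: p_def)
  qed
qed

text \<open>The affine terms coming from a supporting line at \<open>x\<close> cancel when both sides are added.\<close>
lemma three_point_increasing:
  fixes g :: "real \<Rightarrow> real"
  assumes ab: "a < x" "x < b"
    and der: "\<And>t. t \<in> {a..b} \<Longrightarrow> (g has_real_derivative g' t) (at t within {a..b})"
    and pos: "\<And>t. t \<in> {a..b} \<Longrightarrow> 0 < g' t"
    and conv: "convex_on {a..b} (\<lambda>t. g' t powr (-1/2))"
  shows "1 / \<bar>x - a\<bar> + 1 / \<bar>b - x\<bar> \<le> g' x * (1 / \<bar>g x - g a\<bar> + 1 / \<bar>g b - g x\<bar>)"
proof -
  define \<phi> where "\<phi> = (\<lambda>t. g' t powr (-1/2))"
  \<comment> \<open>The right derivative at x of the convex function \<phi>, written as an infimum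
    of slopes: it is the slope of a supporting line.\<close>
  define k where "k = Inf ((\<lambda>t. (\<phi> x - \<phi> t) / (x - t)) ` ({x<..} \<inter> {a..b}))"
  have sup: "\<phi> x + k * (t - x) \<le> \<phi> t" if "t \<in> {a..b}" for t
    unfolding k_def by (rule convex_le_Inf_differential[OF conv[folded \<phi>_def]]) (use that ab in auto)
  have xpos: "g' x > 0" using pos ab by auto
  have 1: "1 / (g' x * \<bar>b - x\<bar>) + k * \<phi> x * sgn (b - x) \<le> 1 / \<bar>g b - g x\<bar>"
    unfolding \<phi>_def
    apply (rule mobius_upper_bound_increasing[of x b x b])
    using ab apply simp_all
    subgoal for t using der[of t] by (auto intro: DERIV_subset)
    subgoal for t using pos[of t] by auto
    subgoal for t using sup[of t] by (auto simp: \<phi>_def)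
    done
  have 2: "1 / (g' x * \<bar>a - x\<bar>) + k * \<phi> x * sgn (a - x) \<le> 1 / \<bar>g a - g x\<bar>"
    unfolding \<phi>_def
    apply (rule mobius_upper_bound_increasing[of a x x a])
    using ab apply simp_all
    subgoal for t using der[of t] by (auto intro: DERIV_subset)
    subgoal for t using pos[of t] by auto
    subgoal for t using sup[of t] by (auto simp: \<phi>_def)
    done
  have "1 / (g' x * \<bar>b - x\<bar>) + 1 / (g' x * \<bar>a - x\<bar>) \<le> 1 / \<bar>g x - g a\<bar> + 1 / \<bar>g b - g x\<bar>"
    using 1 2 ab by (simp add: abs_minus_commute)
  then have "g' x * (1 / (g' x * \<bar>b - x\<bar>) + 1 / (g' x * \<bar>a - x\<bar>))
      \<le> g' x * (1 / \<bar>g x - g a\<bar> + 1 / \<bar>g b - g x\<bar>)"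
    using xpos by (intro mult_left_mono) auto
  moreover have "g' x * (1 / (g' x * \<bar>b - x\<bar>) + 1 / (g' x * \<bar>a - x\<bar>)) = 1 / \<bar>x - a\<bar> + 1 / \<bar>b - x\<bar>"
    using xpos by (simp add: field_simps abs_minus_commute)
  ultimately show ?thesis by simp
qed

lemma convex_on_eq:
  assumes "convex_on S g" "\<And>t. t \<in> S \<Longrightarrow> g t = h t"
  shows "convex_on S h"
  using assms unfolding convex_on_def by (metis convexD)

lemma constant_sign:
  fixes g' :: "real \<Rightarrow> real"
  assumes cont: "continuous_on {u..v} g'"
    and nz: "\<And>t. t \<in> {u..v} \<Longrightarrow> g' t \<noteq> 0"
  shows "(\<forall>t\<in>{u..v}. g' t > 0) \<or> (\<forall>t\<in>{u..v}. g' t < 0)"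
proof (rule ccontr)
  assume "\<not> ?thesis"
  then obtain s t where s: "s \<in> {u..v}" "g' s \<le> 0" and t: "t \<in> {u..v}" "g' t \<ge> 0" by force
  have "connected (g' ` {u..v})" by (rule connected_continuous_image[OF cont]) simp
  then have "0 \<in> g' ` {u..v}"
    using s t by (meson connectedD_interval image_eqI)
  then show False using nz by auto
qed

lemma two_point:
  fixes g :: "real \<Rightarrow> real"
  assumes der: "\<And>t. t \<in> closed_segment u v \<Longrightarrow> (g has_real_derivative g' t) (at t within closed_segment u v)"
    and cont: "continuous_on (closed_segment u v) g'"
    and nz: "\<And>t. t \<in> closed_segment u v \<Longrightarrow> g' t \<noteq> 0"
    and conv: "convex_on (closed_segment u v) (\<lambda>t. \<bar>g' t\<bar> powr (-1/2))"
  shows "(u - v)^2 * (\<bar>g' u\<bar> * \<bar>g' v\<bar>) \<le> (g u - g v)^2"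
proof -
  have main: "(u - v)^2 * (\<bar>g' u\<bar> * \<bar>g' v\<bar>) \<le> (g u - g v)^2"
    if uv: "u < v"
      and der: "\<And>t. t \<in> {u..v} \<Longrightarrow> (g has_real_derivative g' t) (at t within {u..v})"
      and cont: "continuous_on {u..v} g'"
      and nz: "\<And>t. t \<in> {u..v} \<Longrightarrow> g' t \<noteq> 0"
      and conv: "convex_on {u..v} (\<lambda>t. \<bar>g' t\<bar> powr (-1/2))" for u v
  proof -
    have "(\<forall>t\<in>{u..v}. g' t > 0) \<or> (\<forall>t\<in>{u..v}. g' t < 0)"
      by (rule constant_sign[OF cont nz])
    then show ?thesis
    proof
      assume p: "\<forall>t\<in>{u..v}. g' t > 0"
      have "convex_on {u..v} (\<lambda>t. g' t powr (-1/2))"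
        by (rule convex_on_eq[OF conv]) (use p in \<open>force simp: abs_if\<close>)
      from two_point_increasing[OF uv der _ this] p have "(u - v)^2 * (g' u * g' v) \<le> (g u - g v)^2" by blast
      moreover have "g' u > 0" "g' v > 0" using p uv by auto
      ultimately show ?thesis by simp
    next
      assume p: "\<forall>t\<in>{u..v}. g' t < 0"
      have c: "convex_on {u..v} (\<lambda>t. (- g' t) powr (-1/2))"
        by (rule convex_on_eq[OF conv]) (use p in \<open>force simp: abs_if\<close>)
      have "(u - v)^2 * ((- g' u) * (- g' v)) \<le> ((- g u) - (- g v))^2"
        by (rule two_point_increasing[OF uv _ _ c]) (use p der in \<open>auto intro: DERIV_minus\<close>)
      moreover have "g' u < 0" "g' v < 0" using p uv by auto
      ultimately show ?thesis by (simp add: power2_commute)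
    qed
  qed
  consider "u < v" | "v < u" | "u = v" by linarith
  then show ?thesis
  proof cases
    case 1
    then show ?thesis using main[of u v] assms by (simp add: closed_segment_eq_real_ivl)
  next
    case 2
    then have "(v - u)^2 * (\<bar>g' v\<bar> * \<bar>g' u\<bar>) \<le> (g v - g u)^2"
      using main[of v u] assms by (simp add: closed_segment_eq_real_ivl)
    then show ?thesis by (simp add: power2_commute mult.commute)
  qed simp
qed

lemma three_point:
  fixes g :: "real \<Rightarrow> real"
  assumes x: "x \<in> open_segment a b"
    and der: "\<And>t. t \<in> closed_segment a b \<Longrightarrow> (g has_real_derivative g' t) (at t within closed_segment a b)"
    and cont: "continuous_on (closed_segment a b) g'"
    and nz: "\<And>t. t \<in> closed_segment a b \<Longrightarrow> g' t \<noteq> 0"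
    and conv: "convex_on (closed_segment a b) (\<lambda>t. \<bar>g' t\<bar> powr (-1/2))"
  shows "1 / \<bar>x - a\<bar> + 1 / \<bar>x - b\<bar> \<le> \<bar>g' x\<bar> * (1 / \<bar>g x - g a\<bar> + 1 / \<bar>g x - g b\<bar>)"
proof -
  have main: "1 / \<bar>x - a\<bar> + 1 / \<bar>b - x\<bar> \<le> \<bar>g' x\<bar> * (1 / \<bar>g x - g a\<bar> + 1 / \<bar>g b - g x\<bar>)"
    if ab: "a < x" "x < b"
      and der: "\<And>t. t \<in> {a..b} \<Longrightarrow> (g has_real_derivative g' t) (at t within {a..b})"
      and cont: "continuous_on {a..b} g'"
      and nz: "\<And>t. t \<in> {a..b} \<Longrightarrow> g' t \<noteq> 0"
      and conv: "convex_on {a..b} (\<lambda>t. \<bar>g' t\<bar> powr (-1/2))" for a b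
  proof -
    have "(\<forall>t\<in>{a..b}. g' t > 0) \<or> (\<forall>t\<in>{a..b}. g' t < 0)"
      by (rule constant_sign[OF cont nz])
    then show ?thesis
    proof
      assume p: "\<forall>t\<in>{a..b}. g' t > 0"
      have "convex_on {a..b} (\<lambda>t. g' t powr (-1/2))"
        by (rule convex_on_eq[OF conv]) (use p in \<open>force simp: abs_if\<close>)
      from three_point_increasing[OF ab der _ this] p have "1 / \<bar>x - a\<bar> + 1 / \<bar>b - x\<bar> \<le> g' x * (1 / \<bar>g x - g a\<bar> + 1 / \<bar>g b - g x\<bar>)" by blast
      moreover have "g' x > 0" using p ab by auto
      ultimately show ?thesis by simp
    next
      assume p: "\<forall>t\<in>{a..b}. g' t < 0"
      have c: "convex_on {a..b} (\<lambda>t. (- g' t) powr (-1/2))"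
        by (rule convex_on_eq[OF conv]) (use p in \<open>force simp: abs_if\<close>)
      have "1 / \<bar>x - a\<bar> + 1 / \<bar>b - x\<bar> \<le> (- g' x) * (1 / \<bar>- g x - - g a\<bar> + 1 / \<bar>- g b - - g x\<bar>)"
        by (rule three_point_increasing[OF ab _ _ c]) (use p der in \<open>auto intro: DERIV_minus\<close>)
      moreover have "g' x < 0" using p ab by auto
      ultimately show ?thesis by (simp add: abs_minus_commute)
    qed
  qed
  consider "a < x" "x < b" | "b < x" "x < a"
    using x by (auto simp: open_segment_eq_real_ivl split: if_splits)
  then show ?thesis
  proof cases
    case 1
    then show ?thesis using main[of a b] assms by (simp add: closed_segment_eq_real_ivl abs_minus_commute)
  next
    case 2
    then show ?thesis using main[of b a] assms
      by (simp add: closed_segment_eq_real_ivl abs_minus_commute add.commute)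
  qed
qed

section \<open>Elementary real estimates and the truncated bound\<close>

lemma finite_uniform_threshold:
  assumes "finite S"
    and "\<And>p. p \<in> S \<Longrightarrow> \<exists>\<epsilon>>0. \<forall>\<epsilon>'. 0 < \<epsilon>' \<and> \<epsilon>' \<le> (\<epsilon>::real) \<longrightarrow> P p \<epsilon>'"
  shows "\<exists>\<epsilon>>0. \<forall>\<epsilon>'. 0 < \<epsilon>' \<and> \<epsilon>' \<le> \<epsilon> \<longrightarrow> (\<forall>p\<in>S. P p \<epsilon>')"
  using assms
proof (induction S rule: finite_induct)
  case empty
  then show ?case by (auto intro: exI[of _ 1])
next
  case (insert q S)
  obtain e1 where "e1 > 0" "\<forall>\<epsilon>'. 0 < \<epsilon>' \<and> \<epsilon>' \<le> e1 \<longrightarrow> P q \<epsilon>'" using insert.prems[of q] by auto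
  moreover obtain e2 where "e2 > 0" "\<forall>\<epsilon>'. 0 < \<epsilon>' \<and> \<epsilon>' \<le> e2 \<longrightarrow> (\<forall>p\<in>S. P p \<epsilon>')"
    using insert by blast
  \<comment> \<open>Each property holds at all sufficiently small thresholds, not just at one, so
    the minimum works without any monotonicity of \<open>P\<close>.\<close>
  ultimately show ?case by (intro exI[of _ "min e1 e2"]) auto
qed

text \<open>The terms of both summability conditions carry an exponent 1/l(c) <= 1. Such a power of
  a number in [0,1] is no smaller than the number, so small terms mean a small base.\<close>

lemma powr_root_less:
  fixes q \<epsilon> a :: real
  assumes "q powr (1 / a) < \<epsilon>" "a \<ge> 1" "0 < \<epsilon>" "\<epsilon> \<le> 1"
  shows "q < \<epsilon>"
proof (rule ccontr)
  assume "\<not> q < \<epsilon>"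
  then have "\<epsilon> powr (1 / a) \<le> q powr (1 / a)" using assms by (intro powr_mono2) auto
  moreover have "\<epsilon> powr 1 \<le> \<epsilon> powr (1 / a)" using assms by (intro powr_mono') auto
  ultimately show False using assms by simp
qed

lemma positive_limit_bounded_below:
  fixes a :: "nat \<Rightarrow> real"
  assumes "a \<longlonglongrightarrow> L" "L > 0" "\<And>j. a j > 0"
  shows "\<exists>\<kappa>>0. \<forall>j. \<kappa> \<le> a j"
proof -
  obtain N where N: "\<And>j. j \<ge> N \<Longrightarrow> L / 2 < a j"
    using order_tendstoD(1)[OF assms(1), of "L / 2"] assms(2) by (auto simp: eventually_sequentially)
  define \<kappa> where "\<kappa> = Min (insert (L / 2) (a ` {..<N}))"
  have "\<kappa> > 0" using assms by (simp add: \<kappa>_def)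
  moreover have "\<kappa> \<le> a j" for j
  proof (cases "j < N")
    case True
    then show ?thesis by (auto simp: \<kappa>_def intro: Min_le)
  next
    case False
    have "\<kappa> \<le> L / 2" unfolding \<kappa>_def by (rule Min_le) auto
    then show ?thesis using N[of j] False by simp
  qed
  ultimately show ?thesis by blast
qed

text \<open>\<open>min(1, K/\<rho>)\<close>, written so that the value at \<open>\<rho> = 0\<close> is \<open>1\<close>.\<close>
definition trunc :: "real \<Rightarrow> real \<Rightarrow> real" where
  "trunc K \<rho> = K / max K \<rho>"

lemma trunc_le_1: "K > 0 \<Longrightarrow> trunc K \<rho> \<le> 1"
  by (simp add: trunc_def)

lemma trunc_pos: "K > 0 \<Longrightarrow> trunc K \<rho> > 0"
  by (simp add: trunc_def less_max_iff_disj)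

lemma trunc_mult_le: "K > 0 \<Longrightarrow> \<rho> \<ge> 0 \<Longrightarrow> trunc K \<rho> * \<rho> \<le> K"
  unfolding trunc_def by (simp add: pos_divide_le_eq less_max_iff_disj mult_left_mono)

lemma trunc_le_divide: "K > 0 \<Longrightarrow> \<rho> > 0 \<Longrightarrow> trunc K \<rho> \<le> K / \<rho>"
  unfolding trunc_def by (simp add: frac_le)

lemma trunc_eq_1: "K > 0 \<Longrightarrow> \<rho> \<le> K \<Longrightarrow> trunc K \<rho> = 1"
  by (simp add: trunc_def max_def)

lemma trunc_ge: "K > 0 \<Longrightarrow> \<rho> \<le> r \<Longrightarrow> K \<le> r \<Longrightarrow> K / r \<le> trunc K \<rho>"
  unfolding trunc_def by (rule divide_left_mono) (auto simp: less_max_iff_disj)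

lemma trunc_antimono: "K > 0 \<Longrightarrow> \<rho> \<le> \<rho>' \<Longrightarrow> trunc K \<rho>' \<le> trunc K \<rho>"
  unfolding trunc_def by (rule divide_left_mono) (auto simp: less_max_iff_disj)

lemma trunc_mono: "K > 0 \<Longrightarrow> K \<le> K' \<Longrightarrow> trunc K \<rho> \<le> trunc K' \<rho>"
proof -
  assume K: "K > 0" "K \<le> K'"
  have "K * max K' \<rho> \<le> K' * max K \<rho>"
    using K mult_mono[of K K' \<rho> \<rho>] by (cases "\<rho> \<le> K"; cases "\<rho> \<le> K'") (auto simp: max_def mult_left_mono mult_right_mono)
  then show ?thesis
    using K unfolding trunc_def by (simp add: divide_simps less_max_iff_disj)
qed

text \<open>With mu = \<alpha> \<beta> / (\<alpha> + \<beta>) = \<theta> \<beta>, the claim reduces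
  to G \<theta>^2 being at most a multiple of \<open>trunc K \<rho>b\<close>. If \<beta> <= \<rho>0,
  then b is not much farther from \<open>C\<close> than x. Otherwise \<alpha> <= \<rho>0, and the
  small factor \<theta> makes up for an end b that is far from \<open>C\<close>.\<close>

lemma good_end_arith:
  fixes \<alpha> \<beta> \<rho>0 \<rho>b G H K \<Omega> M :: real
  assumes \<alpha>: "\<alpha> > 0" and \<beta>: "\<beta> > 0" and min: "min \<alpha> \<beta> \<le> \<rho>0" and \<rho>0: "\<rho>0 > 0"
    and \<rho>b: "\<rho>b \<le> \<rho>0 + \<beta>" and K: "K > 0" and \<Omega>: "\<Omega> \<ge> 1" and H: "0 < H" "H \<le> \<Omega> * K"
    and G: "0 < G" "G < trunc H \<rho>0" and M: "M \<ge> 8 * \<Omega>"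
  shows "4 * G * (\<alpha> * \<beta> / (\<alpha> + \<beta>)) \<le> M * \<beta> * sqrt (G * trunc K \<rho>b)"
proof -
  define \<theta> where "\<theta> = \<alpha> / (\<alpha> + \<beta>)"
  have \<theta>: "0 \<le> \<theta>" "\<theta> \<le> 1" using \<alpha> \<beta> by (auto simp: \<theta>_def)
  then have \<theta>2: "\<theta>^2 \<le> \<theta>" "0 \<le> \<theta>^2" by (auto simp: power2_eq_square mult_left_le)
  have key: "\<theta>^2 * max K \<rho>b \<le> 4 * max K \<rho>0"
  proof (cases "\<beta> \<le> \<rho>0")
    case True
    have "\<theta>^2 * max K \<rho>b \<le> 1 * max K \<rho>b" using \<theta> \<theta>2 K by (intro mult_right_mono) auto
    also have "\<dots> \<le> 4 * max K \<rho>0" using True \<rho>b K by auto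
    finally show ?thesis .
  next
    case False
    then have "\<alpha> \<le> \<rho>0" using min by auto
    then have "\<alpha> * \<beta> \<le> \<rho>0 * (\<alpha> + \<beta>)"
      using \<alpha> \<beta> \<rho>0 by (intro mult_mono) auto
    then have "\<theta> * \<beta> \<le> \<rho>0" using \<alpha> \<beta> by (simp add: \<theta>_def pos_divide_le_eq)
    show ?thesis
    proof (cases "\<rho>b \<le> K")
      case True
      have "\<theta>^2 * K \<le> 1 * K" using \<theta> \<theta>2 K by (intro mult_right_mono) auto
      then have "\<theta>^2 * K \<le> max K \<rho>0" by simp
      then show ?thesis using True K \<rho>0 by (simp add: max_absorb1 del: max.bounded_iff)
    next
      case f2: False
      have "\<theta>^2 * \<rho>b \<le> \<theta> * (2 * \<beta>)" by (intro mult_mono) (use \<theta> \<theta>2 \<rho>b False f2 K in linarith)+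
      also have "\<dots> \<le> 2 * \<rho>0" using \<open>\<theta> * \<beta> \<le> \<rho>0\<close> by simp
      also have "\<dots> \<le> 4 * max K \<rho>0" using \<rho>0 by auto
      finally show ?thesis using f2 by (simp add: max_def)
    qed
  qed
  have m0: "max K \<rho>0 > 0" "max K \<rho>b > 0" using K by (auto simp: less_max_iff_disj)
  have "trunc H \<rho>0 \<le> trunc (\<Omega> * K) \<rho>0" using H by (intro trunc_mono) auto
  also have "\<dots> \<le> \<Omega> * K / max K \<rho>0"
    unfolding trunc_def using K \<Omega> by (intro divide_left_mono max.mono) (auto simp: less_max_iff_disj)
  finally have "G \<le> \<Omega> * K / max K \<rho>0" using G by linarith
  then have "G * \<theta>^2 \<le> \<Omega> * K / max K \<rho>0 * \<theta>^2" using \<theta>2 by (intro mult_right_mono) auto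
  also have "\<dots> \<le> 4 * \<Omega> * (K / max K \<rho>b)"
  proof -
    have "\<Omega> * K * (\<theta>^2 * max K \<rho>b) \<le> \<Omega> * K * (4 * max K \<rho>0)"
      using key \<Omega> K by (intro mult_left_mono) auto
    then show ?thesis using m0 by (simp add: field_simps)
  qed
  \<comment> \<open>Squaring \<Omega> makes the constant a perfect square, so that the root taken
    below yields 8 \<Omega>.\<close>
  also have "\<dots> \<le> 4 * \<Omega>^2 * (K / max K \<rho>b)"
    using \<Omega> K m0 self_le_power[of \<Omega> 2] by (intro mult_right_mono) auto
  finally have 1: "G * \<theta>^2 \<le> 4 * \<Omega>^2 * trunc K \<rho>b" by (simp add: trunc_def)
  have "(4 * G * \<theta>)^2 = 16 * G * (G * \<theta>^2)" by (simp add: power2_eq_square)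
  also have "\<dots> \<le> 16 * G * (4 * \<Omega>^2 * trunc K \<rho>b)" using 1 G by (intro mult_left_mono) auto
  also have "\<dots> = (8 * \<Omega> * sqrt (G * trunc K \<rho>b))^2"
    using G trunc_pos[OF K, of \<rho>b] by (simp add: power_mult_distrib)
  finally have "4 * G * \<theta> \<le> 8 * \<Omega> * sqrt (G * trunc K \<rho>b)"
    by (rule power2_le_imp_le) (use \<Omega> G trunc_pos[OF K, of \<rho>b] in auto)
  also have "\<dots> \<le> M * sqrt (G * trunc K \<rho>b)" using M G trunc_pos[OF K, of \<rho>b] by (intro mult_right_mono) auto
  finally have "4 * G * \<theta> * \<beta> \<le> M * sqrt (G * trunc K \<rho>b) * \<beta>" using \<beta> by (intro mult_right_mono) auto
  then show ?thesis by (simp add: \<theta>_def algebra_simps)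
qed

section \<open>Iterates and monotone branches\<close>

text \<open>With \<open>C\<close> empty, \<open>infdist x C\<close> is 0 for every x and distances
  to \<open>C\<close> lose their meaning. In that case \<open>Nset\<close> is empty and the claim
  trivial; it is split off in the final theorem.\<close>

locale classA_map =
  fixes f Df :: "real \<Rightarrow> real" and C :: "real set" and l :: "real \<Rightarrow> bool \<Rightarrow> real"
  assumes classA: "classA f Df C l"
    and C_nonempty: "C \<noteq> {}"
begin

abbreviation "F n \<equiv> f ^^ n"

abbreviation "D n x \<equiv> \<bar>Dfn f Df n x\<bar>"

lemma f_in: "x \<in> {0..1} \<Longrightarrow> f x \<in> {0..1}"
  using classA unfolding classA_def by blast

lemma iter_in: "x \<in> {0..1} \<Longrightarrow> F n x \<in> {0..1}"
  by (induction n) (use f_in in auto)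

lemma finite_C: "finite C" and C_subset: "C \<subseteq> {0..1}"
  using classA unfolding classA_def by blast+

lemma f_deriv: "x \<in> {0..1} - C \<Longrightarrow> (f has_real_derivative Df x) (at x within {0..1})"
  using classA unfolding classA_def by blast

lemma comp_props:
  assumes "x \<in> {0..1} - C"
  shows "inj_on f (connected_component_set ({0..1} - C) x)"
    "continuous_on (connected_component_set ({0..1} - C) x) Df"
    "y \<in> connected_component_set ({0..1} - C) x \<Longrightarrow> Df y \<noteq> 0"
    "convex_on (connected_component_set ({0..1} - C) x) (\<lambda>y. \<bar>Df y\<bar> powr (-1/2))"
proof -
  have 1: "\<forall>x\<in>{0..1} - C. inj_on f (connected_component_set ({0..1} - C) x) \<and>
                      continuous_on (connected_component_set ({0..1} - C) x) Df \<and>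
                      (\<forall>y\<in>connected_component_set ({0..1} - C) x. Df y \<noteq> 0)"
    using classA unfolding classA_def by blast
  have 2: "\<forall>x\<in>{0..1} - C. convex_on (connected_component_set ({0..1} - C) x)
                         (\<lambda>y. \<bar>Df y\<bar> powr (-1/2))"
    using classA unfolding classA_def by blast
  show "inj_on f (connected_component_set ({0..1} - C) x)"
    "continuous_on (connected_component_set ({0..1} - C) x) Df"
    "y \<in> connected_component_set ({0..1} - C) x \<Longrightarrow> Df y \<noteq> 0"
    using 1 assms by blast+
  show "convex_on (connected_component_set ({0..1} - C) x) (\<lambda>y. \<bar>Df y\<bar> powr (-1/2))"
    using 2 assms by blast
qed

lemma connected_subset_comp:
  assumes "connected S" "S \<subseteq> {0..1} - C" "x \<in> S"
  shows "S \<subseteq> connected_component_set ({0..1} - C) x"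
  using assms by (simp add: connected_component_maximal)

lemma Df_nz: "x \<in> {0..1} - C \<Longrightarrow> Df x \<noteq> 0"
  using comp_props(3)[of x x] by (simp add: connected_component_refl)

lemma f_cont_at: "x \<in> {0..1} - C \<Longrightarrow> continuous (at x within {0..1}) f"
  using f_deriv DERIV_continuous by blast

lemma Df_cont_at:
  assumes x: "x \<in> {0..1} - C"
  shows "continuous (at x within {0..1}) Df"
proof -
  have "open (- C)" using finite_C finite_imp_closed by auto
  then obtain e where e: "e > 0" "ball x e \<subseteq> - C"
    using x by (meson Compl_iff DiffD2 openE)
  define S where "S = {0..1} \<inter> ball x e"
  have "convex S" unfolding S_def by (intro convex_Int) auto
  then have "S \<subseteq> connected_component_set ({0..1} - C) x"
    using e x by (intro connected_subset_comp) (auto simp: S_def convex_connected)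
  then have "continuous_on S Df" using comp_props(2)[OF x] continuous_on_subset by blast
  then have "continuous (at x within S) Df"
    using x e by (simp add: continuous_on_eq_continuous_within S_def)
  moreover have "at x within S = at x within {0..1}"
    unfolding S_def by (rule at_within_nhd[of _ "ball x e"]) (use e in auto)
  ultimately show ?thesis by simp
qed

lemma Dfn_0 [simp]: "Dfn f Df 0 x = 1"
  by (simp add: Dfn_def)

lemma Dfn_1 [simp]: "Dfn f Df (Suc 0) x = Df x"
  by (simp add: Dfn_def)

lemma Dfn_add: "Dfn f Df (m + n) x = Dfn f Df m x * Dfn f Df n (F m x)"
proof -
  have "F (m + i) x = F i (F m x)" for i
    by (metis add.commute comp_apply funpow_add)
  then show ?thesis
    by (simp add: Dfn_def prod.nat_group lessThan_atLeast0 prod.atLeastLessThan_concat[symmetric, of 0 m "m+n"]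
        prod.shift_bounds_nat_ivl[of _ 0 m n, simplified add.commute, simplified] add.commute)
qed

lemma D_add: "D (m + n) x = D m x * D n (F m x)"
  by (simp add: Dfn_add abs_mult)

lemma Dfn_Suc: "Dfn f Df (Suc n) x = Dfn f Df n x * Df (F n x)"
  by (simp add: Dfn_def)

lemma iter_add: "F (m + n) x = F n (F m x)"
  by (metis add.commute comp_apply funpow_add)

text \<open>\<open>f\<^sup>n\<close> has no singularity on \<open>S\<close>, so it is a diffeomorphism on every interval contained in \<open>S\<close>.\<close>
definition free :: "nat \<Rightarrow> real set \<Rightarrow> bool" where
  "free n S \<longleftrightarrow> S \<subseteq> {0..1} \<and> (\<forall>j<n. \<forall>u\<in>S. F j u \<notin> C)"

lemma free_mono: "free n S \<Longrightarrow> m \<le> n \<Longrightarrow> T \<subseteq> S \<Longrightarrow> free m T"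
  unfolding free_def by (meson less_le_trans subset_iff)

lemma free_subset: "free n S \<Longrightarrow> T \<subseteq> S \<Longrightarrow> free n T"
  using free_mono by blast

lemma free_le: "free n S \<Longrightarrow> m \<le> n \<Longrightarrow> free m S"
  using free_mono by blast

lemma free_Suc: "free (Suc n) S \<longleftrightarrow> free n S \<and> (\<forall>u\<in>S. F n u \<notin> C)"
  unfolding free_def by (auto simp: less_Suc_eq)

lemma free_Un: "free n (S \<union> T) \<longleftrightarrow> free n S \<and> free n T"
  unfolding free_def by auto

lemma free_image: "free (m + k) S \<Longrightarrow> free k (F m ` S)"
  unfolding free_def using iter_in iter_add by (auto simp flip: iter_add)

lemma free_singleton: "free n {x} \<longleftrightarrow> x \<in> {0..1} \<and> (\<forall>j<n. F j x \<notin> C)"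
  unfolding free_def by auto

lemma free_imp_singleton: "free n S \<Longrightarrow> x \<in> S \<Longrightarrow> free n {x}"
  by (rule free_subset) auto

lemma Dfn_nz: "free n {x} \<Longrightarrow> Dfn f Df n x \<noteq> 0"
  unfolding Dfn_def free_singleton using Df_nz iter_in by (simp add: prod_zero_iff)

lemma D_pos: "free n {x} \<Longrightarrow> D n x > 0"
  using Dfn_nz by simp

lemma iter_cont_at: "free n {x} \<Longrightarrow> continuous (at x within {0..1}) (f ^^ n)"
proof (induction n)
  case 0
  then show ?case by (simp add: id_def)
next
  case (Suc n)
  then have c: "continuous (at x within {0..1}) (f ^^ n)" and x: "F n x \<in> {0..1} - C"
    using iter_in by (auto simp: free_Suc free_singleton)
  have "continuous (at (F n x) within (f ^^ n) ` {0..1}) f"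
    using f_cont_at[OF x] by (rule continuous_within_subset) (use iter_in in blast)
  then show ?case using continuous_within_compose[OF c] by (simp add: comp_def)
qed

lemma Dfn_cont_at: "free n {x} \<Longrightarrow> continuous (at x within {0..1}) (Dfn f Df n)"
proof (induction n)
  case 0
  then show ?case by simp
next
  case (Suc n)
  then have d: "continuous (at x within {0..1}) (Dfn f Df n)"
    and c: "continuous (at x within {0..1}) (f ^^ n)" and x: "F n x \<in> {0..1} - C"
    using iter_in iter_cont_at by (auto simp: free_Suc free_singleton)
  have "continuous (at (F n x) within (f ^^ n) ` {0..1}) Df"
    using Df_cont_at[OF x] by (rule continuous_within_subset) (use iter_in in blast)
  then have "continuous (at x within {0..1}) (\<lambda>x. Df (F n x))"
    using continuous_within_compose[OF c] by (simp add: comp_def)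
  then show ?case using d unfolding Dfn_Suc by (intro continuous_mult)
qed

lemma iter_deriv:
  "free n {x} \<Longrightarrow> (F n has_real_derivative Dfn f Df n x) (at x within {0..1})"
proof (induction n)
  case 0
  then show ?case by (simp add: id_def)
next
  case (Suc n)
  then have c: "(F n has_real_derivative Dfn f Df n x) (at x within {0..1})"
    and x: "F n x \<in> {0..1} - C"
    using iter_in by (auto simp: free_Suc free_singleton)
  have "(f has_real_derivative Df (F n x)) (at (F n x) within (f ^^ n) ` {0..1})"
    using f_deriv[OF x] by (rule DERIV_subset) (use iter_in in blast)
  from DERIV_image_chain[OF this c] show ?case by (simp add: Dfn_Suc mult.commute comp_def)
qed

text \<open>The three claims feed one another in the induction: the image of a free segment is a
  segment missing \<open>C\<close>, so it lies in one component, where f is injective and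
  continuous, and a continuous injection again sends a segment to a segment.\<close>

lemma free_segment:
  assumes "free n (closed_segment u v)"
  shows "inj_on (f ^^ n) (closed_segment u v)" (is ?A)
    and "continuous_on (closed_segment u v) (f ^^ n)" (is ?B)
    and "F n ` closed_segment u v = closed_segment (F n u) (F n v)" (is ?C)
proof -
  have "?A \<and> ?B \<and> ?C"
    using assms
  proof (induction n)
    case 0
    then show ?case by (simp add: id_def)
  next
    case (Suc n)
    then have inj: "inj_on (f ^^ n) (closed_segment u v)"
      and cont: "continuous_on (closed_segment u v) (f ^^ n)"
      and img: "F n ` closed_segment u v = closed_segment (F n u) (F n v)"
      by (auto simp: free_Suc)
    let ?S = "closed_segment (F n u) (F n v)"
    have S: "?S \<subseteq> {0..1} - C"
      using Suc.prems iter_in unfolding img[symmetric] by (auto simp: free_def)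
    have "?S \<subseteq> connected_component_set ({0..1} - C) (F n u)"
      by (rule connected_subset_comp) (use S in auto)
    then have injf: "inj_on f ?S"
      using comp_props(1)[of "F n u"] S inj_on_subset by (metis ends_in_segment(1) subsetD)
    have contf: "continuous_on ?S f"
      unfolding continuous_on_eq_continuous_within
      using S f_cont_at continuous_within_subset by blast
    have A: "inj_on (f ^^ Suc n) (closed_segment u v)"
      using comp_inj_on[OF inj] injf img by simp
    have B: "continuous_on (closed_segment u v) (f ^^ Suc n)"
      using continuous_on_compose[OF cont] contf img by simp
    then show ?case using A continuous_injective_image_segment_1[OF B A] by (simp add: comp_def)
  qed
  then show ?A ?B ?C by auto
qed

lemma segment_props:
  assumes "closed_segment u v \<subseteq> {0..1} - C"
  shows "t \<in> closed_segment u v \<Longrightarrow> (f has_real_derivative Df t) (at t within closed_segment u v)"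
    "continuous_on (closed_segment u v) Df"
    "t \<in> closed_segment u v \<Longrightarrow> Df t \<noteq> 0"
    "convex_on (closed_segment u v) (\<lambda>t. \<bar>Df t\<bar> powr (-1/2))"
proof -
  have u: "u \<in> {0..1} - C" using assms by auto
  have sub: "closed_segment u v \<subseteq> connected_component_set ({0..1} - C) u"
    by (rule connected_subset_comp) (use assms in auto)
  show "t \<in> closed_segment u v \<Longrightarrow> (f has_real_derivative Df t) (at t within closed_segment u v)"
    using f_deriv assms by (meson DERIV_subset Diff_subset order_trans subsetD)
  show "continuous_on (closed_segment u v) Df"
    using comp_props(2)[OF u] sub continuous_on_subset by blast
  show "t \<in> closed_segment u v \<Longrightarrow> Df t \<noteq> 0" using Df_nz assms by blast
  show "convex_on (closed_segment u v) (\<lambda>t. \<bar>Df t\<bar> powr (-1/2))"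
    using convex_on_subset[OF comp_props(4)[OF u] sub] by simp
qed

lemma two_point_iter:
  assumes "free n (closed_segment u v)"
  shows "(u - v)^2 * (D n u * D n v) \<le> (F n u - F n v)^2"
  using assms
proof (induction n)
  case 0
  then show ?case by simp
next
  case (Suc n)
  let ?S = "closed_segment (F n u) (F n v)"
  have fr: "free n (closed_segment u v)" using Suc.prems by (simp add: free_Suc)
  have S: "?S \<subseteq> {0..1} - C"
    using Suc.prems iter_in unfolding free_segment(3)[OF fr, symmetric] by (auto simp: free_def)
  have "(u - v)^2 * (D (Suc n) u * D (Suc n) v)
      = (u - v)^2 * (D n u * D n v) * (\<bar>Df (F n u)\<bar> * \<bar>Df (F n v)\<bar>)"
    by (simp add: Dfn_Suc abs_mult)
  also have "\<dots> \<le> (F n u - F n v)^2 * (\<bar>Df (F n u)\<bar> * \<bar>Df (F n v)\<bar>)"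
    using Suc.IH[OF fr] by (intro mult_right_mono) auto
  also have "\<dots> \<le> (f (F n u) - f (F n v))^2"
    by (rule two_point) (use segment_props[OF S] in auto)
  finally show ?case by simp
qed

lemma three_point_iter:
  assumes "free n (closed_segment a b)" "x \<in> open_segment a b"
  shows "1 / \<bar>x - a\<bar> + 1 / \<bar>x - b\<bar>
    \<le> D n x * (1 / \<bar>F n x - F n a\<bar> + 1 / \<bar>F n x - F n b\<bar>)"
  using assms
proof (induction n)
  case 0
  then show ?case by simp
next
  case (Suc n)
  let ?S = "closed_segment (F n a) (F n b)"
  have fr: "free n (closed_segment a b)" using Suc.prems by (simp add: free_Suc)
  have S: "?S \<subseteq> {0..1} - C"
    using Suc.prems iter_in unfolding free_segment(3)[OF fr, symmetric] by (auto simp: free_def)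
  have xs: "x \<in> closed_segment a b" "x \<noteq> a" "x \<noteq> b" using Suc.prems by (auto simp: open_segment_def)
  have "F n x \<in> ?S" using free_segment(3)[OF fr] xs by blast
  moreover have "F n x \<noteq> F n a" "F n x \<noteq> F n b"
    using free_segment(1)[OF fr] xs by (auto dest: inj_onD)
  ultimately have xo: "F n x \<in> open_segment (F n a) (F n b)"
    by (simp add: open_segment_def)
  have "1 / \<bar>x - a\<bar> + 1 / \<bar>x - b\<bar>
    \<le> D n x * (1 / \<bar>F n x - F n a\<bar> + 1 / \<bar>F n x - F n b\<bar>)"
    using Suc.IH[OF fr] Suc.prems by blast
  also have "\<dots> \<le> D n x * (\<bar>Df (F n x)\<bar> * (1 / \<bar>f (F n x) - f (F n a)\<bar>
      + 1 / \<bar>f (F n x) - f (F n b)\<bar>))"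
    by (intro mult_left_mono three_point[OF xo]) (use segment_props[OF S] in auto)
  finally show ?case by (simp add: Dfn_Suc abs_mult mult.assoc)
qed

text \<open>\<open>f\<^sup>n\<close> is monotone between \<open>x\<close> and \<open>b\<close>; at \<open>b\<close> itself it may be discontinuous, and \<open>Y\<close> is its limit
  from the side of \<open>x\<close>.\<close>
definition is_end :: "nat \<Rightarrow> real \<Rightarrow> real \<Rightarrow> real \<Rightarrow> bool" where
  "is_end n x b Y \<longleftrightarrow> b \<noteq> x \<and> b \<in> {0..1} \<and> free n (closed_segment x b - {b}) \<and>
     (F n \<longlongrightarrow> Y) (at b within closed_segment x b)"

text \<open>Since f^n may jump at b, inequalities are proved on closed free segments ending at s k
  and then passed to the limit. The condition on s 0 keeps every s k at least as far from x as s 0,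
  which bounds the images away from f^n(x).\<close>

lemma is_end_seq:
  assumes "is_end n x b Y"
  obtains s where "\<And>k. s k \<in> open_segment x b" "\<And>k. s 0 \<in> closed_segment x (s k)"
    "s \<longlonglongrightarrow> b" "(\<lambda>k. F n (s k)) \<longlonglongrightarrow> Y"
    "\<And>k. free n (closed_segment x (s k))"
proof -
  \<comment> \<open>The shift by 2 puts s 0 at the midpoint, hence every s k strictly between x and
    b.\<close>
  define s where "s = (\<lambda>k. b + (x - b) * (1 / real (k + 2)))"
  have bx: "b \<noteq> x" using assms by (simp add: is_end_def)
  have q: "0 < 1 / real (k + 2)" "1 / real (k + 2) < 1" "1 / real (k + 2) \<le> 1 / real (0 + 2)" for k
    by (auto simp: field_simps)
  have dec: "s k = (1 - (1 - 1 / real (k + 2))) * x + (1 - 1 / real (k + 2)) * b" for k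
    unfolding s_def by algebra
  have so: "s k \<in> open_segment x b" for k
    unfolding in_segment using bx q[of k]
    by (auto intro!: exI[of _ "1 - 1 / real (k + 2)"] simp: dec simp del: of_nat_add)
  have s0: "s 0 \<in> closed_segment x (s k)" for k
  proof (cases "x < b")
    case True
    define q where "q = 1 / real (k + 2)"
    have "(b - x) * q \<le> (b - x) * (1/2)"
      using True q(3)[of k] by (intro mult_left_mono) (auto simp: q_def)
    moreover have "s 0 = b - (b - x) * (1/2)" "s k = b - (b - x) * q"
      by (simp_all add: s_def q_def algebra_simps diff_divide_distrib)
    ultimately have "s 0 \<le> s k" "x \<le> s 0" using True by argo+
    then show ?thesis by (auto simp: closed_segment_eq_real_ivl)
  next
    case False
    define q where "q = 1 / real (k + 2)"
    have "(x - b) * q \<le> (x - b) * (1/2)"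
      using False q(3)[of k] by (intro mult_left_mono) (auto simp: q_def)
    moreover have "s 0 = b + (x - b) * (1/2)" "s k = b + (x - b) * q"
      by (simp_all add: s_def q_def)
    ultimately have "s k \<le> s 0" "s 0 \<le> x" using False bx by argo+
    then show ?thesis by (auto simp: closed_segment_eq_real_ivl)
  qed
  have "(\<lambda>k. 1 / real (k + 2)) \<longlonglongrightarrow> 0"
    using LIMSEQ_ignore_initial_segment[OF lim_1_over_n, of 2] by (simp add: add.commute)
  then have "s \<longlonglongrightarrow> b + (x - b) * 0" unfolding s_def by (intro tendsto_intros)
  then have sb: "s \<longlonglongrightarrow> b" by simp
  have "filterlim s (at b within closed_segment x b) sequentially"
    unfolding filterlim_at using sb so
    by (auto intro!: always_eventually simp: open_segment_def)
  then have "(\<lambda>k. F n (s k)) \<longlonglongrightarrow> Y"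
    using assms unfolding is_end_def by (auto intro: filterlim_compose[of "f ^^ n"])
  moreover have "free n (closed_segment x (s k))" for k
  proof -
    have "closed_segment x (s k) \<subseteq> closed_segment x b - {b}"
      using so[of k] by (auto simp: closed_segment_eq_real_ivl open_segment_eq_real_ivl split: if_splits)
    then show ?thesis using assms unfolding is_end_def by (meson free_subset)
  qed
  ultimately show ?thesis using that so s0 sb by blast
qed

lemma end_gap:
  assumes "is_end n x b Y" and "\<And>k. s k \<in> open_segment x b" "\<And>k. s 0 \<in> closed_segment x (s k)"
    "(\<lambda>k. F n (s k)) \<longlonglongrightarrow> Y" "\<And>k. free n (closed_segment x (s k))"
  shows "F n x \<noteq> Y"
proof -
  have s0: "s 0 \<noteq> x" using assms(2)[of 0] by (auto simp: open_segment_def)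
  have "F n (s 0) \<noteq> F n x"
    using free_segment(1)[OF assms(5)[of 0]] s0 by (auto dest: inj_onD)
  moreover have "\<bar>F n (s 0) - F n x\<bar> \<le> \<bar>F n (s k) - F n x\<bar>" for k
  proof -
    have "F n (s 0) \<in> closed_segment (F n x) (F n (s k))"
      using free_segment(3)[OF assms(5)[of k]] assms(3)[of k] by blast
    then show ?thesis by (auto simp: closed_segment_eq_real_ivl split: if_splits)
  qed
  then have "\<bar>F n (s 0) - F n x\<bar> \<le> \<bar>Y - F n x\<bar>"
    by (intro tendsto_lowerbound[OF tendsto_rabs[OF tendsto_diff[OF assms(4) tendsto_const]]]) auto
  ultimately show ?thesis by auto
qed

lemma three_point_ends:
  assumes a: "is_end n x a Ya" and b: "is_end n x b Yb" and x: "x \<in> open_segment a b"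
  shows "1 / \<bar>x - a\<bar> + 1 / \<bar>x - b\<bar> \<le> D n x * (1 / \<bar>F n x - Ya\<bar> + 1 / \<bar>F n x - Yb\<bar>)"
    and "F n x \<noteq> Ya" "F n x \<noteq> Yb"
proof -
  obtain s where s: "\<And>k. s k \<in> open_segment x a" "\<And>k. s 0 \<in> closed_segment x (s k)"
    "s \<longlonglongrightarrow> a" "(\<lambda>k. F n (s k)) \<longlonglongrightarrow> Ya" "\<And>k. free n (closed_segment x (s k))"
    using is_end_seq[OF a] by blast
  obtain t where t: "\<And>k. t k \<in> open_segment x b" "\<And>k. t 0 \<in> closed_segment x (t k)"
    "t \<longlonglongrightarrow> b" "(\<lambda>k. F n (t k)) \<longlonglongrightarrow> Yb" "\<And>k. free n (closed_segment x (t k))"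
    using is_end_seq[OF b] by blast
  show na: "F n x \<noteq> Ya" using end_gap[OF a s(1,2,4,5)] .
  show nb: "F n x \<noteq> Yb" using end_gap[OF b t(1,2,4,5)] .
  have ab: "a \<noteq> x" "b \<noteq> x" using a b by (auto simp: is_end_def)
  have "1 / \<bar>x - s k\<bar> + 1 / \<bar>x - t k\<bar>
      \<le> D n x * (1 / \<bar>F n x - F n (s k)\<bar> + 1 / \<bar>F n x - F n (t k)\<bar>)" for k
  proof (rule three_point_iter)
    show "x \<in> open_segment (s k) (t k)"
      using x s(1)[of k] t(1)[of k] by (auto simp: open_segment_eq_real_ivl split: if_splits)
    have "closed_segment (s k) (t k) \<subseteq> closed_segment x (s k) \<union> closed_segment x (t k)"
      by (auto simp: closed_segment_eq_real_ivl split: if_splits)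
    then show "free n (closed_segment (s k) (t k))"
      using s(5)[of k] t(5)[of k] by (meson free_Un free_subset)
  qed
  moreover have "(\<lambda>k. 1 / \<bar>x - s k\<bar> + 1 / \<bar>x - t k\<bar>) \<longlonglongrightarrow> 1 / \<bar>x - a\<bar> + 1 / \<bar>x - b\<bar>"
    using ab by (intro tendsto_intros s t) auto
  moreover have "(\<lambda>k. D n x * (1 / \<bar>F n x - F n (s k)\<bar> + 1 / \<bar>F n x - F n (t k)\<bar>))
      \<longlonglongrightarrow> D n x * (1 / \<bar>F n x - Ya\<bar> + 1 / \<bar>F n x - Yb\<bar>)"
    using na nb by (intro tendsto_intros s t) auto
  ultimately show "1 / \<bar>x - a\<bar> + 1 / \<bar>x - b\<bar> \<le> D n x * (1 / \<bar>F n x - Ya\<bar> + 1 / \<bar>F n x - Yb\<bar>)"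
    using LIMSEQ_le by blast
qed

lemma is_end_free:
  assumes "free n (closed_segment x b)" "b \<noteq> x"
  shows "is_end n x b (F n b)"
proof -
  have b: "b \<in> {0..1}" and sub: "closed_segment x b \<subseteq> {0..1}" using assms by (auto simp: free_def)
  have "continuous (at b within {0..1}) (f ^^ n)"
    using assms by (intro iter_cont_at free_imp_singleton[OF assms(1)]) auto
  then have "continuous (at b within closed_segment x b) (f ^^ n)"
    using sub continuous_within_subset by blast
  then show ?thesis
    using assms b by (auto simp: is_end_def continuous_within intro: free_subset)
qed

lemma inj_on_half_open:
  assumes "free n (closed_segment x b - {b})"
  shows "inj_on (f ^^ n) (closed_segment x b - {b})"
proof (rule inj_onI)
  fix u v assume u: "u \<in> closed_segment x b - {b}" and v: "v \<in> closed_segment x b - {b}"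
    and eq: "F n u = F n v"
  have "closed_segment u v \<subseteq> closed_segment x b - {b}"
    using u v by (auto simp: closed_segment_eq_real_ivl split: if_splits)
  then have "free n (closed_segment u v)" using assms free_subset by blast
  from free_segment(1)[OF this] eq show "u = v" by (auto dest: inj_onD)
qed

text \<open>Injectivity of f^n makes the preimage of \<open>C\<close> in S finite, so one of its
  points is nearest to x. Half-open S is included because \<open>first_hit\<close> cuts segments
  that already stop at a singular end.\<close>

lemma first_hit_on:
  assumes S: "S = closed_segment x e \<or> S = closed_segment x e - {e}" and x: "x \<in> S"
    and fr: "free n S" and inj: "inj_on (f ^^ n) S" and xC: "F n x \<notin> C"
    and hit: "\<not> free (Suc n) S"
  obtains b where "b \<in> closed_segment x e" "b \<noteq> x" "F n b \<in> C" "free n (closed_segment x b)"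
    "free (Suc n) (closed_segment x b - {b})"
proof -
  define Q where "Q = {u \<in> S. F n u \<in> C}"
  have "finite Q"
    using finite_vimage_IntI[OF finite_C inj] by (simp add: Q_def vimage_def Int_def conj_commute)
  moreover have "Q \<noteq> {}" using fr hit by (auto simp: Q_def free_Suc)
  ultimately obtain b where bQ: "b \<in> Q" and min: "\<And>u. u \<in> Q \<Longrightarrow> \<bar>b - x\<bar> \<le> \<bar>u - x\<bar>"
    using ex_min_if_finite[of "(\<lambda>u. \<bar>u - x\<bar>) ` Q"] by (metis (no_types, lifting) finite_imageI
      image_iff image_is_empty linorder_not_less)
  have bS: "b \<in> S" and bC: "F n b \<in> C" using bQ by (auto simp: Q_def)
  have sub: "closed_segment x b \<subseteq> S"
    using S bS by (auto simp: closed_segment_eq_real_ivl split: if_splits)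
  have frb: "free n (closed_segment x b)" using free_subset[OF fr sub] .
  have "F n u \<notin> C" if "u \<in> closed_segment x b - {b}" for u
  proof
    assume "F n u \<in> C"
    then have "u \<in> Q" using that sub by (auto simp: Q_def)
    then show False using min[of u] that
      by (auto simp: closed_segment_eq_real_ivl split: if_splits)
  qed
  then have "free (Suc n) (closed_segment x b - {b})"
    using free_subset[OF frb, of "closed_segment x b - {b}"] by (auto simp: free_Suc)
  moreover have "b \<in> closed_segment x e" using bS S by auto
  moreover have "b \<noteq> x" using bC xC by auto
  ultimately show ?thesis using that bC frb by blast
qed

text \<open>Induction on n: the segment free so far stops at e or at an earlier hit b, and it is cut
  again if some point of it falls into \<open>C\<close> at time n. The hit recorded is thus the one
  that ends the monotone branch, with i the time at which it occurs.\<close>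

lemma first_hit:
  assumes "e \<in> {0..1}" "e \<noteq> x" "free n {x}"
  shows "free n (closed_segment x e) \<or>
    (\<exists>b i. b \<in> closed_segment x e \<and> b \<noteq> x \<and> i < n \<and> F i b \<in> C \<and>
       free i (closed_segment x b) \<and> free n (closed_segment x b - {b}))"
  using assms(3)
proof (induction n)
  case 0
  then have "x \<in> {0..1}" by (simp add: free_singleton)
  then have "closed_segment x e \<subseteq> {0..1}"
    using assms(1) by (auto simp: closed_segment_eq_real_ivl split: if_splits)
  then show ?case by (simp add: free_def)
next
  case (Suc n)
  then have fx: "free n {x}" and xC: "F n x \<notin> C" by (auto simp: free_Suc)
  consider "free n (closed_segment x e)"
    | b i where "b \<in> closed_segment x e" "b \<noteq> x" "i < n" "F i b \<in> C"
       "free i (closed_segment x b)" "free n (closed_segment x b - {b})"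
    using Suc.IH[OF fx] by blast
  then show ?case
  proof cases
    case 1
    show ?thesis
    proof (cases "free (Suc n) (closed_segment x e)")
      case False
      from first_hit_on[OF _ _ 1 free_segment(1)[OF 1] xC False] show ?thesis
        by (metis ends_in_segment(1) lessI)
    qed blast
  next
    case 2
    show ?thesis
    proof (cases "free (Suc n) (closed_segment x b - {b})")
      case True
      then show ?thesis using 2 less_SucI by blast
    next
      case False
      obtain b' where b': "b' \<in> closed_segment x b" "b' \<noteq> x" "F n b' \<in> C" "free n (closed_segment x b')"
          "free (Suc n) (closed_segment x b' - {b'})"
        using first_hit_on[OF _ _ 2(6) inj_on_half_open[OF 2(6)] xC False] 2(2)
        by (metis Diff_iff ends_in_segment(1) singletonD)
      moreover have "b' \<in> closed_segment x e"
        using b'(1) 2(1) by (auto simp: closed_segment_eq_real_ivl split: if_splits)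
      ultimately show ?thesis by blast
    qed
  qed
qed

section \<open>Critical points\<close>

abbreviation "sl c r \<equiv> side_lim f c r"

definition sides :: "(real \<times> bool) set" where
  "sides = {(c, r). c \<in> C \<and> side_ok c r}"

lemma finite_sides: "finite sides"
  by (rule finite_subset[of _ "C \<times> UNIV"]) (auto simp: sides_def finite_C)

lemma at_side_within: "at_side c r = at c within (if r then {c<..} else {..<c})"
  by (simp add: at_side_def)

lemma at_side_nontrivial: "at_side c r \<noteq> bot"
  by (simp add: at_side_def trivial_limit_at_right_real trivial_limit_at_left_real)

lemma side_tendsto: "(c, r) \<in> sides \<Longrightarrow> (f \<longlongrightarrow> sl c r) (at_side c r)"
proof -
  assume "(c, r) \<in> sides"
  moreover have "\<forall>c\<in>C. \<forall>r. side_ok c r \<longrightarrow> (\<exists>L. (f \<longlongrightarrow> L) (at_side c r))"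
    using classA unfolding classA_def by blast
  ultimately obtain L where "(f \<longlongrightarrow> L) (at_side c r)" by (auto simp: sides_def)
  then show ?thesis
    unfolding side_lim_def using tendsto_Lim[OF at_side_nontrivial] by metis
qed

lemma side_of_point:
  assumes "c \<in> C" "x \<in> {0..1}" "x \<noteq> c"
  shows "(c, c < x) \<in> sides"
  using assms C_subset by (auto simp: sides_def side_ok_def)

lemma eventually_at_side_in:
  assumes "(c, r) \<in> sides"
  shows "eventually (\<lambda>x. x \<in> {0..1}) (at_side c r)"
proof -
  have c: "c \<in> {0..1}" using assms C_subset by (auto simp: sides_def)
  show ?thesis
  proof (cases r)
    case True
    then have "c < 1" using assms by (auto simp: sides_def side_ok_def)
    then show ?thesis unfolding at_side_def using True c
      by (auto simp: eventually_at_right[of c 1] intro!: exI[of _ 1])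
  next
    case False
    then have "0 < c" using assms by (auto simp: sides_def side_ok_def)
    then show ?thesis unfolding at_side_def using False c
      by (auto simp: eventually_at_left[of 0 c] intro!: exI[of _ 0])
  qed
qed

lemma sl_in: "(c, r) \<in> sides \<Longrightarrow> sl c r \<in> {0..1}"
proof -
  assume s: "(c, r) \<in> sides"
  have "eventually (\<lambda>x. f x \<in> {0..1}) (at_side c r)"
    using eventually_at_side_in[OF s] by (rule eventually_mono) (rule f_in)
  then show ?thesis
    by (intro Lim_in_closed_set[OF closed_atLeastAtMost _ at_side_nontrivial side_tendsto[OF s]])
qed

lemma sl_orbit: "(c, r) \<in> sides \<Longrightarrow> F n (sl c r) \<notin> C"
proof -
  have "\<forall>c\<in>C. \<forall>r. side_ok c r \<longrightarrow> (\<forall>n. F n (side_lim f c r) \<notin> C)"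
    using classA unfolding classA_def by blast
  then show "(c, r) \<in> sides \<Longrightarrow> F n (sl c r) \<notin> C" by (auto simp: sides_def)
qed

lemma sl_free: "(c, r) \<in> sides \<Longrightarrow> free n {sl c r}"
  using sl_orbit sl_in by (simp add: free_singleton)

lemma order_ge_1: "(c, r) \<in> sides \<Longrightarrow> l c r \<ge> 1"
proof -
  have "\<forall>c\<in>C. \<forall>r. side_ok c r \<longrightarrow> l c r \<ge> 1"
    using classA unfolding classA_def by blast
  then show "(c, r) \<in> sides \<Longrightarrow> l c r \<ge> 1" by (auto simp: sides_def)
qed

text \<open>Critical orbits never meet \<open>C\<close>, so f^n and its derivative are continuous at
  the one-sided critical value.\<close>

lemma iter_tendsto_side:
  assumes s: "(c, r) \<in> sides"
  shows "(F (Suc n) \<longlongrightarrow> F n (sl c r)) (at_side c r)"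
    and "((\<lambda>x. Dfn f Df n (f x)) \<longlongrightarrow> Dfn f Df n (sl c r)) (at_side c r)"
proof -
  have ev: "eventually (\<lambda>x. f x \<in> {0..1}) (at_side c r)"
    using eventually_at_side_in[OF s] by (rule eventually_mono) (rule f_in)
  have "((\<lambda>x. F n (f x)) \<longlongrightarrow> F n (sl c r)) (at_side c r)"
    by (rule continuous_within_tendsto_compose[OF iter_cont_at[OF sl_free[OF s]] ev side_tendsto[OF s]])
  moreover have "F (Suc n) = (\<lambda>x. F n (f x))"
    by (simp add: fun_eq_iff funpow_swap1)
  ultimately show "(F (Suc n) \<longlongrightarrow> F n (sl c r)) (at_side c r)" by simp
  show "((\<lambda>x. Dfn f Df n (f x)) \<longlongrightarrow> Dfn f Df n (sl c r)) (at_side c r)"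
    by (rule continuous_within_tendsto_compose[OF Dfn_cont_at[OF sl_free[OF s]] ev side_tendsto[OF s]])
qed

lemma order_local:
  assumes "(c, r) \<in> sides"
  shows "\<exists>e>0. \<exists>A>0. \<exists>B>0. \<forall>x\<in>{0..1}. \<bar>x - c\<bar> < e \<and> (if r then c < x else x < c) \<longrightarrow>
            A * \<bar>x - c\<bar> powr (l c r - 1) \<le> \<bar>Df x\<bar> \<and> \<bar>Df x\<bar> \<le> B * \<bar>x - c\<bar> powr (l c r - 1) \<and>
            A * \<bar>x - c\<bar> powr (l c r) \<le> \<bar>f x - sl c r\<bar> \<and>
            \<bar>f x - sl c r\<bar> \<le> B * \<bar>x - c\<bar> powr (l c r)"
proof -
  have "\<forall>c\<in>C. \<forall>r. side_ok c r \<longrightarrow> 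
        (\<exists>e>0. \<exists>A>0. \<exists>B>0. \<forall>x\<in>side_nbhd c r e \<inter> {0..1}.
            A * \<bar>x - c\<bar> powr (l c r - 1) \<le> \<bar>Df x\<bar> \<and> \<bar>Df x\<bar> \<le> B * \<bar>x - c\<bar> powr (l c r - 1) \<and>
            A * \<bar>x - c\<bar> powr (l c r) \<le> \<bar>f x - side_lim f c r\<bar> \<and>
            \<bar>f x - side_lim f c r\<bar> \<le> B * \<bar>x - c\<bar> powr (l c r))"
    using classA unfolding classA_def by blast
  then obtain e A B where "e > 0" "A > 0" "B > 0" and H: "\<forall>x\<in>side_nbhd c r e \<inter> {0..1}.
            A * \<bar>x - c\<bar> powr (l c r - 1) \<le> \<bar>Df x\<bar> \<and> \<bar>Df x\<bar> \<le> B * \<bar>x - c\<bar> powr (l c r - 1) \<and>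
            A * \<bar>x - c\<bar> powr (l c r) \<le> \<bar>f x - side_lim f c r\<bar> \<and>
            \<bar>f x - side_lim f c r\<bar> \<le> B * \<bar>x - c\<bar> powr (l c r)"
    using assms unfolding sides_def by blast
  moreover have "x \<in> side_nbhd c r e" if "\<bar>x - c\<bar> < e \<and> (if r then c < x else x < c)" for x
    using that by (auto simp: side_nbhd_def split: if_splits)
  ultimately show ?thesis by blast
qed

section \<open>Distance to the critical set and uniform order estimates\<close>

lemma nearest_in_C:
  obtains c where "c \<in> C" "infdist x C = \<bar>x - c\<bar>"
proof -
  have "closed C" using finite_C finite_imp_closed by blast
  then show ?thesis using infdist_attains_inf[OF _ C_nonempty, of x] that by (metis dist_real_def)
qed

lemma infdist_le_C: "c \<in> C \<Longrightarrow> infdist x C \<le> \<bar>x - c\<bar>"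
  using infdist_le[of c C x] by (simp add: dist_real_def)

lemma infdist_pos: "x \<notin> C \<Longrightarrow> infdist x C > 0"
  by (metis finite_C finite_imp_closed C_nonempty infdist_pos_not_in_closed)

lemma infdist_zero: "x \<in> C \<Longrightarrow> infdist x C = 0"
  by simp

lemma infdist_le_1: "x \<in> {0..1} \<Longrightarrow> infdist x C \<le> 1"
proof -
  assume x: "x \<in> {0..1}"
  obtain c where "c \<in> C" using C_nonempty by blast
  then have "c \<in> {0..1}" using C_subset by blast
  then have "\<bar>x - c\<bar> \<le> 1" using x by auto
  then show ?thesis using infdist_le_C[OF \<open>c \<in> C\<close>, of x] by linarith
qed

lemma infdist_lipschitz: "infdist x C \<le> infdist y C + \<bar>x - y\<bar>"
  using infdist_triangle[of x C y] by (simp add: dist_real_def)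

lemma adjacent_nearest:
  assumes "c \<in> C" "infdist x C = \<bar>x - c\<bar>"
  shows "open_segment c x \<inter> C = {}"
proof -
  have False if "d \<in> open_segment c x" "d \<in> C" for d
    using infdist_le_C[OF that(2), of x] assms that(1)
    by (auto simp: open_segment_eq_real_ivl split: if_splits)
  then show ?thesis by blast
qed

lemma compact_away: "compact {x \<in> {0..1}. infdist x C \<ge> \<eta>}"
proof -
  have "closed {x. \<eta> \<le> infdist x C}"
    by (intro closed_Collect_le continuous_intros)
  then have "compact ({0..1} \<inter> {x. \<eta> \<le> infdist x C})" by (intro compact_Int_closed) auto
  moreover have "{0..1} \<inter> {x. \<eta> \<le> infdist x C} = {x \<in> {0..1}. infdist x C \<ge> \<eta>}" by auto
  ultimately show ?thesis by simp
qed

lemma Df_cont_away: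
  assumes "\<eta> > 0"
  shows "continuous_on {x \<in> {0..1}. infdist x C \<ge> \<eta>} (\<lambda>x. \<bar>Df x\<bar>)"
proof -
  have "continuous_on {x \<in> {0..1}. infdist x C \<ge> \<eta>} Df"
    unfolding continuous_on_eq_continuous_within
  proof
    fix x assume x: "x \<in> {x \<in> {0..1}. infdist x C \<ge> \<eta>}"
    then have "x \<in> {0..1} - C" using infdist_zero assms by auto
    then show "continuous (at x within {x \<in> {0..1}. infdist x C \<ge> \<eta>}) Df"
      by (intro continuous_within_subset[OF Df_cont_at]) auto
  qed
  then show ?thesis by (intro continuous_intros)
qed

lemma Df_lower_away:
  assumes "\<eta> > 0"
  shows "\<exists>\<omega>>0. \<forall>x\<in>{0..1}. infdist x C \<ge> \<eta> \<longrightarrow> \<omega> \<le> \<bar>Df x\<bar>"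
proof (cases "{x \<in> {0..1}. infdist x C \<ge> \<eta>} = {}")
  case True
  then show ?thesis by (auto intro: exI[of _ 1])
next
  case False
  obtain z where z: "z \<in> {x \<in> {0..1}. infdist x C \<ge> \<eta>}"
    "\<forall>y\<in>{x \<in> {0..1}. infdist x C \<ge> \<eta>}. \<bar>Df z\<bar> \<le> \<bar>Df y\<bar>"
    using continuous_attains_inf[OF compact_away False Df_cont_away[OF assms]] by blast
  have "z \<in> {0..1} - C" using z(1) infdist_zero assms by auto
  then show ?thesis using z(2) Df_nz by (intro exI[of _ "\<bar>Df z\<bar>"]) auto
qed

text \<open>Near \<open>C\<close> the order bound suffices because the exponent l - 1 is
  nonnegative; the rest of [0,1] is compact.\<close>

lemma Df_bounded: "\<exists>B>0. \<forall>x\<in>{0..1} - C. \<bar>Df x\<bar> \<le> B"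
proof -
  have "\<exists>\<epsilon>>0. \<forall>\<epsilon>'. 0 < \<epsilon>' \<and> \<epsilon>' \<le> \<epsilon> \<longrightarrow> (\<forall>p\<in>sides. \<forall>x\<in>{0..1}. \<bar>x - fst p\<bar> < \<epsilon>' \<and>
      (if snd p then fst p < x else x < fst p) \<longrightarrow> \<bar>Df x\<bar> \<le> 1 / \<epsilon>')"
  proof (rule finite_uniform_threshold[OF finite_sides])
    fix p assume p: "p \<in> sides"
    obtain c r where pc: "p = (c, r)" by (cases p)
    obtain e B where e: "e > 0" "B > 0" and H: "\<And>x. x \<in> {0..1} \<Longrightarrow> \<bar>x - c\<bar> < e \<Longrightarrow>
        (if r then c < x else x < c) \<Longrightarrow> \<bar>Df x\<bar> \<le> B * \<bar>x - c\<bar> powr (l c r - 1)"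
      using order_local[OF p[unfolded pc]] by metis
    show "\<exists>\<epsilon>>0. \<forall>\<epsilon>'. 0 < \<epsilon>' \<and> \<epsilon>' \<le> \<epsilon> \<longrightarrow> (\<forall>x\<in>{0..1}. \<bar>x - fst p\<bar> < \<epsilon>' \<and>
      (if snd p then fst p < x else x < fst p) \<longrightarrow> \<bar>Df x\<bar> \<le> 1 / \<epsilon>')"
    proof (intro exI[of _ "min e (1 / B)"] conjI allI impI ballI)
      show "0 < min e (1 / B)" using e by simp
      fix \<epsilon>' x assume a: "0 < \<epsilon>' \<and> \<epsilon>' \<le> min e (1 / B)" "x \<in> {0..1}" "\<bar>x - fst p\<bar> < \<epsilon>' \<and>
        (if snd p then fst p < x else x < fst p)"
      have c01: "c \<in> {0..1}" using p pc C_subset by (auto simp: sides_def)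
      have "\<bar>Df x\<bar> \<le> B * \<bar>x - c\<bar> powr (l c r - 1)" using H[of x] a unfolding pc fst_conv snd_conv by (cases r) auto
      also have "\<dots> \<le> B * 1"
        using e a(2) c01 order_ge_1[OF p[unfolded pc]] by (intro mult_left_mono powr_le1) auto
      also have "\<dots> \<le> 1 / \<epsilon>'" using a(1) e by (simp add: field_simps)
      finally show "\<bar>Df x\<bar> \<le> 1 / \<epsilon>'" .
    qed
  qed
  then obtain \<epsilon> where \<epsilon>: "\<epsilon> > 0" "\<And>c r x. (c, r) \<in> sides \<Longrightarrow> x \<in> {0..1} \<Longrightarrow> \<bar>x - c\<bar> < \<epsilon> \<Longrightarrow>
      (if r then c < x else x < c) \<Longrightarrow> \<bar>Df x\<bar> \<le> 1 / \<epsilon>"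
    by fastforce
  have "bounded ((\<lambda>x. \<bar>Df x\<bar>) ` {x \<in> {0..1}. infdist x C \<ge> \<epsilon>})"
    using compact_continuous_image[OF Df_cont_away[OF \<epsilon>(1)] compact_away] compact_imp_bounded by blast
  then obtain K where K: "\<And>x. x \<in> {0..1} \<Longrightarrow> infdist x C \<ge> \<epsilon> \<Longrightarrow> \<bar>Df x\<bar> \<le> K"
    unfolding bounded_iff by auto
  have "\<bar>Df x\<bar> \<le> max K (1 / \<epsilon>)" if x: "x \<in> {0..1} - C" for x
  proof (cases "infdist x C \<ge> \<epsilon>")
    case True
    then show ?thesis using K[of x] x by auto
  next
    case False
    obtain c where c: "c \<in> C" "infdist x C = \<bar>x - c\<bar>" using nearest_in_C by blast
    then have "x \<noteq> c" using x by auto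
    then have "\<bar>Df x\<bar> \<le> 1 / \<epsilon>"
      using \<epsilon>(2)[OF side_of_point[OF c(1)], of x] x c False by auto
    then show ?thesis by simp
  qed
  moreover have "max K (1 / \<epsilon>) > 0" using \<epsilon>(1) by (simp add: less_max_iff_disj)
  ultimately show ?thesis by blast
qed

text \<open>f is monotone between c and x. Comparing with points u tending to c from that side
  replaces a value at c by the one-sided limit.\<close>

lemma monotone_toward_side:
  assumes s: "(c, r) \<in> sides" and x: "x \<in> {0..1} - C" "open_segment c x \<inter> C = {}" "r = (c < x)"
    and y: "y \<in> open_segment c x"
  shows "\<bar>f y - sl c r\<bar> \<le> \<bar>f x - sl c r\<bar>"
proof -
  have c01: "c \<in> {0..1}" using s C_subset by (auto simp: sides_def)
  have "x \<noteq> c" using s x(1) by (auto simp: sides_def)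
  have "eventually (\<lambda>u. u \<in> open_segment c y) (at_side c r)"
  proof (cases r)
    case True
    then have "c < y" using x y by (auto simp: open_segment_eq_real_ivl split: if_splits)
    then show ?thesis unfolding at_side_def using True
      by (auto simp: eventually_at_right[of c y] open_segment_eq_real_ivl intro!: exI[of _ y])
  next
    case False
    then have "y < c" using x y \<open>x \<noteq> c\<close> by (auto simp: open_segment_eq_real_ivl split: if_splits)
    then show ?thesis unfolding at_side_def using False
      by (auto simp: eventually_at_left[of y c] open_segment_eq_real_ivl intro!: exI[of _ y])
  qed
  then have ev: "eventually (\<lambda>u. \<bar>f y - f u\<bar> \<le> \<bar>f x - f u\<bar>) (at_side c r)"
  proof (rule eventually_mono)
    fix u assume u: "u \<in> open_segment c y"
    have sub: "closed_segment u x \<subseteq> open_segment c x \<union> {x}"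
      using u y by (auto simp: open_segment_eq_real_ivl closed_segment_eq_real_ivl split: if_splits)
    moreover have "open_segment c x \<subseteq> {0..1}"
      using c01 x(1) by (auto simp: open_segment_eq_real_ivl split: if_splits)
    ultimately have "free (Suc 0) (closed_segment u x)"
      using x by (auto simp: free_def)
    from free_segment(3)[OF this] have "f ` closed_segment u x = closed_segment (f u) (f x)" by simp
    moreover have "y \<in> closed_segment u x"
      using u y by (auto simp: open_segment_eq_real_ivl closed_segment_eq_real_ivl split: if_splits)
    ultimately have "f y \<in> closed_segment (f u) (f x)" by blast
    then show "\<bar>f y - f u\<bar> \<le> \<bar>f x - f u\<bar>"
      by (auto simp: closed_segment_eq_real_ivl split: if_splits)
  qed
  show ?thesis
    by (rule tendsto_le[OF at_side_nontrivial _ _ ev]) (intro tendsto_intros side_tendsto[OF s])+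
qed

text \<open>The order estimates with one pair of constants, extended from small neighbourhoods to
  the whole of each component next to c. Only the lower bound for \<open>Df\<close> stays local: the
  derivative may vanish at the other end of the component.\<close>

definition order_consts :: "real \<Rightarrow> real \<Rightarrow> bool" where
  "order_consts A B \<longleftrightarrow> A > 0 \<and> B > 0 \<and> (\<forall>c\<in>C. \<forall>x\<in>{0..1} - C. open_segment c x \<inter> C = {} \<longrightarrow>
     A * \<bar>x - c\<bar> powr l c (c < x) \<le> \<bar>f x - sl c (c < x)\<bar> \<and>
     \<bar>f x - sl c (c < x)\<bar> \<le> B * \<bar>x - c\<bar> powr l c (c < x) \<and>
     \<bar>Df x\<bar> \<le> B * \<bar>x - c\<bar> powr (l c (c < x) - 1) \<and>
     (\<bar>x - c\<bar> < A \<longrightarrow> A * \<bar>x - c\<bar> powr (l c (c < x) - 1) \<le> \<bar>Df x\<bar>))"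

lemma order_constsD:
  assumes "order_consts A B" "c \<in> C" "x \<in> {0..1} - C" "open_segment c x \<inter> C = {}"
  shows "A * \<bar>x - c\<bar> powr l c (c < x) \<le> \<bar>f x - sl c (c < x)\<bar>"
    "\<bar>f x - sl c (c < x)\<bar> \<le> B * \<bar>x - c\<bar> powr l c (c < x)"
    "\<bar>Df x\<bar> \<le> B * \<bar>x - c\<bar> powr (l c (c < x) - 1)"
    "\<bar>x - c\<bar> < A \<Longrightarrow> A * \<bar>x - c\<bar> powr (l c (c < x) - 1) \<le> \<bar>Df x\<bar>"
  using assms unfolding order_consts_def by blast+

lemma order_consts_exist: "\<exists>A B. order_consts A B"
proof -
  obtain B2 where B2: "B2 > 0" "\<And>x. x \<in> {0..1} - C \<Longrightarrow> \<bar>Df x\<bar> \<le> B2" using Df_bounded by blast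
  let ?P = "\<lambda>c r \<epsilon> x. \<epsilon> * \<bar>x - c\<bar> powr l c r \<le> \<bar>f x - sl c r\<bar> \<and>
       \<bar>f x - sl c r\<bar> \<le> (1 / \<epsilon>) * \<bar>x - c\<bar> powr l c r \<and>
       \<bar>Df x\<bar> \<le> (1 / \<epsilon>) * \<bar>x - c\<bar> powr (l c r - 1) \<and>
       (\<bar>x - c\<bar> < \<epsilon> \<longrightarrow> \<epsilon> * \<bar>x - c\<bar> powr (l c r - 1) \<le> \<bar>Df x\<bar>)"
  have "\<exists>\<epsilon>>0. \<forall>\<epsilon>'. 0 < \<epsilon>' \<and> \<epsilon>' \<le> \<epsilon> \<longrightarrow> (\<forall>p\<in>sides. \<forall>x\<in>{0..1} - C. open_segment (fst p) x \<inter> C = {} \<and>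
      snd p = (fst p < x) \<longrightarrow> ?P (fst p) (snd p) \<epsilon>' x)"
  proof (rule finite_uniform_threshold[OF finite_sides])
    fix p assume p: "p \<in> sides"
    obtain c r where pc: "p = (c, r)" by (cases p)
    have s: "(c, r) \<in> sides" using p pc by simp
    have c01: "c \<in> {0..1}" "c \<in> C" using p pc C_subset by (auto simp: sides_def)
    define L where "L = l c r"
    have L: "L \<ge> 1" using order_ge_1[OF s] by (simp add: L_def)
    obtain e A B where e: "e > 0" "A > 0" "B > 0" and H: "\<And>x. x \<in> {0..1} \<Longrightarrow> \<bar>x - c\<bar> < e \<Longrightarrow>
        (if r then c < x else x < c) \<Longrightarrow> A * \<bar>x - c\<bar> powr (L - 1) \<le> \<bar>Df x\<bar> \<and> \<bar>Df x\<bar> \<le> B * \<bar>x - c\<bar> powr (L - 1) \<and>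
            A * \<bar>x - c\<bar> powr L \<le> \<bar>f x - sl c r\<bar> \<and>
            \<bar>f x - sl c r\<bar> \<le> B * \<bar>x - c\<bar> powr L"
      using order_local[OF s] unfolding L_def by metis
    \<comment> \<open>\<epsilon> plays the role of A and 1/\<epsilon> that of B. The entries A and
      1/B serve the local estimates; the remaining ones serve points at distance at least e from c,
      where the depth lies between A (e/2)^L and 1 and the derivative is at most B2.\<close>
    define \<epsilon>0 where "\<epsilon>0 = Min {e, A, 1 / B, A * (e / 2) powr L, e powr L, e powr (L - 1) / B2}"
    have \<epsilon>0: "\<epsilon>0 > 0" using e B2 by (simp add: \<epsilon>0_def)
    have "?P c r \<epsilon> x" if \<epsilon>: "0 < \<epsilon>" "\<epsilon> \<le> \<epsilon>0" and x: "x \<in> {0..1} - C" "open_segment c x \<inter> C = {}"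
      and r: "r = (c < x)" for \<epsilon> x
    proof -
      have b: "\<epsilon> \<le> e" "\<epsilon> \<le> A" "\<epsilon> \<le> 1 / B" "\<epsilon> \<le> A * (e / 2) powr L" "\<epsilon> \<le> e powr L" "\<epsilon> \<le> e powr (L - 1) / B2"
        using \<epsilon>(2) by (simp_all add: \<epsilon>0_def)
      have B: "B \<le> 1 / \<epsilon>" using b(3) \<epsilon> e by (simp add: field_simps)
      have xc: "x \<noteq> c" using x c01 by auto
      then have rr: "if r then c < x else x < c" using r by auto
      have x1: "\<bar>x - c\<bar> \<le> 1" using x c01 by auto
      show ?thesis
      proof (cases "\<bar>x - c\<bar> < e")
        case True
        note h = H[OF _ True rr, folded L_def]
        have p: "\<bar>x - c\<bar> powr L \<ge> 0" "\<bar>x - c\<bar> powr (L - 1) \<ge> 0" by auto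
        show ?thesis
          using h x mult_right_mono[OF b(2) p(1)] mult_right_mono[OF b(2) p(2)]
            mult_right_mono[OF B p(1)] mult_right_mono[OF B p(2)]
          unfolding L_def[symmetric] by auto
      next
        case False
        \<comment> \<open>A point still inside the local neighbourhood; by monotonicity its depth
          bounds that of x from below.\<close>
        define y where "y = (if r then c + e / 2 else c - e / 2)"
        have yo: "y \<in> open_segment c x"
          using False e r xc by (auto simp: y_def open_segment_eq_real_ivl)
        have yc: "\<bar>y - c\<bar> = e / 2" using e by (auto simp: y_def)
        have "y \<in> {0..1}" using yo x(1) c01 by (auto simp: open_segment_eq_real_ivl split: if_splits)
        then have "A * (e / 2) powr L \<le> \<bar>f y - sl c r\<bar>"
          using H[of y] yc e by (auto simp: y_def)
        also have "\<dots> \<le> \<bar>f x - sl c r\<bar>" by (rule monotone_toward_side[OF s x r yo])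
        finally have 1: "\<epsilon> \<le> \<bar>f x - sl c r\<bar>" using b(4) by linarith
        have "\<bar>x - c\<bar> powr L \<le> 1" using x1 L by (intro powr_le1) auto
        then have "\<epsilon> * \<bar>x - c\<bar> powr L \<le> \<epsilon> * 1" using \<epsilon> by (intro mult_left_mono) auto
        then have 2: "\<epsilon> * \<bar>x - c\<bar> powr L \<le> \<bar>f x - sl c r\<bar>" using 1 by simp
        have "\<bar>f x - sl c r\<bar> \<le> 1" using f_in[of x] sl_in[OF s] x by auto
        moreover have "e powr L \<le> \<bar>x - c\<bar> powr L" using False e L by (intro powr_mono2) auto
        then have "1 \<le> (1 / \<epsilon>) * \<bar>x - c\<bar> powr L" using b(5) \<epsilon> by (simp add: field_simps)
        ultimately have 3: "\<bar>f x - sl c r\<bar> \<le> (1 / \<epsilon>) * \<bar>x - c\<bar> powr L" by linarith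
        have "e powr (L - 1) \<le> \<bar>x - c\<bar> powr (L - 1)" using False e L by (intro powr_mono2) auto
        then have "B2 \<le> (1 / \<epsilon>) * \<bar>x - c\<bar> powr (L - 1)" using b(6) \<epsilon> B2 by (simp add: field_simps)
        then have 4: "\<bar>Df x\<bar> \<le> (1 / \<epsilon>) * \<bar>x - c\<bar> powr (L - 1)" using B2(2)[OF x(1)] by linarith
        show ?thesis using 2 3 4 False b(1) unfolding L_def by auto
      qed
    qed
    then show "\<exists>\<epsilon>>0. \<forall>\<epsilon>'. 0 < \<epsilon>' \<and> \<epsilon>' \<le> \<epsilon> \<longrightarrow> (\<forall>x\<in>{0..1} - C. open_segment (fst p) x \<inter> C = {} \<and>
      snd p = (fst p < x) \<longrightarrow> ?P (fst p) (snd p) \<epsilon>' x)"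
      using \<epsilon>0 unfolding pc fst_conv snd_conv by blast
  qed
  then obtain \<epsilon> where \<epsilon>: "\<epsilon> > 0" and H: "\<forall>p\<in>sides. \<forall>x\<in>{0..1} - C. open_segment (fst p) x \<inter> C = {} \<and>
      snd p = (fst p < x) \<longrightarrow> ?P (fst p) (snd p) \<epsilon> x" by blast
  have "order_consts \<epsilon> (1 / \<epsilon>)"
    unfolding order_consts_def
  proof (intro conjI[of "\<epsilon> > 0"] conjI[of "1 / \<epsilon> > 0"] ballI impI)
    fix c x assume c: "c \<in> C" and x: "x \<in> {0..1} - C" and o: "open_segment c x \<inter> C = {}"
    have "(c, c < x) \<in> sides" using side_of_point[OF c] x c by auto
    from bspec[OF bspec[OF H this] x] o show "?P c (c < x) \<epsilon> x" by simp
  qed (use \<epsilon> in auto)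
  then show ?thesis by blast
qed

lemma orders_bounded: "\<exists>\<Lambda>\<ge>1. \<forall>(c, r)\<in>sides. l c r \<le> \<Lambda>"
proof -
  define \<Lambda> where "\<Lambda> = Max (insert 1 ((\<lambda>(c, r). l c r) ` sides))"
  have "finite (insert 1 ((\<lambda>(c, r). l c r) ` sides))" using finite_sides by simp
  then show ?thesis
    by (intro exI[of _ \<Lambda>]) (auto simp: \<Lambda>_def intro!: Max_ge intro: rev_image_eqI)
qed

lemma C_gap: "\<exists>g>0. \<forall>c\<in>C. \<forall>c'\<in>C. c \<noteq> c' \<longrightarrow> g \<le> \<bar>c - c'\<bar>"
proof -
  have "\<exists>\<epsilon>>0. \<forall>\<epsilon>'. 0 < \<epsilon>' \<and> \<epsilon>' \<le> \<epsilon> \<longrightarrow> (\<forall>p\<in>C \<times> C. fst p \<noteq> snd p \<longrightarrow> \<epsilon>' \<le> \<bar>fst p - snd p\<bar>)"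
  proof (rule finite_uniform_threshold)
    show "finite (C \<times> C)" using finite_C by simp
    fix p :: "real \<times> real"
    show "\<exists>\<epsilon>>0. \<forall>\<epsilon>'. 0 < \<epsilon>' \<and> \<epsilon>' \<le> \<epsilon> \<longrightarrow> fst p \<noteq> snd p \<longrightarrow> \<epsilon>' \<le> \<bar>fst p - snd p\<bar>"
      by (cases "fst p = snd p") (auto intro: exI[of _ 1] exI[of _ "\<bar>fst p - snd p\<bar>"])
  qed
  then show ?thesis by fastforce
qed

lemma nearest_props:
  shows "nearest C y \<in> C" "c \<in> C \<Longrightarrow> \<bar>y - nearest C y\<bar> \<le> \<bar>y - c\<bar>" "infdist y C = \<bar>y - nearest C y\<bar>"
proof -
  obtain c0 where c0: "c0 \<in> C" "infdist y C = \<bar>y - c0\<bar>" using nearest_in_C by blast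
  then have "\<exists>c'. c' \<in> C \<and> (\<forall>c''\<in>C. \<bar>y - c'\<bar> \<le> \<bar>y - c''\<bar>)"
    using infdist_le_C[of _ y] by (intro exI[of _ c0]) auto
  then have *: "nearest C y \<in> C \<and> (\<forall>c''\<in>C. \<bar>y - nearest C y\<bar> \<le> \<bar>y - c''\<bar>)"
    unfolding nearest_def by (rule someI_ex)
  then show "nearest C y \<in> C" "c \<in> C \<Longrightarrow> \<bar>y - nearest C y\<bar> \<le> \<bar>y - c\<bar>" by auto
  show "infdist y C = \<bar>y - nearest C y\<bar>"
    using * c0 infdist_le_C[of "nearest C y" y] by force
qed

text \<open>Let d be the distance of y to \<open>C\<close>, a the order at c and a' that at the
  point of \<open>C\<close> nearest to y. Replacing the last derivative factor by its bound B d^(a'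
  - 1) leaves d^(1 - a) in the first summability term and d^(1 - a') in the second, each at most a
  small multiple of the derivative up to y. The two exponents answer two different situations in
  \<open>end_estimate\<close>.\<close>

lemma deriv_growth_side:
  assumes s: "(c, r) \<in> sides"
  shows "eventually (\<lambda>m. let y = F m (sl c r); ct = nearest C y; d = \<bar>y - ct\<bar> in
       M * d powr (1 - l c r) \<le> D m (sl c r) \<and> M * d powr (1 - l ct (ct < y)) \<le> D m (sl c r)) sequentially"
proof -
  obtain A B where AB: "order_consts A B" using order_consts_exist by blast
  then have B: "B > 0" by (simp add: order_consts_def)
  \<comment> \<open>Small enough to absorb M and B; being at most 1, it also allows the root 1/a to
    be removed.\<close>
  define \<epsilon> where "\<epsilon> = min 1 (1 / (B * (\<bar>M\<bar> + 1)))"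
  have \<epsilon>: "0 < \<epsilon>" "\<epsilon> \<le> 1" "M * (B * \<epsilon>) \<le> 1"
  proof -
    show "0 < \<epsilon>" "\<epsilon> \<le> 1" using B by (auto simp: \<epsilon>_def)
    have "\<bar>M\<bar> * (B * \<epsilon>) \<le> \<bar>M\<bar> * (B * (1 / (B * (\<bar>M\<bar> + 1))))"
      using B by (intro mult_left_mono) (auto simp: \<epsilon>_def)
    also have "\<dots> = \<bar>M\<bar> / (\<bar>M\<bar> + 1)" using B by simp
    also have "\<dots> \<le> 1" by simp
    finally have "\<bar>M\<bar> * (B * \<epsilon>) \<le> 1" .
    moreover have "M * (B * \<epsilon>) \<le> \<bar>M\<bar> * (B * \<epsilon>)"
      by (rule mult_right_mono) (use B \<open>0 < \<epsilon>\<close> in auto)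
    ultimately show "M * (B * \<epsilon>) \<le> 1" by (rule order_trans[rotated])
  qed
  let ?q = "\<lambda>m. let n = Suc m; y = F m (sl c r); ct = nearest C y in
            (\<bar>y - ct\<bar> powr (l ct (ct < y)) /
              (\<bar>y - ct\<bar> powr (l c r) * \<bar>Dfn f Df n (sl c r)\<bar>)) powr (1 / l c r)"
  have "summable ?q"
    using classA s unfolding classA_def sides_def by blast
  then have ev1: "eventually (\<lambda>m. ?q m < \<epsilon>) sequentially"
    using \<epsilon>(1) by (intro order_tendstoD(2)[OF summable_LIMSEQ_zero])
  have "summable (\<lambda>m. \<bar>Dfn f Df (Suc m) (sl c r)\<bar> powr (- 1 / l c r))"
    using classA s unfolding classA_def sides_def by blast
  then have ev2: "eventually (\<lambda>m. \<bar>Dfn f Df (Suc m) (sl c r)\<bar> powr (- 1 / l c r) < \<epsilon>) sequentially"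
    using \<epsilon>(1) by (intro order_tendstoD(2)[OF summable_LIMSEQ_zero])
  show ?thesis
    using ev1 ev2
  proof eventually_elim
    case (elim m)
    define y where "y = F m (sl c r)"
    define ct where "ct = nearest C y"
    define d where "d = \<bar>y - ct\<bar>"
    define a where "a = l c r"
    define a' where "a' = l ct (ct < y)"
    define E where "E = D m (sl c r)"
    have y: "y \<in> {0..1} - C" using sl_orbit[OF s] iter_in[OF sl_in[OF s]] by (simp add: y_def)
    have ct: "ct \<in> C" "infdist y C = \<bar>y - ct\<bar>" using nearest_props by (auto simp: ct_def)
    have d: "d > 0" using y ct by (auto simp: d_def)
    have E: "E > 0" using D_pos[OF sl_free[OF s]] by (simp add: E_def)
    have a: "a \<ge> 1" using order_ge_1[OF s] by (simp add: a_def)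
    have E': "D (Suc m) (sl c r) = E * \<bar>Df y\<bar>" by (simp add: Dfn_Suc abs_mult E_def y_def)
    have Dy: "\<bar>Df y\<bar> \<le> B * d powr (a' - 1)" "\<bar>Df y\<bar> > 0"
      using AB ct y adjacent_nearest[OF ct] Df_nz[OF y] unfolding order_consts_def a'_def d_def by auto
    have "(d powr a' / (d powr a * (E * \<bar>Df y\<bar>))) powr (1 / a) < \<epsilon>"
      using elim(1) E' by (simp add: Let_def y_def ct_def d_def a_def a'_def)
    from powr_root_less[OF this a \<epsilon>(1,2)]
    have "d powr a' < \<epsilon> * (d powr a * (E * \<bar>Df y\<bar>))"
      using d E Dy by (simp add: pos_divide_less_eq)
    also have "\<dots> \<le> \<epsilon> * (d powr a * (E * (B * d powr (a' - 1))))"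
      using Dy d E \<epsilon> by (intro mult_left_mono) auto
    finally have "d powr a' < (\<epsilon> * E * B) * (d powr a * d powr (a' - 1))" by (simp add: algebra_simps)
    moreover have "d powr a' = d powr (1 - a) * (d powr a * d powr (a' - 1))"
      using d by (simp flip: powr_add)
    ultimately have "d powr (1 - a) * (d powr a * d powr (a' - 1)) < (\<epsilon> * E * B) * (d powr a * d powr (a' - 1))"
      by simp
    moreover have "d powr a * d powr (a' - 1) > 0" using d by simp
    ultimately have 1: "d powr (1 - a) < \<epsilon> * E * B" by (simp only: mult_less_cancel_right_pos)
    have "(1 / (E * \<bar>Df y\<bar>)) powr (1 / a) < \<epsilon>"
      using elim(2) E' E Dy(2) by (simp add: a_def powr_minus_divide powr_divide)
    from powr_root_less[OF this a \<epsilon>(1,2)] have "1 < \<epsilon> * (E * \<bar>Df y\<bar>)"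
      using E Dy by (simp add: pos_divide_less_eq)
    also have "\<dots> \<le> \<epsilon> * (E * (B * d powr (a' - 1)))"
      using Dy d E \<epsilon> by (intro mult_left_mono) auto
    finally have "1 < (\<epsilon> * E * B) * d powr (a' - 1)" by (simp add: algebra_simps)
    moreover have "1 = d powr (1 - a') * d powr (a' - 1)" using d by (simp flip: powr_add)
    ultimately have "d powr (1 - a') * d powr (a' - 1) < (\<epsilon> * E * B) * d powr (a' - 1)" by simp
    moreover have "d powr (a' - 1) > 0" using d by simp
    ultimately have 2: "d powr (1 - a') < \<epsilon> * E * B" by (simp only: mult_less_cancel_right_pos)
    have fin: "M * z \<le> E" if "z < \<epsilon> * E * B" "z > 0" for z
    proof (cases "M \<ge> 0")
      case True
      then have "M * z \<le> M * (\<epsilon> * E * B)" using that by (intro mult_left_mono) auto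
      also have "\<dots> = (M * (B * \<epsilon>)) * E" by simp
      also have "\<dots> \<le> 1 * E" using \<epsilon>(3) E by (intro mult_right_mono) auto
      finally show ?thesis by simp
    next
      case False
      then have "M * z \<le> 0" using that by (simp add: mult_nonpos_nonneg)
      then show ?thesis using E by linarith
    qed
    show ?case
      using fin[OF 1] fin[OF 2] d unfolding Let_def y_def[symmetric] ct_def[symmetric] d_def[symmetric]
        a_def[symmetric] a'_def[symmetric] E_def[symmetric] by simp
  qed
qed

lemma deriv_growth:
  "\<exists>m0. \<forall>m\<ge>m0. \<forall>(c, r)\<in>sides. M * infdist (F m (sl c r)) C powr (1 - l c r) \<le> D m (sl c r) \<and>
     M * infdist (F m (sl c r)) C powr (1 - l (nearest C (F m (sl c r)))
        (nearest C (F m (sl c r)) < F m (sl c r))) \<le> D m (sl c r)"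
proof -
  have "eventually (\<lambda>m. \<forall>p\<in>sides. case p of (c, r) \<Rightarrow> M * infdist (F m (sl c r)) C powr (1 - l c r) \<le> D m (sl c r) \<and>
     M * infdist (F m (sl c r)) C powr (1 - l (nearest C (F m (sl c r)))
        (nearest C (F m (sl c r)) < F m (sl c r))) \<le> D m (sl c r)) sequentially"
    apply (rule eventually_ball_finite[OF finite_sides])
    using deriv_growth_side[of _ _ M] by (auto simp: Let_def nearest_props(3))
  then show ?thesis by (simp add: eventually_sequentially)
qed

lemma critical_orbit_gap:
  "\<exists>\<kappa>>0. \<forall>m<m0. \<forall>(c, r)\<in>sides. \<kappa> \<le> infdist (F m (sl c r)) C"
proof -
  have "\<exists>\<epsilon>>0. \<forall>\<epsilon>'. 0 < \<epsilon>' \<and> \<epsilon>' \<le> \<epsilon> \<longrightarrow> (\<forall>p\<in>{..<m0::nat} \<times> sides.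
      \<epsilon>' \<le> infdist (F (fst p) (sl (fst (snd p)) (snd (snd p)))) C)"
  proof (rule finite_uniform_threshold)
    show "finite ({..<m0} \<times> sides)" using finite_sides by simp
    fix p assume "p \<in> {..<m0} \<times> sides"
    then have "infdist (F (fst p) (sl (fst (snd p)) (snd (snd p)))) C > 0"
      by (intro infdist_pos sl_orbit) auto
    then show "\<exists>\<epsilon>>0. \<forall>\<epsilon>'. 0 < \<epsilon>' \<and> \<epsilon>' \<le> \<epsilon> \<longrightarrow> \<epsilon>' \<le> infdist (F (fst p) (sl (fst (snd p)) (snd (snd p)))) C"
      by blast
  qed
  then obtain \<kappa> where "\<kappa> > 0" "\<forall>p\<in>{..<m0} \<times> sides. \<kappa> \<le> infdist (F (fst p) (sl (fst (snd p)) (snd (snd p)))) C"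
    by blast
  then show ?thesis by (intro exI[of _ \<kappa>]) fastforce
qed

section \<open>Ends of monotone branches\<close>

text \<open>The quantity compared with \<delta> in the definition of the neighbourhoods. At u = c
  the test c < u selects the left limit by default; this does no harm in \<open>adm\<close>, where
  the comparison by distance then holds.\<close>

definition depth :: "real \<Rightarrow> real \<Rightarrow> real" where
  "depth c u = \<bar>f u - sl c (c < u)\<bar>"

text \<open>This weakening of ``\<open>n\<close> is the first entry time into a neighbourhood of \<open>C\<close>'' allows each earlier
  point to be compared with \<open>x\<^sub>n\<close> either by distance or by depth. It covers both closest approaches
  and first entries into \<open>N\<^sub>\<delta>\<close>, and it is inherited by tails of the orbit.\<close>
definition adm :: "real \<Rightarrow> nat \<Rightarrow> real \<Rightarrow> bool" where
  "adm \<rho> n x \<longleftrightarrow> free n {x} \<and> (\<exists>c\<in>C. \<bar>F n x - c\<bar> \<le> \<rho> \<and>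
     (\<forall>j<n. \<forall>c'\<in>C. \<bar>F n x - c\<bar> \<le> \<bar>F j x - c'\<bar> \<or> depth c (F n x) \<le> depth c' (F j x)))"

lemma segment_end_nontrivial:
  fixes x b :: real
  assumes "b \<noteq> x"
  shows "at b within closed_segment x b \<noteq> bot"
proof -
  have "b \<in> closure (open_segment x b)" using assms by (simp add: closure_open_segment)
  moreover have "open_segment x b \<subseteq> closed_segment x b - {b}" by (auto simp: open_segment_def)
  ultimately have "b \<in> closure (closed_segment x b - {b})" using closure_mono by blast
  then show ?thesis using not_trivial_limit_within by blast
qed

text \<open>The orbit is split at time i, when b reaches c. The first inequality is applied to f^i
  between x and b and to f^m between f w and points tending to \<sigma>; the factor |Df w| joins the
  two. The relevant side of c is that of w, because f^i maps the half-open segment to one side of c,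
  and Y is where the orbit of this one-sided critical value stands at time n.\<close>

lemma hit_end:
  assumes bx: "b \<noteq> x" and i: "i < n" and hit: "F i b \<in> C"
    and fi: "free i (closed_segment x b)" and fn: "free n (closed_segment x b - {b})"
  defines "c \<equiv> F i b" and "w \<equiv> F i x" and "m \<equiv> n - Suc i"
  defines "\<sigma> \<equiv> sl c (c < w)"
  defines "Y \<equiv> F m \<sigma>"
  shows "(c, c < w) \<in> sides" "w \<in> {0..1} - C" "open_segment c w \<inter> C = {}" "is_end n x b Y"
    "D n x * D i b * (x - b)^2 * (D m \<sigma> * (f w - \<sigma>)^2) \<le> (w - c)^2 * \<bar>Df w\<bar> * (F n x - Y)^2"
proof -
  let ?H = "closed_segment x b - {b}"
  let ?F = "at b within closed_segment x b"
  have n: "n = Suc i + m" using i by (simp add: m_def)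
  have xH: "x \<in> ?H" using bx by auto
  have w: "w \<in> {0..1} - C"
    using fn xH i iter_in[of x i] unfolding w_def free_def by auto
  show "w \<in> {0..1} - C" by (rule w)
  have cC: "c \<in> C" using hit by (simp add: c_def)
  have wc: "w \<noteq> c" using w cC by auto
  have s: "(c, c < w) \<in> sides" using side_of_point[OF cC] w wc by auto
  show "(c, c < w) \<in> sides" by (rule s)
  note seg = free_segment[OF fi, folded c_def w_def]
  have side: "F i u \<in> closed_segment w c - {c}" if "u \<in> ?H" for u
  proof -
    have "F i u \<in> closed_segment w c" using seg(3) that by blast
    moreover have "F i u \<noteq> c"
      using seg(1) that unfolding c_def by (metis DiffE ends_in_segment(2) inj_onD singletonI)
    ultimately show ?thesis by simp
  qed
  have "closed_segment w c - {c} \<subseteq> (f ^^ i) ` ?H"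
    using seg(3) unfolding c_def by blast
  then have cl: "(closed_segment w c - {c}) \<inter> C = {}"
    using fn i unfolding free_def by blast
  have "open_segment c w \<subseteq> closed_segment w c - {c}"
    by (auto simp: open_segment_def closed_segment_commute)
  then show "open_segment c w \<inter> C = {}" using cl by blast
  have evH: "eventually (\<lambda>u. u \<in> ?H) ?F"
    by (simp add: eventually_at_filter)
  have sub01: "closed_segment x b \<subseteq> {0..1}" using fi by (simp add: free_def)
  have "continuous (at b within {0..1}) (f ^^ i)"
    by (rule iter_cont_at[OF free_imp_singleton[OF fi]]) simp
  then have lim1: "(F i \<longlongrightarrow> c) ?F"
    using continuous_within_subset[OF _ sub01] unfolding continuous_within c_def by blast
  have "filterlim (f ^^ i) (at_side c (c < w)) ?F"
    unfolding at_side_within filterlim_at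
  proof (intro conjI lim1)
    show "eventually (\<lambda>u. F i u \<in> (if c < w then {c<..} else {..<c}) \<and> F i u \<noteq> c) ?F"
      using evH
    proof (rule eventually_mono)
      fix u assume "u \<in> ?H"
      from side[OF this] wc show "F i u \<in> (if c < w then {c<..} else {..<c}) \<and> F i u \<noteq> c"
        by (auto simp: closed_segment_eq_real_ivl split: if_splits)
    qed
  qed
  then have lim2: "((\<lambda>u. f (F i u)) \<longlongrightarrow> \<sigma>) ?F"
    using filterlim_compose[OF side_tendsto[OF s]] by (simp add: \<sigma>_def)
  have ev01: "eventually (\<lambda>u. f (F i u) \<in> {0..1}) ?F"
    using evH by (rule eventually_mono) (use f_in iter_in sub01 in blast)
  have f\<sigma>: "free m {\<sigma>}" using sl_free[OF s] by (simp add: \<sigma>_def)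
  have iter_n: "F n u = F m (f (F i u))" for u
    unfolding n iter_add by simp
  have lim3: "(F n \<longlongrightarrow> Y) ?F"
    unfolding iter_n Y_def
    by (rule continuous_within_tendsto_compose[OF iter_cont_at[OF f\<sigma>] ev01 lim2])
  have lim4: "((\<lambda>u. Dfn f Df m (f (F i u))) \<longlongrightarrow> Dfn f Df m \<sigma>) ?F"
    by (rule continuous_within_tendsto_compose[OF Dfn_cont_at[OF f\<sigma>] ev01 lim2])
  show "is_end n x b Y"
    using bx sub01 fn lim3 by (auto simp: is_end_def)
  have ineq: "(f w - f (F i u))^2 * (D m (f w) * D m (f (F i u))) \<le> (F n x - F n u)^2"
    if u: "u \<in> ?H" for u
  proof -
    have "closed_segment x u \<subseteq> ?H"
      using u by (auto simp: closed_segment_eq_real_ivl split: if_splits)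
    then have fu: "free n (closed_segment x u)" using fn free_subset by blast
    have "free (Suc i) (closed_segment x u)" using fu i by (auto intro: free_le)
    from free_segment(3)[OF this]
    have img: "F (Suc i) ` closed_segment x u = closed_segment (f w) (f (F i u))"
      by (simp add: w_def)
    have "free m (closed_segment (f w) (f (F i u)))"
      using free_image[of "Suc i" m] fu unfolding n img[symmetric] by blast
    from two_point_iter[OF this] show ?thesis
      unfolding iter_n[of u] iter_n[of x] w_def[symmetric] .
  qed
  have A: "(f w - \<sigma>)^2 * (D m (f w) * D m \<sigma>) \<le> (F n x - Y)^2"
  proof (rule tendsto_le[OF segment_end_nontrivial[OF bx]])
    show "((\<lambda>u. (F n x - F n u)^2) \<longlongrightarrow> (F n x - Y)^2) ?F"
      by (intro tendsto_intros lim3)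
    show "((\<lambda>u. (f w - f (F i u))^2 * (D m (f w) * D m (f (F i u)))) \<longlongrightarrow>
        (f w - \<sigma>)^2 * (D m (f w) * D m \<sigma>)) ?F"
      by (intro tendsto_intros lim2 lim4)
    show "eventually (\<lambda>u. (f w - f (F i u))^2 * (D m (f w) * D m (f (F i u)))
        \<le> (F n x - F n u)^2) ?F"
      using evH by (rule eventually_mono) (rule ineq)
  qed
  have B: "(x - b)^2 * (D i x * D i b) \<le> (w - c)^2"
    using two_point_iter[OF fi] by (simp add: w_def c_def)
  have Dn: "D n x = D i x * \<bar>Df w\<bar> * D m (f w)"
    unfolding n D_add by (simp add: Dfn_Suc abs_mult w_def)
  have "((x - b)^2 * (D i x * D i b)) * ((f w - \<sigma>)^2 * (D m (f w) * D m \<sigma>)) \<le> (w - c)^2 * (F n x - Y)^2"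
    by (rule mult_mono[OF B A]) auto
  then have "\<bar>Df w\<bar> * (((x - b)^2 * (D i x * D i b)) * ((f w - \<sigma>)^2 * (D m (f w) * D m \<sigma>)))
      \<le> \<bar>Df w\<bar> * ((w - c)^2 * (F n x - Y)^2)"
    by (rule mult_left_mono) auto
  then show "D n x * D i b * (x - b)^2 * (D m \<sigma> * (f w - \<sigma>)^2) \<le> (w - c)^2 * \<bar>Df w\<bar> * (F n x - Y)^2"
    unfolding Dn by (simp add: algebra_simps)
qed

text \<open>If the first two alternatives fail, the derivative along the critical orbit is large: if \<open>x\<^sub>n\<close> is not
  much farther from \<open>C\<close> than \<open>x\<^sub>i\<close>, this is the first summability condition; otherwise \<open>x\<^sub>n\<close> is at most
  as deep as \<open>x\<^sub>i\<close>, the critical orbit is at comparable distance from the same critical point, and it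
  is the second one.\<close>
lemma end_estimate:
  assumes L: "L \<ge> 1" and M: "M > 0"
  shows "\<exists>\<kappa>>0. \<exists>\<rho>>0. \<forall>x n b i. b \<noteq> x \<longrightarrow> i < n \<longrightarrow> F i b \<in> C \<longrightarrow> free i (closed_segment x b) \<longrightarrow>
     free n (closed_segment x b - {b}) \<longrightarrow> adm \<rho> n x \<longrightarrow>
     (\<exists>Y. is_end n x b Y \<and> (\<kappa> \<le> \<bar>F n x - Y\<bar> \<or> L * infdist (F i x) C \<le> \<bar>F n x - Y\<bar> \<or>
        M * \<bar>x - b\<bar> * sqrt (D n x * D i b) \<le> \<bar>F n x - Y\<bar>))"
proof -
  obtain A B where AB: "order_consts A B" using order_consts_exist by blast
  then have A: "A > 0" and B: "B > 0" by (auto simp: order_consts_def)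
  obtain \<Lambda> where \<Lambda>: "\<Lambda> \<ge> 1" "\<And>c r. (c, r) \<in> sides \<Longrightarrow> l c r \<le> \<Lambda>" using orders_bounded by blast
  obtain g where g: "g > 0" "\<And>c c'. c \<in> C \<Longrightarrow> c' \<in> C \<Longrightarrow> c \<noteq> c' \<Longrightarrow> g \<le> \<bar>c - c'\<bar>" using C_gap by blast
  \<comment> \<open>M0 is the size of \<open>E * p powr (a - 1)\<close> from which the product
    inequality of \<open>hit_end\<close> yields the third alternative. M1 adds the losses on the way
    there: (3L)^(\<Lambda> - 1) from comparing distances and 1 + B/A from comparing depths.\<close>
  define M0 where "M0 = M^2 * B / A^2"
  define M1 where "M1 = M0 * (3 * L) powr (\<Lambda> - 1) * (1 + B / A)"
  have M0: "M0 > 0" using M A B by (simp add: M0_def)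
  have M1: "M1 > 0" using M0 L A B by (simp add: M1_def add_pos_pos)
  obtain m0 where m0: "\<And>m c r. m \<ge> m0 \<Longrightarrow> (c, r) \<in> sides \<Longrightarrow>
      M1 * infdist (F m (sl c r)) C powr (1 - l c r) \<le> D m (sl c r) \<and>
     M1 * infdist (F m (sl c r)) C powr (1 - l (nearest C (F m (sl c r)))
        (nearest C (F m (sl c r)) < F m (sl c r))) \<le> D m (sl c r)"
    using deriv_growth[of M1] by blast
  obtain \<kappa> where \<kappa>: "\<kappa> > 0" "\<And>m c r. m < m0 \<Longrightarrow> (c, r) \<in> sides \<Longrightarrow> \<kappa> \<le> infdist (F m (sl c r)) C"
    using critical_orbit_gap[of m0] by blast
  \<comment> \<open>\<kappa>/2: an early point of a critical orbit is at least \<kappa> from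
    \<open>C\<close>, hence at least \<kappa>/2 from x_n. g/4: the critical point near x_n is
    unique, also as seen from Y.\<close>
  define \<rho> where "\<rho> = min (\<kappa> / 2) (g / 4)"
  have \<rho>: "\<rho> > 0" "\<rho> \<le> \<kappa> / 2" "\<rho> \<le> g / 4" using \<kappa> g by (auto simp: \<rho>_def)
  have main: "\<exists>Y. is_end n x b Y \<and> (\<kappa> / 2 \<le> \<bar>F n x - Y\<bar> \<or> L * infdist (F i x) C \<le> \<bar>F n x - Y\<bar> \<or>
        M * \<bar>x - b\<bar> * sqrt (D n x * D i b) \<le> \<bar>F n x - Y\<bar>)"
    if H: "b \<noteq> x" "i < n" "F i b \<in> C" "free i (closed_segment x b)" "free n (closed_segment x b - {b})"
      and ad: "adm \<rho> n x" for x n b i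
  proof -
    define c where "c = F i b"
    define w where "w = F i x"
    define m where "m = n - Suc i"
    define r where "r = (c < w)"
    define \<sigma> where "\<sigma> = sl c r"
    define Y where "Y = F m \<sigma>"
    define p where "p = \<bar>w - c\<bar>"
    define \<gamma> where "\<gamma> = \<bar>F n x - Y\<bar>"
    define z where "z = F n x"
    define a where "a = l c r"
    note he = hit_end[OF H, folded c_def w_def m_def, folded r_def, folded \<sigma>_def, folded Y_def]
    have s: "(c, r) \<in> sides" using he(1) .
    have cC: "c \<in> C" using H(3) by (simp add: c_def)
    have p: "p > 0" using he(2) cC by (auto simp: p_def)
    have pw: "infdist w C \<le> p" using infdist_le_C[OF cC] by (simp add: p_def)
    have a: "a \<ge> 1" "a \<le> \<Lambda>" using order_ge_1[OF s] \<Lambda>(2)[OF s] by (auto simp: a_def)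
    obtain cn where cn: "cn \<in> C" "\<bar>z - cn\<bar> \<le> \<rho>"
      and adm_i: "\<bar>z - cn\<bar> \<le> p \<or> depth cn z \<le> depth c w"
      using ad H(2) cC unfolding adm_def z_def w_def p_def by blast
    define \<rho>n where "\<rho>n = \<bar>z - cn\<bar>"
    have Y01: "Y \<in> {0..1} - C" using sl_orbit[OF s] iter_in[OF sl_in[OF s]] by (simp add: Y_def \<sigma>_def)
    have dY: "infdist Y C \<le> \<gamma> + \<rho>n"
      using infdist_le_C[OF cn(1), of Y] by (simp add: \<gamma>_def \<rho>n_def z_def)
    have z01: "z \<in> {0..1}" using ad iter_in by (auto simp: adm_def z_def free_singleton)
    have ord: "A * p powr a \<le> \<bar>f w - \<sigma>\<bar>" "\<bar>f w - \<sigma>\<bar> \<le> B * p powr a" "\<bar>Df w\<bar> \<le> B * p powr (a - 1)"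
      using AB cC he(2,3) unfolding order_consts_def p_def a_def r_def \<sigma>_def by auto
    have "\<kappa> / 2 \<le> \<gamma> \<or> L * infdist w C \<le> \<gamma> \<or> M * \<bar>x - b\<bar> * sqrt (D n x * D i b) \<le> \<gamma>"
    proof (cases "m < m0 \<or> L * p \<le> \<gamma>")
      case True
      then show ?thesis
      proof
        assume "m < m0"
        then have "\<kappa> \<le> infdist Y C" using \<kappa>(2)[OF _ s] by (simp add: Y_def \<sigma>_def)
        then have "\<kappa> / 2 \<le> \<gamma>" using dY cn(2) \<rho>(2) by (simp add: \<rho>n_def)
        then show ?thesis by simp
      next
        assume "L * p \<le> \<gamma>"
        moreover have "L * infdist w C \<le> L * p" using pw L by (intro mult_left_mono) auto
        ultimately show ?thesis by linarith
      qed
    next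
      case False
      then have mm: "m \<ge> m0" and \<gamma>L: "\<gamma> < L * p" by auto
      define E where "E = D m \<sigma>"
      define d where "d = infdist Y C"
      have d: "d > 0" using infdist_pos Y01 by (auto simp: d_def)
      have E4: "M1 * d powr (1 - a) \<le> E"
        and E5: "M1 * d powr (1 - l (nearest C Y) (nearest C Y < Y)) \<le> E"
        using m0[OF mm s] by (auto simp: E_def d_def a_def Y_def \<sigma>_def)
      have pa: "p powr (1 - a) * p powr (a - 1) = 1" using p by (simp flip: powr_add)
      have key: "M0 * p powr (1 - a) \<le> E"
      proof (cases "\<rho>n \<le> 2 * L * p")
        case True
        have "d \<le> 3 * L * p" using dY \<gamma>L True by (simp add: d_def)
        then have "(3 * L * p) powr (1 - a) \<le> d powr (1 - a)"
          using d a by (intro powr_mono2') auto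
        moreover have "(3 * L * p) powr (1 - a) = (3 * L) powr (1 - a) * p powr (1 - a)"
          using L p by (simp add: powr_mult)
        moreover have "(3 * L) powr (1 - \<Lambda>) \<le> (3 * L) powr (1 - a)"
          using L a by (intro powr_mono) auto
        ultimately have "(3 * L) powr (1 - \<Lambda>) * p powr (1 - a) \<le> d powr (1 - a)"
          by (smt (verit) mult_right_mono powr_ge_zero)
        then have "M1 * ((3 * L) powr (1 - \<Lambda>) * p powr (1 - a)) \<le> E"
          using E4 M1 mult_left_mono[of _ _ M1] by (smt (verit))
        moreover have "M1 * (3 * L) powr (1 - \<Lambda>) = M0 * (1 + B / A)"
          using L by (simp add: M1_def mult.assoc mult.left_commute flip: powr_add)
        ultimately have "M0 * (1 + B / A) * p powr (1 - a) \<le> E" by (metis mult.assoc)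
        moreover have "M0 * 1 * p powr (1 - a) \<le> M0 * (1 + B / A) * p powr (1 - a)"
          using M0 A B by (intro mult_right_mono mult_left_mono) auto
        ultimately show ?thesis by simp
      next
        case False
        then have \<rho>p: "\<rho>n > 2 * L * p" by simp
        moreover have "p \<le> L * p" using L p by simp
        ultimately have \<rho>np: "\<rho>n \<ge> p" "\<rho>n > 0" using p by linarith+
        have zcn: "z \<noteq> cn" using \<rho>np by (auto simp: \<rho>n_def)
        have zC: "z \<notin> C"
        proof
          assume "z \<in> C"
          then have "g \<le> \<bar>z - cn\<bar>" using g(2)[OF _ cn(1)] zcn by blast
          then show False using cn(2) \<rho>(3) g(1) by linarith
        qed
        have seg: "open_segment cn z \<inter> C = {}"
        proof -
          have False if "t \<in> open_segment cn z" "t \<in> C" for t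
          proof -
            have "t \<noteq> cn" "\<bar>t - cn\<bar> \<le> \<bar>z - cn\<bar>"
              using that(1) by (auto simp: open_segment_eq_real_ivl split: if_splits)
            then show False using g(2)[OF that(2) cn(1)] cn(2) \<rho>(3) g(1) by linarith
          qed
          then show ?thesis by blast
        qed
        define a' where "a' = l cn (cn < z)"
        have s': "(cn, cn < z) \<in> sides" using side_of_point[OF cn(1) z01 zcn] .
        have a': "a' \<ge> 1" "a' \<le> \<Lambda>" using order_ge_1[OF s'] \<Lambda>(2)[OF s'] by (auto simp: a'_def)
        have yz: "\<bar>Y - z\<bar> < \<rho>n / 2" using \<gamma>L \<rho>p abs_minus_commute[of Y z] by (simp add: \<gamma>_def z_def)
        have near: "nearest C Y = cn"
        proof (rule ccontr)
          assume ne: "nearest C Y \<noteq> cn"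
          have "\<bar>Y - nearest C Y\<bar> \<le> \<bar>Y - cn\<bar>" using nearest_props(2)[OF cn(1)] .
          moreover have "g \<le> \<bar>nearest C Y - cn\<bar>" using g(2)[OF nearest_props(1) cn(1) ne] .
          moreover have "\<bar>nearest C Y - cn\<bar> \<le> \<bar>Y - nearest C Y\<bar> + \<bar>Y - cn\<bar>" by linarith
          moreover have "\<bar>Y - cn\<bar> \<le> \<bar>Y - z\<bar> + \<bar>z - cn\<bar>" by linarith
          ultimately show False using yz cn(2) \<rho>(3) g(1) unfolding \<rho>n_def by linarith
        qed
        have same: "(cn < Y) = (cn < z)" using yz unfolding \<rho>n_def by (smt (verit) field_sum_of_halves)
        have "d = \<bar>Y - cn\<bar>" using nearest_props(3)[of Y] near by (simp add: d_def)
        also have "\<dots> \<le> \<bar>Y - z\<bar> + \<rho>n" unfolding \<rho>n_def by linarith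
        finally have "d \<le> 2 * \<rho>n" using yz \<rho>np(2) by linarith
        then have "(2 * \<rho>n) powr (1 - a') \<le> d powr (1 - a')"
          using d a' by (intro powr_mono2') auto
        moreover have "(2 * \<rho>n) powr (1 - a') = 2 powr (1 - a') * \<rho>n powr (1 - a')"
          using \<rho>np by (simp add: powr_mult)
        moreover have "(3 * L) powr (1 - \<Lambda>) \<le> 2 powr (1 - a')"
        proof -
          have "(3 * L) powr (1 - \<Lambda>) \<le> 2 powr (1 - \<Lambda>)" using L \<Lambda>(1) by (intro powr_mono2') auto
          also have "\<dots> \<le> 2 powr (1 - a')" using a' by (intro powr_mono) auto
          finally show ?thesis .
        qed
        ultimately have "(3 * L) powr (1 - \<Lambda>) * \<rho>n powr (1 - a') \<le> d powr (1 - a')"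
          by (smt (verit) mult_right_mono powr_ge_zero)
        then have "M1 * ((3 * L) powr (1 - \<Lambda>) * \<rho>n powr (1 - a')) \<le> E"
          using E5 M1 mult_left_mono[of _ _ M1] unfolding near same a'_def by (smt (verit))
        moreover have "M1 * (3 * L) powr (1 - \<Lambda>) = M0 * (1 + B / A)"
          using L by (simp add: M1_def mult.assoc mult.left_commute flip: powr_add)
        ultimately have e1: "M0 * (1 + B / A) * \<rho>n powr (1 - a') \<le> E" by (metis mult.assoc)
        have "depth cn z \<le> depth c w"
        proof -
          have "\<not> \<bar>z - cn\<bar> \<le> p" using \<rho>p L p \<open>p \<le> L * p\<close> unfolding \<rho>n_def by linarith
          then show ?thesis using adm_i by blast
        qed
        moreover have "A * \<rho>n powr a' \<le> depth cn z"
          using AB cn(1) z01 zC seg unfolding order_consts_def depth_def a'_def \<rho>n_def by auto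
        moreover have "depth c w \<le> B * p powr a"
          using ord(2) by (simp add: depth_def \<sigma>_def r_def)
        ultimately have dep: "A * \<rho>n powr a' \<le> B * p powr a" by linarith
        \<comment> \<open>As p <= \<rho>n, the depth comparison A \<rho>n^a' <= B p^a, which
          involves two different orders, turns into p^(1 - a) <= (B/A) \<rho>n^(1 - a').\<close>
        have "p powr (1 - a) * (A * \<rho>n powr a') \<le> p powr (1 - a) * (B * p powr a)"
          using dep by (intro mult_left_mono) auto
        also have "\<dots> = B * p" using p by (simp add: mult.left_commute flip: powr_add)
        also have "\<dots> \<le> B * \<rho>n" using \<rho>np B by (intro mult_left_mono) auto
        also have "\<dots> = B * (\<rho>n powr (1 - a') * \<rho>n powr a')" using \<rho>np by (simp flip: powr_add)
        finally have "(A * p powr (1 - a)) * \<rho>n powr a' \<le> (B * \<rho>n powr (1 - a')) * \<rho>n powr a'"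
          by (simp add: algebra_simps)
        then have "A * p powr (1 - a) \<le> B * \<rho>n powr (1 - a')"
          by (rule mult_right_le_imp_le) (use \<rho>np in simp)
        then have "p powr (1 - a) \<le> B / A * \<rho>n powr (1 - a')" using A by (simp add: field_simps)
        also have "\<dots> \<le> (1 + B / A) * \<rho>n powr (1 - a')" by (intro mult_right_mono) auto
        finally have "M0 * p powr (1 - a) \<le> M0 * ((1 + B / A) * \<rho>n powr (1 - a'))"
          using M0 by (intro mult_left_mono) auto
        then show ?thesis using e1 by (metis mult.assoc order_trans)
      qed
      have Ep: "M0 \<le> E * p powr (a - 1)"
      proof -
        have "M0 * p powr (1 - a) * p powr (a - 1) \<le> E * p powr (a - 1)"
          using key by (intro mult_right_mono) auto
        then show ?thesis using pa by (simp add: mult.assoc)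
      qed
      define G where "G = D n x * D i b"
      have G: "G \<ge> 0" by (simp add: G_def)
      have h5: "G * (x - b)^2 * (E * (f w - \<sigma>)^2) \<le> p^2 * \<bar>Df w\<bar> * \<gamma>^2"
        using he(5) by (simp add: G_def E_def p_def \<gamma>_def)
      have "(A * p powr a)^2 \<le> (f w - \<sigma>)^2"
        using ord(1) A p by (metis abs_le_square_iff abs_of_nonneg less_imp_le mult_nonneg_nonneg powr_ge_zero)
      then have "G * (x - b)^2 * (E * (A * p powr a)^2) \<le> G * (x - b)^2 * (E * (f w - \<sigma>)^2)"
        using G by (intro mult_left_mono) (auto simp: E_def)
      also have "\<dots> \<le> p^2 * \<bar>Df w\<bar> * \<gamma>^2" by (rule h5)
      also have "\<dots> \<le> p^2 * (B * p powr (a - 1)) * \<gamma>^2"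
        using ord(3) by (intro mult_right_mono mult_left_mono) auto
      finally have i1: "G * (x - b)^2 * (E * (A * p powr a)^2) \<le> p^2 * (B * p powr (a - 1)) * \<gamma>^2" .
      have pa2: "p powr a = p * p powr (a - 1)" using p powr_add[of p 1 "a - 1"] by simp
      have "(G * (x - b)^2 * (E * p powr (a - 1)) * A^2) * (p^2 * p powr (a - 1))
           \<le> (B * \<gamma>^2) * (p^2 * p powr (a - 1))"
        using i1 unfolding pa2 by (simp add: power_mult_distrib power2_eq_square algebra_simps)
      then have "G * (x - b)^2 * (E * p powr (a - 1)) * A^2 \<le> B * \<gamma>^2"
        by (rule mult_right_le_imp_le) (use p in simp)
      moreover have "G * (x - b)^2 * M0 * A^2 \<le> G * (x - b)^2 * (E * p powr (a - 1)) * A^2"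
        using Ep G by (intro mult_right_mono mult_left_mono) auto
      ultimately have "G * (x - b)^2 * M0 * A^2 \<le> B * \<gamma>^2" by linarith
      moreover have "M0 * A^2 = M^2 * B" using A by (simp add: M0_def)
      then have "G * (x - b)^2 * M0 * A^2 = B * (M^2 * (x - b)^2 * G)" by algebra
      ultimately have "B * (M^2 * (x - b)^2 * G) \<le> B * \<gamma>^2" by linarith
      then have "M^2 * (x - b)^2 * G \<le> \<gamma>^2" using B by simp
      moreover have "(M * \<bar>x - b\<bar> * sqrt G)^2 = M^2 * (x - b)^2 * G"
        using G by (simp add: power_mult_distrib)
      ultimately have "(M * \<bar>x - b\<bar> * sqrt G)^2 \<le> \<gamma>^2" by simp
      then have "M * \<bar>x - b\<bar> * sqrt G \<le> \<gamma>"
        by (rule power2_le_imp_le) (simp add: \<gamma>_def)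
      then show ?thesis by (simp add: G_def)
    qed
    then show ?thesis using he(4) unfolding \<gamma>_def w_def by blast
  qed
  show ?thesis
    by (intro exI[of _ "\<kappa> / 2"] exI[of _ \<rho>] conjI) (use \<kappa>(1) \<rho>(1) main in auto)
qed

section \<open>Escape from critical points and from the boundary\<close>

text \<open>A limit c in \<open>C\<close> would be approached from one side, and the next term would
  tend both to c and to a point on the orbit of the one-sided critical value; but such orbits avoid
  \<open>C\<close>.\<close>

lemma limit_of_monotone_orbit_not_critical:
  assumes mono: "monoseq z" and z: "\<And>j. z j \<in> {0..1} - C" and lim: "z \<longlonglongrightarrow> c"
    and step: "\<And>j. z (Suc j) = F (Suc m) (z j)"
  shows "c \<notin> C"
proof
  assume cC: "c \<in> C"
  define r where "r = (c < z 0)"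
  have ne: "z j \<noteq> c" for j using z cC by blast
  have side: "if r then c < z j else z j < c" for j
  proof -
    consider "incseq z" | "decseq z" using mono monoseq_iff by blast
    then show ?thesis
    proof cases
      case 1
      have "z j < c" "z 0 < c" using incseq_le[OF 1 lim] ne by (metis less_le)+
      then show ?thesis by (simp add: r_def)
    next
      case 2
      have "c < z j" "c < z 0" using decseq_ge[OF 2 lim] ne by (metis less_le)+
      then show ?thesis by (simp add: r_def)
    qed
  qed
  have s: "(c, r) \<in> sides" unfolding r_def by (rule side_of_point[OF cC]) (use z ne in auto)
  have "filterlim z (at_side c r) sequentially"
    unfolding at_side_within filterlim_at using lim side ne
    by (auto intro!: always_eventually)
  then have "(\<lambda>j. F (Suc m) (z j)) \<longlonglongrightarrow> F m (sl c r)"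
    by (rule filterlim_compose[OF iter_tendsto_side(1)[OF s]])
  then have "(\<lambda>j. z (Suc j)) \<longlonglongrightarrow> F m (sl c r)" by (simp only: step)
  moreover have "(\<lambda>j. z (Suc j)) \<longlonglongrightarrow> c" using lim by (rule LIMSEQ_Suc)
  ultimately have "F m (sl c r) = c" by (rule LIMSEQ_unique)
  then show False using sl_orbit[OF s] cC by metis
qed

text \<open>The even iterates of \<open>f\<^sup>p\<close> act monotonically on the interval spanned by the orbit, so the orbit
  converges to a periodic orbit, which cannot meet \<open>C\<close>.\<close>
lemma orbit_bounded_away:
  assumes p: "p \<ge> 1" and fr: "\<And>n. free n (closed_segment x (F p x))"
  shows "\<exists>\<kappa>>0. \<forall>n. \<kappa> \<le> infdist (F n x) C"
proof -
  define u where "u = (\<lambda>j. F (p * j) x)"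
  have seg_step: "free n (closed_segment (u j) (u (Suc j)))" for n j
  proof -
    have "F (p * j) (F p x) = u (Suc j)"
      unfolding u_def by (simp add: add.commute flip: iter_add)
    then have "F (p * j) ` closed_segment x (F p x) = closed_segment (u j) (u (Suc j))"
      using free_segment(3)[OF fr, of "p * j"] by (simp add: u_def)
    then show ?thesis using free_image[OF fr[of "p * j + n"]] by simp
  qed
  have seg: "free n (closed_segment x (u j))" for n j
  proof (induction j)
    case 0
    then show ?case using fr[of n] by (auto simp: u_def intro: free_subset)
  next
    case (Suc j)
    have "closed_segment x (u (Suc j)) \<subseteq> closed_segment x (u j) \<union> closed_segment (u j) (u (Suc j))"
      by (auto simp: closed_segment_eq_real_ivl split: if_splits)
    then show ?case using Suc seg_step free_Un free_subset by metis
  qed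
  \<comment> \<open>The images of the first segment chain together, so I is an interval; f^p maps it
    into itself and every iterate is injective on it.\<close>
  define I where "I = (\<Union>j. closed_segment x (u j))"
  have uI: "u j \<in> I" for j by (auto simp: I_def)
  have xI: "x \<in> I" by (auto simp: I_def)
  have frI: "free n (closed_segment a b)" if ab: "a \<in> I" "b \<in> I" for a b n
  proof -
    obtain j k where jk: "a \<in> closed_segment x (u j)" "b \<in> closed_segment x (u k)"
      using ab unfolding I_def by blast
    then have "closed_segment a b \<subseteq> closed_segment x (u j) \<union> closed_segment x (u k)"
      by (auto simp: closed_segment_eq_real_ivl split: if_splits)
    then show ?thesis using seg free_Un free_subset by metis
  qed
  have "connected I" unfolding I_def by (rule connected_Union) auto
  then have iI: "is_interval I" by (simp add: is_interval_connected_1)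
  have I01: "I \<subseteq> {0..1}" using seg[of 0] by (auto simp: I_def free_def)
  have contI: "continuous_on I (f ^^ n)" for n
    unfolding continuous_on_eq_continuous_within
  proof
    fix a assume "a \<in> I"
    then have "free n {a}" using frI[of a a n] by simp
    from iter_cont_at[OF this] show "continuous (at a within I) (f ^^ n)"
      using I01 continuous_within_subset by blast
  qed
  have injI: "inj_on (f ^^ n) I" for n
  proof (rule inj_onI)
    fix a b assume "a \<in> I" "b \<in> I" "F n a = F n b"
    then show "a = b" using free_segment(1)[OF frI] by (metis ends_in_segment inj_onD)
  qed
  have mono: "strict_mono_on I (f ^^ n) \<or> strict_antimono_on I (f ^^ n)" for n
    using injective_eq_monotone_map[OF iI contI] injI by blast
  have fpI: "F p a \<in> I" if a: "a \<in> I" for a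
  proof -
    obtain j where j: "a \<in> closed_segment x (u j)" using a by (auto simp: I_def)
    have "F p a \<in> closed_segment (F p x) (F p (u j))"
      using free_segment(3)[OF seg] j by blast
    moreover have "F p x = u 1" "F p (u j) = u (Suc j)"
      by (simp_all add: u_def add.commute flip: iter_add)
    moreover have "closed_segment (u 1) (u (Suc j)) \<subseteq> I"
      using iI uI by (simp add: is_interval_convex closed_segment_subset)
    ultimately show ?thesis by auto
  qed
  define q where "q = p + p"
  have q: "q \<ge> 1" using p by (simp add: q_def)
  have fqI: "F q a \<in> I" if "a \<in> I" for a
    unfolding q_def iter_add using fpI that by blast
  have fq_mono: "F q a \<le> F q b" if ab: "a \<in> I" "b \<in> I" "a \<le> b" for a b
  proof (cases "a = b")
    case False
    then have "a < b" using ab by simp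
    then have "F q a < F q b"
      using mono[of p] fpI[OF ab(1)] fpI[OF ab(2)] ab(1,2) unfolding q_def iter_add monotone_on_def
      by metis
    then show ?thesis by simp
  qed simp
  define v where "v = (\<lambda>j. F (q * j) x)"
  have v_Suc: "v (Suc j) = F q (v j)" for j
    by (simp add: v_def add.commute flip: iter_add)
  have vI: "v j \<in> I" for j
    by (induction j) (use xI fqI v_Suc in \<open>auto simp: v_def\<close>)
  have "monoseq v"
  proof (cases "v 0 \<le> v 1")
    case True
    have "v j \<le> v (Suc j)" for j
    proof (induction j)
      case 0
      then show ?case using True by simp
    next
      case (Suc j)
      then show ?case using fq_mono[OF vI vI] v_Suc by metis
    qed
    then show ?thesis by (auto simp: monoseq_Suc)
  next
    case False
    have "v (Suc j) \<le> v j" for j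
    proof (induction j)
      case 0
      then show ?case using False by simp
    next
      case (Suc j)
      then show ?case using fq_mono[OF vI vI] v_Suc by metis
    qed
    then show ?thesis by (auto simp: monoseq_Suc)
  qed
  \<comment> \<open>For each residue r the points F r (v j) again form a monotone sequence with step
    f^q, and the finitely many residues below q exhaust the orbit.\<close>
  have bound: "\<exists>\<kappa>>0. \<forall>j. \<kappa> \<le> infdist (F r (v j)) C" for r
  proof -
    define z where "z = (\<lambda>j. F r (v j))"
    have z01: "z j \<in> {0..1} - C" for j
      using frI[OF vI[of j] vI[of j], of "Suc r"] iter_in[of "v j" r] I01 vI[of j]
      by (auto simp: z_def free_Suc)
    have mz: "monoseq z"
    proof -
      have "monoseq z" if "incseq v"
        using mono[of r] vI incseqD[OF that] unfolding monoseq_def z_def monotone_on_def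
        by (metis less_le order_refl)
      moreover have "monoseq z" if "decseq v"
        using mono[of r] vI decseqD[OF that] unfolding monoseq_def z_def monotone_on_def
        by (metis less_le order_refl)
      ultimately show ?thesis using \<open>monoseq v\<close> monoseq_iff by blast
    qed
    moreover have "Bseq z"
      by (rule BseqI'[of _ 1]) (use z01 in auto)
    ultimately obtain \<pi> where \<pi>: "z \<longlonglongrightarrow> \<pi>"
      using Bseq_monoseq_convergent convergent_def by blast
    have zs: "z (Suc j) = F (Suc (q - 1)) (z j)" for j
      using q v_Suc by (simp add: z_def add.commute del: funpow.simps flip: iter_add)
    have "\<pi> \<notin> C" by (rule limit_of_monotone_orbit_not_critical[OF mz z01 \<pi> zs])
    moreover have "(\<lambda>j. infdist (z j) C) \<longlonglongrightarrow> infdist \<pi> C" by (intro tendsto_intros \<pi>)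
    ultimately show ?thesis
      using positive_limit_bounded_below[of "\<lambda>j. infdist (z j) C" "infdist \<pi> C"] infdist_pos z01
      unfolding z_def by blast
  qed
  have "\<exists>\<epsilon>>0. \<forall>\<epsilon>'. 0 < \<epsilon>' \<and> \<epsilon>' \<le> \<epsilon> \<longrightarrow> (\<forall>r\<in>{..<q}. \<forall>j. \<epsilon>' \<le> infdist (F r (v j)) C)"
  proof (rule finite_uniform_threshold)
    fix r
    obtain \<kappa> where "\<kappa> > 0" "\<forall>j. \<kappa> \<le> infdist (F r (v j)) C" using bound by blast
    then show "\<exists>\<epsilon>>0. \<forall>\<epsilon>'. 0 < \<epsilon>' \<and> \<epsilon>' \<le> \<epsilon> \<longrightarrow> (\<forall>j. \<epsilon>' \<le> infdist (F r (v j)) C)"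
      by (meson order_trans)
  qed simp
  then obtain \<kappa> where \<kappa>: "\<kappa> > 0" "\<forall>r\<in>{..<q}. \<forall>j. \<kappa> \<le> infdist (F r (v j)) C" by blast
  have "\<kappa> \<le> infdist (F n x) C" for n
  proof -
    have "F n x = F (n mod q) (v (n div q))"
      unfolding v_def iter_add[symmetric] by simp
    moreover have "n mod q < q" using q by simp
    ultimately show ?thesis using \<kappa>(2) by simp
  qed
  then show ?thesis using \<kappa>(1) by blast
qed

section \<open>Finitely many iterates near the critical set\<close>

lemma eventually_at_side:
  "eventually P (at_side c r) \<longleftrightarrow> (\<exists>e>0. \<forall>x. \<bar>x - c\<bar> < e \<and> (if r then c < x else x < c) \<longrightarrow> P x)"
  unfolding at_side_within eventually_at dist_real_def by (cases r) auto

lemma uniform_near_critical: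
  assumes "\<And>c r. (c, r) \<in> sides \<Longrightarrow> eventually (P c r) (at_side c r)"
  shows "\<exists>\<eta>>0. \<forall>c\<in>C. \<forall>x\<in>{0..1}. x \<noteq> c \<longrightarrow> \<bar>x - c\<bar> < \<eta> \<longrightarrow> P c (c < x) x"
proof -
  have "\<exists>\<epsilon>>0. \<forall>\<epsilon>'. 0 < \<epsilon>' \<and> \<epsilon>' \<le> \<epsilon> \<longrightarrow> (\<forall>p\<in>sides. \<forall>x. \<bar>x - fst p\<bar> < \<epsilon>' \<and>
     (if snd p then fst p < x else x < fst p) \<longrightarrow> P (fst p) (snd p) x)"
  proof (rule finite_uniform_threshold[OF finite_sides])
    fix p assume "p \<in> sides"
    then have "eventually (P (fst p) (snd p)) (at_side (fst p) (snd p))" using assms by (cases p) auto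
    then obtain e where "e > 0"
      "\<forall>x. \<bar>x - fst p\<bar> < e \<and> (if snd p then fst p < x else x < fst p) \<longrightarrow> P (fst p) (snd p) x"
      unfolding eventually_at_side by blast
    then show "\<exists>\<epsilon>>0. \<forall>\<epsilon>'. 0 < \<epsilon>' \<and> \<epsilon>' \<le> \<epsilon> \<longrightarrow> (\<forall>x. \<bar>x - fst p\<bar> < \<epsilon>' \<and>
     (if snd p then fst p < x else x < fst p) \<longrightarrow> P (fst p) (snd p) x)"
      by (meson less_le_trans)
  qed
  then obtain \<eta> where \<eta>: "\<eta> > 0" "\<forall>p\<in>sides. \<forall>x. \<bar>x - fst p\<bar> < \<eta> \<and>
     (if snd p then fst p < x else x < fst p) \<longrightarrow> P (fst p) (snd p) x" by blast
  have "P c (c < x) x" if "c \<in> C" "x \<in> {0..1}" "x \<noteq> c" "\<bar>x - c\<bar> < \<eta>" for c x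
    using bspec[OF \<eta>(2) side_of_point[OF that(1-3)]] that by auto
  then show ?thesis using \<eta>(1) by blast
qed

text \<open>A point close to c follows the orbit of a one-sided critical value for N steps, and
  these finitely many points have positive distance to \<open>C\<close>.\<close>

lemma escape_near_critical:
  "\<exists>\<eta>>0. \<forall>x\<in>{0..1} - C. infdist x C < \<eta> \<longrightarrow> (\<forall>m<N. \<eta> \<le> infdist (F (Suc m) x) C)"
proof -
  obtain \<kappa> where \<kappa>: "\<kappa> > 0" "\<And>m c r. m < N \<Longrightarrow> (c, r) \<in> sides \<Longrightarrow> \<kappa> \<le> infdist (F m (sl c r)) C"
    using critical_orbit_gap[of N] by blast
  have "eventually (\<lambda>x. \<forall>m\<in>{..<N}. \<kappa> / 2 < infdist (F (Suc m) x) C) (at_side c r)"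
    if s: "(c, r) \<in> sides" for c r
  proof (rule eventually_ball_finite)
    show "\<forall>m\<in>{..<N}. eventually (\<lambda>x. \<kappa> / 2 < infdist (F (Suc m) x) C) (at_side c r)"
    proof
      fix m assume "m \<in> {..<N}"
      then have "\<kappa> / 2 < infdist (F m (sl c r)) C" using \<kappa>(2)[OF _ s, of m] \<kappa>(1) by simp
      moreover have "((\<lambda>x. infdist (F (Suc m) x) C) \<longlongrightarrow> infdist (F m (sl c r)) C) (at_side c r)"
        by (intro tendsto_infdist iter_tendsto_side(1)[OF s])
      ultimately show "eventually (\<lambda>x. \<kappa> / 2 < infdist (F (Suc m) x) C) (at_side c r)"
        by (metis order_tendstoD(1))
    qed
  qed simp
  from uniform_near_critical[of "\<lambda>c r x. \<forall>m\<in>{..<N}. \<kappa> / 2 < infdist (F (Suc m) x) C", OF this]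
  obtain \<eta> where \<eta>: "\<eta> > 0" "\<And>c x m. c \<in> C \<Longrightarrow> x \<in> {0..1} \<Longrightarrow> x \<noteq> c \<Longrightarrow> \<bar>x - c\<bar> < \<eta> \<Longrightarrow> m < N \<Longrightarrow>
      \<kappa> / 2 < infdist (F (Suc m) x) C"
    by blast
  show ?thesis
  proof (intro exI[of _ "min \<eta> (\<kappa> / 2)"] conjI ballI impI allI)
    show "0 < min \<eta> (\<kappa> / 2)" using \<eta> \<kappa> by simp
    fix x m assume x: "x \<in> {0..1} - C" "infdist x C < min \<eta> (\<kappa> / 2)" "m < N"
    obtain c where c: "c \<in> C" "infdist x C = \<bar>x - c\<bar>" using nearest_in_C by blast
    show "min \<eta> (\<kappa> / 2) \<le> infdist (F (Suc m) x) C"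
      using \<eta>(2)[OF c(1), of x m] x c by (metis DiffE less_imp_le min.strict_boundedE min_le_iff_disj)
  qed
qed

text \<open>By escape, an orbit near \<open>C\<close> at a time n <= N was not near \<open>C\<close>
  before, so all its derivative factors are bounded below. This covers the small n in the
  induction.\<close>

lemma finite_time_bound:
  "\<exists>\<eta>>0. \<exists>\<omega>>0. \<forall>x n. n \<le> N \<longrightarrow> free n {x} \<longrightarrow> infdist (F n x) C < \<eta> \<longrightarrow>
     (\<forall>j<n. \<eta> \<le> infdist (F j x) C) \<and> \<omega> \<le> D n x"
proof -
  obtain \<eta> where \<eta>: "\<eta> > 0" "\<And>x m. x \<in> {0..1} - C \<Longrightarrow> infdist x C < \<eta> \<Longrightarrow> m < N \<Longrightarrow>
      \<eta> \<le> infdist (F (Suc m) x) C"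
    using escape_near_critical[of N] by blast
  obtain \<omega> where \<omega>: "\<omega> > 0" "\<And>x. x \<in> {0..1} \<Longrightarrow> infdist x C \<ge> \<eta> \<Longrightarrow> \<omega> \<le> \<bar>Df x\<bar>"
    using Df_lower_away[OF \<eta>(1)] by blast
  define w where "w = min 1 \<omega>"
  have w: "0 < w" "w \<le> 1" "w \<le> \<omega>" using \<omega>(1) by (auto simp: w_def)
  have "(\<forall>j<n. \<eta> \<le> infdist (F j x) C) \<and> w ^ N \<le> D n x"
    if n: "n \<le> N" and fr: "free n {x}" and near: "infdist (F n x) C < \<eta>" for x n
  proof -
    have far: "\<eta> \<le> infdist (F j x) C" if j: "j < n" for j
    proof (rule ccontr)
      assume "\<not> ?thesis"
      moreover have "F j x \<in> {0..1} - C" using fr j iter_in by (auto simp: free_singleton)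
      ultimately have "\<eta> \<le> infdist (F (Suc (n - Suc j)) (F j x)) C"
        using n j by (intro \<eta>(2)) auto
      moreover have "F (Suc (n - Suc j)) (F j x) = F n x"
        using j by (simp del: funpow.simps flip: iter_add)
      ultimately show False using near by simp
    qed
    have "w ^ n = (\<Prod>i<n. w)" by simp
    also have "\<dots> \<le> (\<Prod>i<n. \<bar>Df (F i x)\<bar>)"
    proof (rule prod_mono)
      fix i assume "i \<in> {..<n}"
      then have "\<omega> \<le> \<bar>Df (F i x)\<bar>"
        using fr by (intro \<omega>(2) iter_in far) (auto simp: free_singleton)
      then show "0 \<le> w \<and> w \<le> \<bar>Df (F i x)\<bar>" using w by linarith
    qed
    also have "\<dots> = D n x" by (simp add: Dfn_def abs_prod)
    finally have "w ^ n \<le> D n x" .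
    moreover have "w ^ N \<le> w ^ n" using w n by (intro power_decreasing) auto
    ultimately show ?thesis using far by auto
  qed
  moreover have "w ^ N > 0" using w by simp
  ultimately show ?thesis using \<eta>(1) by blast
qed

text \<open>From x towards c, |Df| is at most a multiple of its value at x, being comparable with |t
  - c|^(l - 1); the other m iterates start near a one-sided critical value and have bounded
  distortion. Needed for one and two iterates, when the comparison moves from x to an image of x
  near a bad end point.\<close>

lemma near_critical_lipschitz:
  "\<exists>\<eta>>0. \<exists>K\<ge>1. \<forall>c\<in>C. \<forall>x\<in>{0..1}. x \<noteq> c \<longrightarrow> \<bar>x - c\<bar> < \<eta> \<longrightarrow> (\<forall>u\<in>open_segment x c.
     free (Suc m) (closed_segment x u) \<and>
     \<bar>F (Suc m) x - F (Suc m) u\<bar> \<le> K * D (Suc m) x * \<bar>x - u\<bar>)"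
proof -
  obtain A B where AB: "order_consts A B" using order_consts_exist by blast
  then have A: "A > 0" and B: "B > 0" by (auto simp: order_consts_def)
  obtain g where g: "g > 0" "\<And>c c'. c \<in> C \<Longrightarrow> c' \<in> C \<Longrightarrow> c \<noteq> c' \<Longrightarrow> g \<le> \<bar>c - c'\<bar>" using C_gap by blast
  obtain \<eta>1 where \<eta>1: "\<eta>1 > 0" "\<And>x k. x \<in> {0..1} - C \<Longrightarrow> infdist x C < \<eta>1 \<Longrightarrow> k < m \<Longrightarrow>
      \<eta>1 \<le> infdist (F (Suc k) x) C"
    using escape_near_critical[of m] by blast
  have "eventually (\<lambda>x. D m (sl c r) / 2 < D m (f x) \<and> D m (f x) < 2 * D m (sl c r)) (at_side c r)"
    if s: "(c, r) \<in> sides" for c r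
  proof -
    have t: "((\<lambda>x. D m (f x)) \<longlongrightarrow> D m (sl c r)) (at_side c r)"
      by (intro tendsto_rabs iter_tendsto_side(2)[OF s])
    have "D m (sl c r) > 0" using D_pos[OF sl_free[OF s]] .
    then show ?thesis
      by (intro eventually_conj order_tendstoD(1)[OF t] order_tendstoD(2)[OF t]) auto
  qed
  from uniform_near_critical[of "\<lambda>c r x. D m (sl c r) / 2 < D m (f x) \<and> D m (f x) < 2 * D m (sl c r)", OF this]
  obtain \<eta>2 where \<eta>2: "\<eta>2 > 0" "\<And>c x. c \<in> C \<Longrightarrow> x \<in> {0..1} \<Longrightarrow> x \<noteq> c \<Longrightarrow> \<bar>x - c\<bar> < \<eta>2 \<Longrightarrow>
      D m (sl c (c < x)) / 2 < D m (f x) \<and> D m (f x) < 2 * D m (sl c (c < x))"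
    by blast
  define \<eta> where "\<eta> = Min {g, A, \<eta>1, \<eta>2}"
  have \<eta>: "\<eta> > 0" "\<eta> \<le> g" "\<eta> \<le> A" "\<eta> \<le> \<eta>1" "\<eta> \<le> \<eta>2" using g A \<eta>1 \<eta>2 by (auto simp: \<eta>_def)
  define K where "K = max 1 (4 * B / A)"
  have main: "free (Suc m) (closed_segment x u) \<and>
     \<bar>F (Suc m) x - F (Suc m) u\<bar> \<le> K * D (Suc m) x * \<bar>x - u\<bar>"
    if c: "c \<in> C" and x: "x \<in> {0..1}" "x \<noteq> c" "\<bar>x - c\<bar> < \<eta>" and u: "u \<in> open_segment x c" for c x u
  proof -
    define r where "r = (c < x)"
    have c01: "c \<in> {0..1}" using c C_subset by auto
    have t: "t \<in> {0..1}" "t \<noteq> c" "\<bar>t - c\<bar> \<le> \<bar>x - c\<bar>" "(c < t) = r" if "t \<in> closed_segment x u" for t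
      using that u x c01 by (auto simp: r_def open_segment_eq_real_ivl closed_segment_eq_real_ivl split: if_splits)
    have notC: "s \<notin> C" if "s \<noteq> c" "\<bar>s - c\<bar> \<le> \<bar>x - c\<bar>" for s
      using g(2)[OF _ c, of s] that x \<eta>(2) by force
    have tC: "t \<notin> C" if "t \<in> closed_segment x u" for t using notC t(2,3)[OF that] .
    have adj: "open_segment c t \<inter> C = {}" if "t \<in> closed_segment x u" for t
    proof -
      have "s \<notin> C" if "s \<in> open_segment c t" for s
        using that t(3)[OF \<open>t \<in> closed_segment x u\<close>]
        by (intro notC) (auto simp: open_segment_eq_real_ivl split: if_splits)
      then show ?thesis by blast
    qed
    have fr: "free (Suc m) (closed_segment x u)"
      unfolding free_def
    proof (intro conjI allI impI ballI)
      show "closed_segment x u \<subseteq> {0..1}" using t(1) by blast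
      fix j t assume j: "j < Suc m" and tt: "t \<in> closed_segment x u"
      show "F j t \<notin> C"
      proof (cases j)
        case 0
        then show ?thesis using tC[OF tt] by simp
      next
        case (Suc k)
        have "infdist t C < \<eta>1" using infdist_le_C[OF c, of t] t(3)[OF tt] x(3) \<eta>(4) by linarith
        then have "\<eta>1 \<le> infdist (F (Suc k) t) C"
          using \<eta>1(2)[of t k] tC[OF tt] t(1)[OF tt] j Suc by auto
        then show ?thesis unfolding Suc using \<eta>1(1) infdist_zero by force
      qed
    qed
    have x_in: "x \<in> closed_segment x u" by simp
    have Dt: "D (Suc m) t \<le> K * D (Suc m) x" if tt: "t \<in> closed_segment x u" for t
    proof -
      define a where "a = l c r"
      have s: "(c, r) \<in> sides" unfolding r_def by (rule side_of_point[OF c x(1,2)])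
      have a: "a \<ge> 1" using order_ge_1[OF s] by (simp add: a_def)
      have dec: "D (Suc m) y = \<bar>Df y\<bar> * D m (f y)" for y
        using D_add[of "Suc 0" m y] by simp
      have 1: "\<bar>Df t\<bar> \<le> B * \<bar>t - c\<bar> powr (a - 1)"
        using order_constsD(3)[OF AB c _ adj[OF tt]] t(1,4)[OF tt] tC[OF tt] by (simp add: a_def)
      have 2: "\<bar>t - c\<bar> powr (a - 1) \<le> \<bar>x - c\<bar> powr (a - 1)"
        using t(3)[OF tt] a by (intro powr_mono2) auto
      have "\<bar>x - c\<bar> < A" using x(3) \<eta>(3) by simp
      then have 3: "A * \<bar>x - c\<bar> powr (a - 1) \<le> \<bar>Df x\<bar>"
        using order_constsD(4)[OF AB c _ adj[OF x_in]] x(1) tC[OF x_in] by (simp add: a_def r_def)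
      have "B * \<bar>t - c\<bar> powr (a - 1) \<le> B * \<bar>x - c\<bar> powr (a - 1)"
        using 2 B by (intro mult_left_mono) auto
      also have "\<dots> \<le> B * (\<bar>Df x\<bar> / A)" using 3 A B by (intro mult_left_mono) (auto simp: field_simps)
      finally have 4: "\<bar>Df t\<bar> \<le> B / A * \<bar>Df x\<bar>" using 1 by simp
      have "D m (f t) < 2 * D m (sl c r)" "D m (sl c r) / 2 < D m (f x)"
        using \<eta>2(2)[OF c t(1,2)[OF tt]] \<eta>2(2)[OF c x(1,2)] t(3,4)[OF tt] x(3) \<eta>(5) by (auto simp: r_def)
      then have 5: "D m (f t) \<le> 4 * D m (f x)" by simp
      have "D (Suc m) t \<le> (B / A * \<bar>Df x\<bar>) * (4 * D m (f x))"
        unfolding dec using 4 5 A B by (intro mult_mono) auto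
      also have "\<dots> = (4 * B / A) * D (Suc m) x" by (simp add: dec)
      also have "\<dots> \<le> K * D (Suc m) x" by (intro mult_right_mono) (auto simp: K_def)
      finally show ?thesis .
    qed
    have "norm (F (Suc m) x - F (Suc m) u) \<le> (K * D (Suc m) x) * norm (x - u)"
    proof (rule field_differentiable_bound[of "closed_segment x u"])
      fix t assume tt: "t \<in> closed_segment x u"
      show "(F (Suc m) has_field_derivative Dfn f Df (Suc m) t) (at t within closed_segment x u)"
        by (rule DERIV_subset[OF iter_deriv[OF free_imp_singleton[OF fr tt]]]) (use t(1) in auto)
      show "norm (Dfn f Df (Suc m) t) \<le> K * D (Suc m) x" using Dt[OF tt] by simp
    qed auto
    then show ?thesis using fr by simp
  qed
  have "K \<ge> 1" by (simp add: K_def)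
  then show ?thesis using main \<eta>(1) by blast
qed

text \<open>The summability conditions say nothing about the orbits of the end points of \<open>[0,1]\<close>. They matter
  only if they accumulate at \<open>C\<close> without hitting it.\<close>
definition bad_end :: "real \<Rightarrow> bool" where
  "bad_end e \<longleftrightarrow> (e = 0 \<or> e = 1) \<and> (\<forall>n. free n {e}) \<and> \<not> (\<exists>\<kappa>>0. \<forall>n. \<kappa> \<le> infdist (F n e) C)"

text \<open>A segment from e to f^p(e) that stayed free forever would contradict badness, by
  \<open>orbit_bounded_away\<close>. The lags 1 and 2 are those needed to compare points among three
  consecutive ones.\<close>

lemma bad_end_return:
  "\<exists>N. \<forall>e. bad_end e \<longrightarrow> (\<forall>p\<in>{1, 2}. \<not> free N (closed_segment e (F p e)))"
proof -
  have "\<exists>N. bad_end e \<longrightarrow> \<not> free N (closed_segment e (F p e))" if "p \<in> {1, 2}" for e and p :: nat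
  proof (rule ccontr)
    assume "\<nexists>N. bad_end e \<longrightarrow> \<not> free N (closed_segment e (F p e))"
    then have "bad_end e" "\<And>n. free n (closed_segment e (F p e))" by blast+
    moreover have "p \<ge> 1" using that by auto
    ultimately show False using orbit_bounded_away unfolding bad_end_def by blast
  qed
  then have ex: "\<exists>N. \<not> free N (closed_segment e (F p e))" if "p \<in> {1, 2}" "bad_end e" for e and p :: nat
    using that by blast
  define n where "n = (\<lambda>e p. SOME N. \<not> free N (closed_segment e (F p e)))"
  have n: "\<not> free (n e p) (closed_segment e (F p e))" if "p \<in> {1, 2}" "bad_end e" for e and p :: nat
    unfolding n_def by (rule someI_ex[OF ex[OF that]])
  \<comment> \<open>A common upper bound for the four pairs of end point and lag; freeness passes to
    smaller times.\<close>
  define N where "N = n 0 1 + n 0 2 + n 1 1 + n 1 2"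
  show ?thesis
  proof (intro exI[of _ N] allI impI ballI notI)
    fix e p assume e: "bad_end e" and p: "p \<in> {1, 2::nat}" and fr: "free N (closed_segment e (F p e))"
    have "n e p \<le> N" using e p by (auto simp: N_def bad_end_def)
    then show False using n[OF p e] free_le[OF fr] by blast
  qed
qed

text \<open>An end point that is not bad either hits \<open>C\<close>, which freeness up to a large
  time excludes, or has an orbit at positive distance from \<open>C\<close>.\<close>

lemma other_ends:
  "\<exists>N. \<exists>\<kappa>>0. \<forall>e\<in>{0, 1}. free N {e} \<longrightarrow> \<not> bad_end e \<longrightarrow> (\<forall>n. \<kappa> \<le> infdist (F n e) C)"
proof -
  have "\<exists>N. \<exists>\<kappa>>0. e \<in> {0, 1} \<longrightarrow> free N {e} \<longrightarrow> \<not> bad_end e \<longrightarrow> (\<forall>n. \<kappa> \<le> infdist (F n e) C)" for e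
    unfolding bad_end_def by (metis insertE singletonD zero_less_one)
  then obtain N \<kappa> where *: "\<And>e. \<kappa> e > 0"
    "\<And>e. e \<in> {0, 1} \<Longrightarrow> free (N e) {e} \<Longrightarrow> \<not> bad_end e \<Longrightarrow> (\<forall>n. \<kappa> e \<le> infdist (F n e) C)"
    by metis
  show ?thesis
  proof (intro exI[of _ "N 0 + N 1"] exI[of _ "min (\<kappa> 0) (\<kappa> 1)"] conjI ballI impI allI)
    show "0 < min (\<kappa> 0) (\<kappa> 1)" using *(1) by simp
    fix e n assume e: "e \<in> {0, 1::real}" "free (N 0 + N 1) {e}" "\<not> bad_end e"
    have "free (N e) {e}" using e by (auto intro: free_le)
    then have "\<kappa> e \<le> infdist (F n e) C" using *(2) e by blast
    then show "min (\<kappa> 0) (\<kappa> 1) \<le> infdist (F n e) C" using e(1) by auto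
  qed
qed

definition V :: "nat \<Rightarrow> real set" where
  "V N = {x. \<exists>e. bad_end e \<and> free N (closed_segment x e)}"

text \<open>There are only two end points, so among three consecutive points in \<open>V N\<close> two belong to the same
  one.\<close>
lemma V_leaves:
  assumes N0: "\<And>e p. bad_end e \<Longrightarrow> p \<in> {1, 2} \<Longrightarrow> \<not> free N0 (closed_segment e (F p e))"
    and N: "N \<ge> N0 + 2" and x: "x \<in> V N" "f x \<in> V N"
  shows "f (f x) \<notin> V N"
proof
  assume x2: "f (f x) \<in> V N"
  \<comment> \<open>Two orbit points p steps apart are joined to the same e: the image of the first
    segment, together with the second, joins e to f^p(e). The margin 2 in N leaves room for the p
    iterates.\<close>
  have clash: False
    if "bad_end e" and a: "free N (closed_segment y e)" and b: "free N (closed_segment (F p y) e)"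
      and p: "p \<in> {1, 2}" for e y p
  proof -
    have "free p (closed_segment y e)" using a p N by (auto intro: free_le)
    from free_segment(3)[OF this]
    have img: "F p ` closed_segment y e = closed_segment (F p y) (F p e)" .
    have "free N0 (closed_segment (F p y) (F p e))"
      unfolding img[symmetric] by (rule free_image, rule free_le[OF a]) (use p N in auto)
    moreover have "free N0 (closed_segment (F p y) e)" using b N by (auto intro: free_le)
    moreover have "closed_segment e (F p e) \<subseteq>
        closed_segment (F p y) (F p e) \<union> closed_segment (F p y) e"
      by (auto simp: closed_segment_eq_real_ivl split: if_splits)
    ultimately have "free N0 (closed_segment e (F p e))" by (meson free_Un free_subset)
    then show False using N0 that(1) p by blast
  qed
  obtain e0 e1 e2 where e: "bad_end e0" "free N (closed_segment x e0)" "bad_end e1" "free N (closed_segment (f x) e1)"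
     "bad_end e2" "free N (closed_segment (f (f x)) e2)"
    using x x2 by (auto simp: V_def)
  have "e0 = e1 \<or> e1 = e2 \<or> e0 = e2" using e(1,3,5) by (auto simp: bad_end_def)
  moreover have "e0 \<noteq> e1" using clash[OF e(1,2), of 1] e(4) by auto
  moreover have "e1 \<noteq> e2" using clash[OF e(3,4), of 1] e(6) by auto
  moreover have "e0 \<noteq> e2" using clash[OF e(1,2), of 2] e(6) by (auto simp: numeral_2_eq_2)
  ultimately show False by blast
qed

end

section \<open>The derivative bound\<close>

text \<open>The order in which these constants can be chosen matters: first those for small
  neighbourhoods and derivatives (\<eta>, \<omega>1, \<omega>2, \<eta>', B, KL), then L and M, then
  \<kappa> and \<rho>s, which depend on L and M through \<open>end_estimate\<close>, and last K'.
  The product \<eta> \<omega>1 \<omega>2 in the conditions on L and M provides for the ratio of the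
  two target constants.\<close>

locale classA_consts = classA_map +
  fixes N N0 :: nat and \<eta> \<eta>' \<omega>1 \<omega>2 B KL L M \<kappa> \<rho>s \<eta>F \<omega>F K' :: real
  assumes N_ge: "N \<ge> N0 + 2"
    and N0: "\<And>e p. bad_end e \<Longrightarrow> p \<in> {1, 2} \<Longrightarrow> \<not> free N0 (closed_segment e (F p e))"
    and other_end: "\<And>e n. e \<in> {0, 1} \<Longrightarrow> free N {e} \<Longrightarrow> \<not> bad_end e \<Longrightarrow> \<kappa> + \<rho>s \<le> infdist (F n e) C"
    and near: "\<And>c x u s. c \<in> C \<Longrightarrow> x \<in> {0..1} \<Longrightarrow> x \<noteq> c \<Longrightarrow> \<bar>x - c\<bar> < \<eta> \<Longrightarrow> u \<in> open_segment x c \<Longrightarrow>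
       s \<in> {1, 2} \<Longrightarrow> \<bar>F s x - F s u\<bar> \<le> KL * D s x * \<bar>x - u\<bar>"
    and bad_far: "\<And>e. bad_end e \<Longrightarrow> 2 * \<eta> \<le> infdist e C"
    and lower1: "\<And>x. x \<in> {0..1} \<Longrightarrow> \<eta> \<le> infdist x C \<Longrightarrow> \<omega>1 \<le> \<bar>Df x\<bar>"
    and lower2: "\<And>x. x \<in> {0..1} \<Longrightarrow> \<omega>1 * \<eta> \<le> infdist x C \<Longrightarrow> \<omega>2 \<le> \<bar>Df x\<bar>"
    and bad_image: "\<And>e x s. bad_end e \<Longrightarrow> s \<in> {1, 2} \<Longrightarrow> free s (closed_segment x e) \<Longrightarrow> infdist x C < \<eta> \<Longrightarrow>
       \<eta>' \<le> \<bar>F s x - F s e\<bar>"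
    and Df_le: "\<And>x. x \<in> {0..1} - C \<Longrightarrow> \<bar>Df x\<bar> \<le> B"
    and end_est: "\<And>x n b i. b \<noteq> x \<Longrightarrow> i < n \<Longrightarrow> F i b \<in> C \<Longrightarrow> free i (closed_segment x b) \<Longrightarrow>
       free n (closed_segment x b - {b}) \<Longrightarrow> adm \<rho>s n x \<Longrightarrow>
       \<exists>Y. is_end n x b Y \<and> (\<kappa> \<le> \<bar>F n x - Y\<bar> \<or> L * infdist (F i x) C \<le> \<bar>F n x - Y\<bar> \<or>
          M * \<bar>x - b\<bar> * sqrt (D n x * D i b) \<le> \<bar>F n x - Y\<bar>)"
    and short: "\<And>x n. n \<le> N + 2 \<Longrightarrow> free n {x} \<Longrightarrow> infdist (F n x) C \<le> \<rho>s \<Longrightarrow>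
       (\<forall>j<n. \<eta>F \<le> infdist (F j x) C) \<and> \<omega>F \<le> D n x"
    and \<eta>: "0 < \<eta>" "\<eta> \<le> 1" and \<eta>': "0 < \<eta>'" and \<omega>: "0 < \<omega>1" "\<omega>1 \<le> 1" "0 < \<omega>2" "\<omega>2 \<le> 1"
    and B: "B \<ge> 1" and KL: "KL \<ge> 1" and \<kappa>: "0 < \<kappa>" and \<rho>s: "0 < \<rho>s" and \<eta>F: "0 < \<eta>F"
    and L: "L * (\<eta> * \<omega>1 * \<omega>2) \<ge> 4 * KL"
    and M: "M * (\<eta> * \<omega>1 * \<omega>2) \<ge> 8" "M \<ge> 4 * KL" "M * \<eta>' \<ge> 4 * KL * B"
    and K': "0 < K'" "K' \<le> 1" "4 * KL * K' \<le> \<kappa>" "K' \<le> \<omega>F * \<eta>F" "K' \<le> \<rho>s"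
begin

section \<open>Target constants and admissible pieces of orbits\<close>

definition "\<Omega> = 1 / (\<eta> * \<omega>1 * \<omega>2)"
definition "K = K' * (\<eta> * \<omega>1 * \<omega>2)"

lemma scale: "0 < \<eta> * \<omega>1 * \<omega>2" "\<eta> * \<omega>1 * \<omega>2 \<le> 1" "\<eta> * \<omega>1 * \<omega>2 \<le> \<eta> * \<omega>1"
  using \<eta> \<omega> by (auto simp: mult_le_one mult_left_le)

lemma \<Omega>: "\<Omega> \<ge> 1"
  unfolding \<Omega>_def using scale by (simp add: le_divide_eq)

lemma K: "0 < K" "K \<le> K'" "K \<le> 1" "K' = \<Omega> * K" "K / \<eta> = K' * \<omega>1 * \<omega>2" "K \<le> \<omega>1 * \<eta>" "K \<le> \<rho>s"
proof -
  show 1: "0 < K" "K \<le> K'" using K' scale by (auto simp: K_def mult_left_le)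
  then show "K \<le> 1" "K \<le> \<rho>s" using K' by auto
  show "K' = \<Omega> * K" "K / \<eta> = K' * \<omega>1 * \<omega>2" using scale \<eta> \<omega> by (auto simp: K_def \<Omega>_def)
  have "K \<le> 1 * (\<eta> * \<omega>1 * \<omega>2)" unfolding K_def using K' scale by (intro mult_right_mono) auto
  then show "K \<le> \<omega>1 * \<eta>" using scale by (simp add: mult.commute)
qed

lemma L_M: "L * K \<ge> 4 * KL * K'" "L \<ge> 4 * KL" "M \<ge> 8 * \<Omega>" "M \<ge> 0" "L \<ge> 0"
proof -
  show "L * K \<ge> 4 * KL * K'"
    using mult_right_mono[OF L, of K'] K' by (simp add: K_def algebra_simps)
  have "L * (\<eta> * \<omega>1 * \<omega>2) > 0" using L KL by linarith
  then show L0: "L \<ge> 0" using scale by (simp add: zero_less_mult_iff)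
  then have "L * (\<eta> * \<omega>1 * \<omega>2) \<le> L * 1" using scale by (intro mult_left_mono) auto
  then show "L \<ge> 4 * KL" using L by simp
  show "M \<ge> 8 * \<Omega>" using M(1) scale by (simp add: \<Omega>_def divide_le_eq)
  show "M \<ge> 0" using M(2) KL by simp
qed

text \<open>Points of \<open>V N\<close> may lose the factor \<eta> \<omega>1 \<omega>2 relative to
  the others. The loss does not accumulate, since at most two consecutive points of an orbit lie in
  \<open>V N\<close>.\<close>

definition "tgt x = (if x \<in> V N then K else K')"

lemma tgt: "0 < tgt x" "tgt x \<le> K'" "K \<le> tgt x" "tgt x \<le> 1"
  using K K' by (auto simp: tgt_def)

definition "bound_holds n \<longleftrightarrow> (\<forall>x. adm \<rho>s n x \<longrightarrow> trunc (tgt x) (infdist x C) \<le> D n x)"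

lemma bound_holdsD: "bound_holds n \<Longrightarrow> adm \<rho>s n x \<Longrightarrow> trunc (tgt x) (infdist x C) \<le> D n x"
  unfolding bound_holds_def by blast

lemma bound_holds_K: "bound_holds n \<Longrightarrow> adm \<rho>s n x \<Longrightarrow> trunc K (infdist x C) \<le> D n x"
  using bound_holdsD trunc_mono[OF K(1) tgt(3)] by (meson order_trans)

lemma adm_free: "adm \<rho>s n x \<Longrightarrow> free n {x}"
  by (simp add: adm_def)

lemma adm_in: "adm \<rho>s n x \<Longrightarrow> x \<in> {0..1}"
  by (simp add: adm_def free_singleton)

lemma adm_close: "adm \<rho>s n x \<Longrightarrow> infdist (F n x) C \<le> \<rho>s"
  unfolding adm_def using infdist_le_C by (meson order_trans)

lemma adm_record:
  assumes "free q {x}" "infdist (F q x) C \<le> \<rho>s"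
    "\<And>j. j < q \<Longrightarrow> infdist (F q x) C \<le> infdist (F j x) C"
  shows "adm \<rho>s q x"
proof -
  obtain c where c: "c \<in> C" "infdist (F q x) C = \<bar>F q x - c\<bar>" using nearest_in_C by blast
  have "\<bar>F q x - c\<bar> \<le> \<bar>F j x - c'\<bar>" if "j < q" "c' \<in> C" for j c'
    using assms(3)[OF that(1)] infdist_le_C[OF that(2), of "F j x"] c(2) by linarith
  then show ?thesis using assms(1,2) c unfolding adm_def by metis
qed

lemma adm_shift:
  assumes "adm \<rho>s n x" "q \<le> n"
  shows "adm \<rho>s (n - q) (F q x)"
proof -
  have n: "F (n - q) (F q x) = F n x"
    using assms(2) by (simp flip: iter_add)
  have j: "F j (F q x) = F (q + j) x" for j by (simp add: iter_add)
  have "free (n - q) {F q x}"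
    using free_image[of q "n - q" "{x}"] adm_free[OF assms(1)] assms(2) by simp
  moreover have "q + j < n" if "j < n - q" for j using that by simp
  ultimately show ?thesis using assms(1) unfolding adm_def n unfolding j by blast
qed

text \<open>Makes the induction hypothesis available at an end b of a branch, up to the time at
  which b hits \<open>C\<close>.\<close>

lemma adm_hit: "free i {b} \<Longrightarrow> F i b \<in> C \<Longrightarrow> adm \<rho>s i b"
  by (rule adm_record) (use \<rho>s in \<open>auto simp: infdist_nonneg\<close>)

text \<open>Splitting at the closest approach before time \<open>j\<close>: from there on the bound is \<open>1\<close>.\<close>
lemma record_split:
  assumes IH: "\<And>m. m < n \<Longrightarrow> bound_holds m" and ad: "adm \<rho>s n x" and j: "j < n"
    and lt: "infdist (F j x) C < infdist x C" and ltK: "infdist (F j x) C < K"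
  shows "trunc (tgt x) (infdist x C) \<le> D n x"
proof -
  define q where "q = arg_min_on (\<lambda>i. infdist (F i x) C) {..j}"
  have q: "q \<in> {..j}" and qmin: "\<And>i. i \<in> {..j} \<Longrightarrow> infdist (F q x) C \<le> infdist (F i x) C"
    using arg_min_if_finite(1)[of "{..j}" "\<lambda>i. infdist (F i x) C"]
      arg_min_least[of "{..j}" _ "\<lambda>i. infdist (F i x) C"] by (auto simp: q_def)
  have qK: "infdist (F q x) C < K" using qmin[of j] ltK by simp
  have "q \<noteq> 0"
  proof
    assume "q = 0"
    then show False using qmin[of j] lt by simp
  qed
  have qn: "q < n" using q j by simp
  have "adm \<rho>s q x"
  proof (rule adm_record)
    show "free q {x}" using adm_free[OF ad] qn by (auto intro: free_le)
    show "infdist (F q x) C \<le> \<rho>s" using qK K(7) by simp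
    show "infdist (F q x) C \<le> infdist (F i x) C" if "i < q" for i
      using qmin[of i] q that by simp
  qed
  then have 1: "trunc (tgt x) (infdist x C) \<le> D q x" using IH[OF qn] bound_holdsD by blast
  have "n - q < n" using \<open>q \<noteq> 0\<close> qn by simp
  then have "trunc K (infdist (F q x) C) \<le> D (n - q) (F q x)"
    using IH bound_holds_K adm_shift[OF ad] qn by simp
  moreover have "trunc K (infdist (F q x) C) = 1" using qK K(1) by (simp add: trunc_eq_1)
  ultimately have 2: "1 \<le> D (n - q) (F q x)" by simp
  have "D n x = D q x * D (n - q) (F q x)" using D_add[of q "n - q" x] qn by simp
  also have "\<dots> \<ge> D q x * 1" using 2 by (intro mult_left_mono) auto
  finally show ?thesis using 1 by simp
qed

text \<open>If the bound fails, \<open>D n x * mu\<close> is at most KL K' and at most KL times the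
  distance of x to \<open>C\<close>. This settles the first alternative, and the second unless the
  j-th point is both closer to \<open>C\<close> than x and within K of it; in that case
  \<open>record_split\<close> applies. The factor 4 is what later makes the three-point inequality
  contradictory.\<close>

lemma end_small:
  assumes IH: "\<And>m. m < n \<Longrightarrow> bound_holds m" and ad: "adm \<rho>s n x"
    and G: "D n x < trunc (tgt x) (infdist x C)"
    and mu: "0 \<le> mu" "mu \<le> KL * infdist x C"
    and tri: "\<kappa> \<le> \<gamma> \<or> (\<exists>j<n. L * infdist (F j x) C \<le> \<gamma>) \<or> 4 * D n x * mu \<le> \<gamma>"
  shows "4 * D n x * mu \<le> \<gamma>"
proof -
  define h where "h = trunc (tgt x) (infdist x C)"
  have h: "h \<le> 1" "h * infdist x C \<le> K'" "0 \<le> h"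
    using trunc_le_1[OF tgt(1), of x "infdist x C"] trunc_mult_le[OF tgt(1) infdist_nonneg, of x x C] tgt(2)[of x]
      trunc_pos[OF tgt(1), of x "infdist x C"]
    by (auto simp: h_def)
  have a: "4 * D n x * mu \<le> 4 * KL * (h * infdist x C)"
  proof -
    have "D n x * mu \<le> h * (KL * infdist x C)" using G mu h by (intro mult_mono) (auto simp: h_def)
    then show ?thesis by (simp add: mult.left_commute)
  qed
  also have "\<dots> \<le> 4 * KL * K'" using h KL by (intro mult_left_mono) auto
  finally have b: "4 * D n x * mu \<le> 4 * KL * K'" .
  have c: "4 * D n x * mu \<le> 4 * KL * infdist x C"
  proof -
    have "h * infdist x C \<le> 1 * infdist x C" using h infdist_nonneg by (intro mult_right_mono) auto
    then have "4 * KL * (h * infdist x C) \<le> 4 * KL * infdist x C" using KL by (intro mult_left_mono) auto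
    then show ?thesis using a by linarith
  qed
  from tri show ?thesis
  proof (elim disjE exE conjE)
    assume "\<kappa> \<le> \<gamma>"
    then show ?thesis using b K'(3) by linarith
  next
    fix j assume j: "j < n" and \<gamma>: "L * infdist (F j x) C \<le> \<gamma>"
    consider "infdist x C \<le> infdist (F j x) C" | "K \<le> infdist (F j x) C"
      | "infdist (F j x) C < infdist x C" "infdist (F j x) C < K" by linarith
    then show ?thesis
    proof cases
      case 1
      have "4 * KL * infdist x C \<le> L * infdist (F j x) C"
        using 1 L_M KL infdist_nonneg by (intro mult_mono) auto
      then show ?thesis using c \<gamma> by linarith
    next
      case 2
      have "L * K \<le> L * infdist (F j x) C" using 2 L_M by (intro mult_left_mono) auto
      then show ?thesis using b \<gamma> L_M(1) by linarith
    next
      case 3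
      then show ?thesis using record_split[OF IH ad j] G by linarith
    qed
  qed
qed

text \<open>The alternatives of \<open>end_estimate\<close> with the derivative at the end replaced
  by its inductive bound; this form also covers an end point of [0,1] reached by the branch.\<close>

abbreviation "end_alt n x b Y \<equiv> \<kappa> \<le> \<bar>F n x - Y\<bar> \<or>
  (\<exists>j<n. L * infdist (F j x) C \<le> \<bar>F n x - Y\<bar>) \<or>
  M * \<bar>x - b\<bar> * sqrt (D n x * trunc K (infdist b C)) \<le> \<bar>F n x - Y\<bar>"

lemma end_of_hit:
  assumes IH: "\<And>m. m < n \<Longrightarrow> bound_holds m" and ad: "adm \<rho>s n x"
    and b: "b \<noteq> x" "i < n" "F i b \<in> C" "free i (closed_segment x b)" "free n (closed_segment x b - {b})"
  shows "\<exists>Y. is_end n x b Y \<and> end_alt n x b Y"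
proof -
  have "trunc K (infdist b C) \<le> D i b"
    using IH[OF b(2)] bound_holds_K adm_hit[OF free_imp_singleton[OF b(4)] b(3)] by simp
  then have "sqrt (D n x * trunc K (infdist b C)) \<le> sqrt (D n x * D i b)"
    by (intro real_sqrt_le_mono mult_left_mono) auto
  then have "M * \<bar>x - b\<bar> * sqrt (D n x * trunc K (infdist b C)) \<le> M * \<bar>x - b\<bar> * sqrt (D n x * D i b)"
    using L_M(4) by (intro mult_left_mono) auto
  then show ?thesis using end_est[OF b ad] b(2) by (meson order_trans)
qed

text \<open>Either the branch reaches e, which is then not bad, so that f^n(e) is far from
  \<open>C\<close> while x_n is within \<rho>s of it; or it stops at a preimage of \<open>C\<close>.
  The clause \<open>b = e \<or> \<not> free n {b}\<close> records that the branch is maximal;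
  \<open>near_boundary_step\<close> relies on this.\<close>

lemma end_in_direction:
  assumes IH: "\<And>m. m < n \<Longrightarrow> bound_holds m" and ad: "adm \<rho>s n x" and n: "n \<ge> N"
    and e: "e \<in> {0, 1}" and nb: "bad_end e \<Longrightarrow> \<not> free n (closed_segment x e)"
  shows "x \<noteq> e" and
    "\<exists>b Y. b \<in> closed_segment x e \<and> b \<noteq> x \<and> (b = e \<or> \<not> free n {b}) \<and> is_end n x b Y \<and>
      end_alt n x b Y"
proof -
  have far: "\<kappa> + \<rho>s \<le> infdist (F n e) C" if fr: "free n (closed_segment x e)"
  proof -
    have "free N {e}" using free_mono[OF fr n, of "{e}"] by simp
    moreover have "\<not> bad_end e" using nb fr by blast
    ultimately show ?thesis using other_end e by blast
  qed
  show xe: "x \<noteq> e"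
  proof
    assume "x = e"
    then have "free n (closed_segment x e)" using adm_free[OF ad] by simp
    from far[OF this] show False using adm_close[OF ad] \<open>x = e\<close> \<kappa> by simp
  qed
  have e01: "e \<in> {0..1}" using e by auto
  consider "free n (closed_segment x e)" | b i where "b \<in> closed_segment x e" "b \<noteq> x" "i < n" "F i b \<in> C"
     "free i (closed_segment x b)" "free n (closed_segment x b - {b})"
    using first_hit[OF e01 _ adm_free[OF ad]] xe by metis
  then show "\<exists>b Y. b \<in> closed_segment x e \<and> b \<noteq> x \<and> (b = e \<or> \<not> free n {b}) \<and> is_end n x b Y \<and>
      end_alt n x b Y"
  proof cases
    case 1
    have "is_end n x e (F n e)" using is_end_free[OF 1] xe by auto
    moreover have "\<kappa> \<le> \<bar>F n x - F n e\<bar>"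
      using far[OF 1] adm_close[OF ad] infdist_lipschitz[of "F n e" "F n x"] by linarith
    ultimately show ?thesis using xe by (intro exI[of _ e] exI[of _ "F n e"]) auto
  next
    case 2
    have "\<not> free n {b}" using 2(3,4) by (auto simp: free_singleton)
    then show ?thesis using end_of_hit[OF IH ad 2(2-6)] 2(1,2) by blast
  qed
qed

text \<open>For n >= 1 no critical point lies inside a branch, so the nearest one is at or beyond an
  end.\<close>

lemma min_dist_le:
  assumes "is_end n x a Ya" "is_end n x b Yb" "x \<in> open_segment a b" "n \<ge> 1"
  shows "min \<bar>x - a\<bar> \<bar>x - b\<bar> \<le> infdist x C"
proof -
  obtain c where c: "c \<in> C" "infdist x C = \<bar>x - c\<bar>" using nearest_in_C by blast
  have *: "c \<notin> closed_segment x y - {y}" if "is_end n x y Y" for y Y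
    using that c(1) assms(4) unfolding is_end_def free_def by (metis funpow_0 less_le_trans zero_less_one)
  have "c \<notin> closed_segment x a - {a}" "c \<notin> closed_segment x b - {b}" using * assms(1,2) by blast+
  then show ?thesis
    unfolding c(2) using assms(3)
    by (auto simp: closed_segment_eq_real_ivl open_segment_eq_real_ivl abs_if min_def split: if_splits)
qed

lemma interior_step:
  assumes IH: "\<And>m. m < n \<Longrightarrow> bound_holds m" and ad: "adm \<rho>s n x" and n: "n \<ge> N" "n \<ge> 1"
    and nb: "\<And>e. bad_end e \<Longrightarrow> \<not> free n (closed_segment x e)"
  shows "trunc (tgt x) (infdist x C) \<le> D n x"
proof (rule ccontr)
  assume "\<not> ?thesis"
  then have G: "D n x < trunc (tgt x) (infdist x C)" by simp
  have Gpos: "D n x > 0" using D_pos[OF adm_free[OF ad]] .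
  have xC: "x \<notin> C" using adm_free[OF ad] n(2) by (auto simp: free_singleton)
  define \<rho>0 where "\<rho>0 = infdist x C"
  have \<rho>0: "\<rho>0 > 0" using infdist_pos[OF xC] by (simp add: \<rho>0_def)
  have x01: "x \<in> {0..1}" using adm_in[OF ad] .
  have x0: "x \<noteq> 0" and x1: "x \<noteq> 1"
    using end_in_direction(1)[OF IH ad n(1) _ nb] by auto
  obtain a Ya where a: "a \<in> closed_segment x 0" "a \<noteq> x" "is_end n x a Ya"
      "end_alt n x a Ya"
    using end_in_direction(2)[OF IH ad n(1) _ nb, of 0] by blast
  obtain b Yb where b: "b \<in> closed_segment x 1" "b \<noteq> x" "is_end n x b Yb"
      "end_alt n x b Yb"
    using end_in_direction(2)[OF IH ad n(1) _ nb, of 1] by blast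
  have xab: "x \<in> open_segment a b"
    using a(1,2) b(1,2) x01 by (auto simp: closed_segment_eq_real_ivl open_segment_eq_real_ivl split: if_splits)
  define \<alpha> where "\<alpha> = \<bar>x - a\<bar>"
  define \<beta> where "\<beta> = \<bar>x - b\<bar>"
  define mu where "mu = \<alpha> * \<beta> / (\<alpha> + \<beta>)"
  have \<alpha>: "\<alpha> > 0" and \<beta>: "\<beta> > 0" using a(2) b(2) by (auto simp: \<alpha>_def \<beta>_def)
  have mu: "mu > 0" using \<alpha> \<beta> by (simp add: mu_def)
  have minle: "min \<alpha> \<beta> \<le> \<rho>0"
    using min_dist_le[OF a(3) b(3) xab n(2)] by (simp add: \<alpha>_def \<beta>_def \<rho>0_def)
  have "mu \<le> min \<alpha> \<beta>"
    using \<alpha> \<beta> by (auto simp: mu_def pos_divide_le_eq algebra_simps min_def mult_left_mono)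
  then have mu\<rho>: "mu \<le> KL * infdist x C"
  proof -
    have "1 * \<rho>0 \<le> KL * \<rho>0" using KL \<rho>0 by (intro mult_right_mono) auto
    then show ?thesis using \<open>mu \<le> min \<alpha> \<beta>\<close> minle unfolding \<rho>0_def by linarith
  qed
  \<comment> \<open>An end may lie in \<open>V N\<close>, so its inductive bound has the smaller
    constant K even if the target at x is K'. The ratio \<Omega> is absorbed by M.\<close>
  have H: "tgt x \<le> \<Omega> * K" using tgt(2)[of x] K(4) by simp
  have good_a: "4 * D n x * mu \<le> M * \<bar>x - a\<bar> * sqrt (D n x * trunc K (infdist a C))"
    using good_end_arith[OF \<beta> \<alpha> _ \<rho>0 _ K(1) \<Omega> tgt(1) H Gpos _ L_M(3), of "infdist a C"] minle G
      infdist_lipschitz[of a x] by (simp add: \<alpha>_def \<rho>0_def mu_def abs_minus_commute min.commute algebra_simps)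
  have good_b: "4 * D n x * mu \<le> M * \<bar>x - b\<bar> * sqrt (D n x * trunc K (infdist b C))"
    using good_end_arith[OF \<alpha> \<beta> _ \<rho>0 _ K(1) \<Omega> tgt(1) H Gpos _ L_M(3), of "infdist b C"] minle G
      infdist_lipschitz[of b x] by (simp add: \<beta>_def \<rho>0_def mu_def abs_minus_commute algebra_simps)
  have ga: "4 * D n x * mu \<le> \<bar>F n x - Ya\<bar>"
    by (rule end_small[OF IH ad G]) (use mu mu\<rho> a(4) good_a in auto)
  have gb: "4 * D n x * mu \<le> \<bar>F n x - Yb\<bar>"
    by (rule end_small[OF IH ad G]) (use mu mu\<rho> b(4) good_b in auto)
  have pos: "0 < 4 * D n x * mu" using Gpos mu by simp
  have "1 / mu = 1 / \<alpha> + 1 / \<beta>" using \<alpha> \<beta> by (simp add: mu_def field_simps)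
  also have "\<dots> \<le> D n x * (1 / \<bar>F n x - Ya\<bar> + 1 / \<bar>F n x - Yb\<bar>)"
    using three_point_ends(1)[OF a(3) b(3) xab] by (simp add: \<alpha>_def \<beta>_def)
  also have "\<dots> \<le> D n x * (1 / (4 * D n x * mu) + 1 / (4 * D n x * mu))"
    using ga gb pos by (intro mult_left_mono add_mono frac_le) auto
  also have "\<dots> = 1 / (2 * mu)" using Gpos mu by (simp add: field_simps)
  finally show False using mu by (simp add: field_simps)
qed

text \<open>At distance at least \<eta> from \<open>C\<close> the target is at most K/\<eta> = K'
  \<omega>1 \<omega>2. One or two derivative factors, bounded below by \<omega>1 and \<omega>2, lead
  out of \<open>V N\<close>, where the constant K' is available.\<close>

lemma far_boundary_step:
  assumes IH: "\<And>m. m < n \<Longrightarrow> bound_holds m" and ad: "adm \<rho>s n x" and n: "n \<ge> 2"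
    and V: "x \<in> V N" and far: "\<eta> \<le> infdist x C"
  shows "trunc (tgt x) (infdist x C) \<le> D n x"
proof -
  have x01: "x \<in> {0..1}" using adm_in[OF ad] .
  have fx01: "f x \<in> {0..1}" using f_in[OF x01] .
  have D1: "D n x = \<bar>Df x\<bar> * D (n - 1) (f x)" using D_add[of 1 "n - 1" x] n by simp
  have ad1: "adm \<rho>s (n - 1) (f x)" using adm_shift[OF ad, of 1] n by simp
  have w1: "\<omega>1 \<le> \<bar>Df x\<bar>" by (rule lower1[OF x01 far])
  have goal: "trunc (tgt x) (infdist x C) \<le> K / \<eta>"
  proof -
    have "trunc (tgt x) (infdist x C) \<le> K / infdist x C"
      using V K(1) far \<eta> by (simp add: tgt_def trunc_le_divide)
    also have "\<dots> \<le> K / \<eta>" using far \<eta> K(1) by (intro divide_left_mono) auto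
    finally show ?thesis .
  qed
  have inV: "K' \<le> D m y" if "bound_holds m" "adm \<rho>s m y" "y \<notin> V N" for m y
  proof -
    have "K' / 1 \<le> trunc K' (infdist y C)"
      by (rule trunc_ge) (use K' infdist_le_1[OF adm_in[OF that(2)]] in auto)
    then show ?thesis using bound_holdsD[OF that(1,2)] that(3) by (simp add: tgt_def)
  qed
  have "K / \<eta> \<le> D n x"
  proof (cases "f x \<in> V N")
    case False
    have "K' * \<omega>1 * \<omega>2 \<le> K' * \<omega>1 * 1" using K' \<omega> by (intro mult_left_mono) auto
    also have "\<dots> \<le> D (n - 1) (f x) * \<bar>Df x\<bar>"
      using inV[OF IH ad1 False] n w1 K' \<omega> by (simp add: mult_mono)
    finally show ?thesis using D1 K(5) by (simp add: mult.commute)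
  next
    case True
    show ?thesis
    \<comment> \<open>Below this threshold the induction hypothesis at f x already gives
      K/(\<omega>1 \<eta>), which pays for the factor \<omega>1 lost at x.\<close>
    proof (cases "infdist (f x) C < \<omega>1 * \<eta>")
      case small: True
      have "K / (\<omega>1 * \<eta>) \<le> trunc K (infdist (f x) C)"
        by (rule trunc_ge) (use K small in auto)
      also have "\<dots> \<le> D (n - 1) (f x)" using bound_holds_K[OF IH ad1] n by simp
      finally have "\<omega>1 * (K / (\<omega>1 * \<eta>)) \<le> \<bar>Df x\<bar> * D (n - 1) (f x)"
        using w1 \<omega> \<eta> K by (intro mult_mono) auto
      then show ?thesis using D1 \<omega> by simp
    next
      case False
      have w2: "\<omega>2 \<le> \<bar>Df (f x)\<bar>" using lower2[OF fx01] False by simp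
      have D2: "D (n - 1) (f x) = \<bar>Df (f x)\<bar> * D (n - 2) (f (f x))"
        using D_add[of 1 "n - 2" "f x"] n by (simp add: numeral_2_eq_2 Suc_diff_Suc)
      have ad2: "adm \<rho>s (n - 2) (f (f x))"
        using adm_shift[OF ad, of 2] n by (simp add: numeral_2_eq_2)
      have "f (f x) \<notin> V N" by (rule V_leaves[OF N0 N_ge V True])
      then have "K' \<le> D (n - 2) (f (f x))" using inV[OF IH ad2] n by simp
      then have "\<omega>1 * (\<omega>2 * K') \<le> \<bar>Df x\<bar> * (\<bar>Df (f x)\<bar> * D (n - 2) (f (f x)))"
        using w1 w2 \<omega> K' by (intro mult_mono) auto
      then show ?thesis using D1 D2 K(5) by (simp add: algebra_simps)
    qed
  qed
  then show ?thesis using goal by linarith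
qed

text \<open>Here \<open>f\<^sup>n\<close> is monotone all the way from \<open>x\<close> to the end point \<open>e\<close> of the interval, so there is no
  information on that side.  The comparison is made at \<open>f\<^sup>s x\<close> instead, where the branch of \<open>f\<^sup>n\<^sup>-\<^sup>s\<close>
  extends beyond \<open>f\<^sup>s e\<close>; this costs only a constant since \<open>x\<close> is close to a critical point.\<close>
lemma near_boundary_step:
  assumes IH: "\<And>m. m < n \<Longrightarrow> bound_holds m" and ad: "adm \<rho>s n x" and n: "n \<ge> N + 2"
    and e: "bad_end e" and fe: "free n (closed_segment x e)" and close: "infdist x C < \<eta>"
  shows "trunc (tgt x) (infdist x C) \<le> D n x"
proof (rule ccontr)
  assume "\<not> ?thesis"
  then have G: "D n x < trunc (tgt x) (infdist x C)" by simp
  define G0 where "G0 = D n x"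
  have Gpos: "G0 > 0" using D_pos[OF adm_free[OF ad]] by (simp add: G0_def)
  have V: "x \<in> V N" using e free_le[OF fe, of N] n by (auto simp: V_def)
  have tgtx: "tgt x = K" using V by (simp add: tgt_def)
  \<comment> \<open>The first image of x outside \<open>V N\<close>: from there no branch of f^N
    runs into a bad end point.\<close>
  obtain s where s: "s \<in> {1, 2::nat}" "F s x \<notin> V N"
  proof (cases "f x \<in> V N")
    case True
    then show ?thesis using V_leaves[OF N0 N_ge V True] that[of 2] by (simp add: numeral_2_eq_2)
  next
    case False
    then show ?thesis using that[of 1] by simp
  qed
  define y where "y = F s x"
  define \<nu> where "\<nu> = n - s"
  have sn: "s \<le> n" "\<nu> \<ge> N" "\<nu> < n" "n = s + \<nu>" using s n by (auto simp: \<nu>_def)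
  have ady: "adm \<rho>s \<nu> y" using adm_shift[OF ad sn(1)] by (simp add: \<nu>_def y_def)
  have IHy: "\<And>m. m < \<nu> \<Longrightarrow> bound_holds m" using IH sn by auto
  have iter_n: "F n u = F \<nu> (F s u)" for u unfolding sn(4) iter_add ..
  have x01: "x \<in> {0..1}" using adm_in[OF ad] .
  have e01: "e = 0 \<or> e = 1" using e by (simp add: bad_end_def)
  have n1: "n \<ge> 1" using n by simp
  have xC: "x \<notin> C" using adm_free[OF ad] n1 by (auto simp: free_singleton)
  obtain c where c: "c \<in> C" "infdist x C = \<bar>x - c\<bar>" using nearest_in_C by blast
  have xc: "x \<noteq> c" using c xC by auto
  have c01: "c \<in> {0..1}" using c C_subset by auto
  have xe: "x \<noteq> e" using bad_far[OF e] close \<eta> by auto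
  have cnot: "c \<notin> closed_segment x e" using fe n1 c(1) unfolding free_def by (metis funpow_0 less_le_trans zero_less_one)
  have xce: "x \<in> open_segment c e"
    using cnot e01 c01 x01 xc xe by (auto simp: closed_segment_eq_real_ivl open_segment_eq_real_ivl split: if_splits)
  have "\<not> free n (closed_segment x c)"
    using c(1) n1 unfolding free_def by (metis ends_in_segment(2) funpow_0 less_le_trans zero_less_one)
  then obtain b i where b: "b \<in> closed_segment x c" "b \<noteq> x" "i < n" "F i b \<in> C"
     "free i (closed_segment x b)" "free n (closed_segment x b - {b})"
    using first_hit[OF c01 _ adm_free[OF ad]] xc by metis
  obtain Yb where Yb: "is_end n x b Yb" "end_alt n x b Yb"
    using end_of_hit[OF IH ad b(2-6)] by blast
  define \<beta> where "\<beta> = \<bar>x - b\<bar>"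
  have \<beta>: "\<beta> > 0" "\<beta> \<le> infdist x C"
    using b(1,2) c(2) by (auto simp: \<beta>_def closed_segment_eq_real_ivl split: if_splits)
  have \<rho>b: "infdist b C \<le> infdist x C"
    using infdist_le_C[OF c(1), of b] b(1) c(2) by (auto simp: closed_segment_eq_real_ivl split: if_splits)
  have fse: "free s (closed_segment x e)" using fe sn by (auto intro: free_le)
  have ye: "y \<noteq> F s e"
    unfolding y_def using free_segment(1)[OF fse] xe by (auto dest: inj_onD)
  have fse01: "F s e \<in> {0..1}" using e01 by (intro iter_in) auto
  have y01: "y \<in> {0..1}" unfolding y_def by (rule iter_in[OF x01])
  \<comment> \<open>The end of [0,1] that lies beyond F s e as seen from y.\<close>
  define e' where "e' = (if y < F s e then 1 else (0::real))"
  have e': "e' \<in> {0, 1}" "F s e \<in> closed_segment y e'"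
    using fse01 y01 ye by (auto simp: e'_def closed_segment_eq_real_ivl)
  have nb': "\<not> free \<nu> (closed_segment y e')" if "bad_end e'"
  proof
    assume "free \<nu> (closed_segment y e')"
    then have "y \<in> V N" using that sn(2) by (auto simp: V_def intro: free_le)
    then show False using s(2) by (simp add: y_def)
  qed
  obtain A YA where A: "A \<in> closed_segment y e'" "A \<noteq> y" "A = e' \<or> \<not> free \<nu> {A}" "is_end \<nu> y A YA"
      "end_alt \<nu> y A YA"
    using end_in_direction(2)[OF IHy ady sn(2) e'(1) nb'] by blast
  have yn: "F \<nu> y = F n x" by (simp add: iter_n y_def)
  have fr_e: "free \<nu> (closed_segment y (F s e))"
    using free_image[of s \<nu> "closed_segment x e"] fe free_segment(3)[OF fse] unfolding sn(4) y_def by simp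
  \<comment> \<open>A ends a maximal branch at y, and the segment from y to F s e is free, so A
    cannot come before F s e.\<close>
  have eA: "F s e \<in> closed_segment y A"
  proof (cases "A = e'")
    case True
    then show ?thesis using e'(2) by simp
  next
    case False
    then have "A \<notin> closed_segment y (F s e)" using A(3) free_imp_singleton[OF fr_e] by blast
    then show ?thesis using A(1) e' by (auto simp: closed_segment_eq_real_ivl split: if_splits)
  qed
  have yA: "\<eta>' \<le> \<bar>y - A\<bar>"
  proof -
    have "\<eta>' \<le> \<bar>y - F s e\<bar>" unfolding y_def by (rule bad_image[OF e s(1) fse close])
    also have "\<dots> \<le> \<bar>y - A\<bar>" using eA by (auto simp: closed_segment_eq_real_ivl split: if_splits)
    finally show ?thesis .
  qed
  define \<gamma>A where "\<gamma>A = \<bar>F n x - YA\<bar>"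
  define \<gamma>b where "\<gamma>b = \<bar>F n x - Yb\<bar>"
  have Dsx: "D s x > 0" "D s x \<le> B^2"
  proof -
    show "D s x > 0" using free_le[OF adm_free[OF ad] sn(1)] by (rule D_pos)
    have fx: "free 2 {x}" using adm_free[OF ad] n by (auto intro: free_le)
    then have "x \<in> {0..1} - C" "f x \<in> {0..1} - C"
      using f_in by (auto simp: free_singleton numeral_2_eq_2 less_Suc_eq)
    then have d: "\<bar>Df x\<bar> \<le> B" "\<bar>Df (f x)\<bar> \<le> B" using Df_le by blast+
    from s(1) consider "s = 1" | "s = 2" by blast
    then show "D s x \<le> B^2"
    proof cases
      case 1
      then show ?thesis using d B self_le_power[of B 2] by simp
    next
      case 2
      have "\<bar>Df x\<bar> * \<bar>Df (f x)\<bar> \<le> B * B" using d B by (intro mult_mono) auto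
      then show ?thesis using 2 by (simp add: Dfn_def numeral_2_eq_2 abs_mult)
    qed
  qed
  have G0s: "G0 = D s x * D \<nu> y" unfolding G0_def sn(4) D_add y_def ..
  obtain t where t: "\<And>k. t k \<in> open_segment x b" "\<And>k. t 0 \<in> closed_segment x (t k)"
    "t \<longlonglongrightarrow> b" "(\<lambda>k. F n (t k)) \<longlonglongrightarrow> Yb" "\<And>k. free n (closed_segment x (t k))"
    using is_end_seq[OF Yb(1)] by blast
  have Yb_ne: "F n x \<noteq> Yb" using end_gap[OF Yb(1) t(1,2,4,5)] .
  \<comment> \<open>Three-point inequality for f^\<nu> at y with the ends A and F s u. The term 1/|y
    - A| is dropped, and \<open>near\<close> converts |y - F s u| into |x - u| at the cost of
    KL.\<close>
  have step: "1 / \<bar>x - t k\<bar> \<le> KL * G0 * (1 / \<gamma>A + 1 / \<bar>F n x - F n (t k)\<bar>)" for k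
  proof -
    define u where "u = t k"
    have u: "u \<in> open_segment x b" "free n (closed_segment x u)" using t by (auto simp: u_def)
    have uc: "u \<in> open_segment x c"
      using u(1) b(1) by (auto simp: open_segment_eq_real_ivl closed_segment_eq_real_ivl split: if_splits)
    have "free n (closed_segment e u)"
    proof -
      have "closed_segment e u \<subseteq> closed_segment x e \<union> closed_segment x u"
        by (auto simp: closed_segment_eq_real_ivl split: if_splits)
      then show ?thesis using fe u(2) by (meson free_Un free_subset)
    qed
    then have fs: "free s (closed_segment e u)" using sn by (auto intro: free_le)
    have xeu: "x \<in> closed_segment e u" "x \<noteq> e" "x \<noteq> u"
      using xce uc by (auto simp: open_segment_eq_real_ivl closed_segment_eq_real_ivl split: if_splits)
    have "y \<in> closed_segment (F s e) (F s u)" unfolding y_def using free_segment(3)[OF fs] xeu(1) by blast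
    moreover have yu: "F s u \<noteq> y" using free_segment(1)[OF fs] xeu by (auto simp: y_def dest: inj_onD)
    ultimately have yo: "y \<in> open_segment A (F s u)"
      using eA ye A(2) by (auto simp: open_segment_eq_real_ivl closed_segment_eq_real_ivl split: if_splits)
    have "free s (closed_segment x u)" using u(2) sn by (auto intro: free_le)
    then have "free \<nu> (closed_segment y (F s u))"
      using free_image[of s \<nu> "closed_segment x u"] u(2) free_segment(3)[of s x u] unfolding sn(4) y_def by simp
    then have ue: "is_end \<nu> y (F s u) (F n u)" unfolding iter_n using is_end_free yu by blast
    have "1 / \<bar>y - A\<bar> + 1 / \<bar>y - F s u\<bar> \<le> D \<nu> y * (1 / \<gamma>A + 1 / \<bar>F n x - F n u\<bar>)"
      using three_point_ends(1)[OF A(4) ue yo] by (simp add: yn \<gamma>A_def)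
    then have i1: "1 / \<bar>y - F s u\<bar> \<le> D \<nu> y * (1 / \<gamma>A + 1 / \<bar>F n x - F n u\<bar>)"
      using zero_le_divide_1_iff[of "\<bar>y - A\<bar>"] by (smt (verit) abs_ge_zero)
    have nl: "\<bar>y - F s u\<bar> \<le> KL * D s x * \<bar>x - u\<bar>"
      unfolding y_def by (rule near[OF c(1) x01 xc _ uc s(1)]) (use close c in simp)
    have "1 / (KL * D s x * \<bar>x - u\<bar>) \<le> 1 / \<bar>y - F s u\<bar>"
      using nl yu KL Dsx(1) xeu(3) by (intro divide_left_mono) (auto intro!: mult_pos_pos)
    then have "1 / (KL * D s x * \<bar>x - u\<bar>) \<le> D \<nu> y * (1 / \<gamma>A + 1 / \<bar>F n x - F n u\<bar>)"
      using i1 by linarith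
    then have "(KL * D s x) * (1 / (KL * D s x * \<bar>x - u\<bar>))
        \<le> (KL * D s x) * (D \<nu> y * (1 / \<gamma>A + 1 / \<bar>F n x - F n u\<bar>))"
      using KL Dsx by (intro mult_left_mono) auto
    moreover have "(KL * D s x) * (1 / (KL * D s x * \<bar>x - u\<bar>)) = 1 / \<bar>x - u\<bar>"
      using KL Dsx by simp
    ultimately show ?thesis unfolding G0s u_def by (simp add: mult.assoc)
  qed
  have lim: "1 / \<beta> \<le> KL * G0 * (1 / \<gamma>A + 1 / \<gamma>b)"
  proof (rule LIMSEQ_le)
    show "(\<lambda>k. 1 / \<bar>x - t k\<bar>) \<longlonglongrightarrow> 1 / \<beta>"
      unfolding \<beta>_def by (intro tendsto_intros t) (use b(2) in auto)
    show "(\<lambda>k. KL * G0 * (1 / \<gamma>A + 1 / \<bar>F n x - F n (t k)\<bar>)) \<longlonglongrightarrow> KL * G0 * (1 / \<gamma>A + 1 / \<gamma>b)"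
      unfolding \<gamma>b_def by (intro tendsto_intros t) (use Yb_ne in auto)
  qed (use step in auto)
  \<comment> \<open>In \<open>lim\<close> only 1/\<beta> is left on the left side and KL is a factor
    on the right, so KL \<beta> takes the place of the harmonic expression used in
    \<open>interior_step\<close>.\<close>
  define mu where "mu = KL * \<beta>"
  have mu: "mu > 0" "mu \<le> KL * infdist x C" using KL \<beta> by (auto simp: mu_def)
  have GK: "G0 < trunc K (infdist x C)" using G tgtx by (simp add: G0_def)
  have gb: "4 * D n x * mu \<le> \<gamma>b"
  proof (rule end_small[OF IH ad G])
    have "G0 \<le> sqrt (G0 * trunc K (infdist b C))"
    proof (rule real_le_rsqrt)
      have "G0 * G0 \<le> G0 * trunc K (infdist b C)"
        using GK Gpos trunc_antimono[OF K(1) \<rho>b] by (intro mult_left_mono) auto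
      then show "G0^2 \<le> G0 * trunc K (infdist b C)" by (simp add: power2_eq_square)
    qed
    then have "(4 * KL * \<beta>) * G0 \<le> (M * \<beta>) * sqrt (G0 * trunc K (infdist b C))"
      using M(2) \<beta> Gpos L_M(4) KL by (intro mult_mono mult_right_mono) auto
    then have "4 * D n x * mu \<le> M * \<bar>x - b\<bar> * sqrt (D n x * trunc K (infdist b C))"
      by (simp add: mu_def G0_def \<beta>_def algebra_simps)
    then show "\<kappa> \<le> \<gamma>b \<or> (\<exists>j<n. L * infdist (F j x) C \<le> \<gamma>b) \<or> 4 * D n x * mu \<le> \<gamma>b"
      using Yb(2) unfolding \<gamma>b_def by (meson order_trans)
  qed (use mu in auto)
  \<comment> \<open>The end A is seen from y: |y - A| >= \<eta>', and the factor D s x <= B^2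
    between G0 and D \<nu> y costs B under the root. The condition on M \<eta>' covers both.\<close>
  have gA: "4 * D n x * mu \<le> \<gamma>A"
  proof (rule end_small[OF IH ad G])
    have KA: "K \<le> trunc K (infdist A C)"
      using trunc_ge[OF K(1), of "infdist A C" 1] infdist_le_1[of A] A(1) y01 e'(1) K(3)
      by (auto simp: closed_segment_eq_real_ivl split: if_splits)
    have "sqrt (G0 * K) = sqrt (D s x) * sqrt (D \<nu> y * K)"
      unfolding G0s by (simp add: real_sqrt_mult)
    also have "\<dots> \<le> B * sqrt (D \<nu> y * trunc K (infdist A C))"
    proof (rule mult_mono)
      show "sqrt (D s x) \<le> B" using Dsx B by (intro real_le_lsqrt) auto
      show "sqrt (D \<nu> y * K) \<le> sqrt (D \<nu> y * trunc K (infdist A C))"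
        using KA by (intro real_sqrt_le_mono mult_left_mono) auto
      show "0 \<le> sqrt (D \<nu> y * K)" using K(1) by simp
    qed (use B in simp)
    finally have q1: "sqrt (G0 * K) \<le> B * sqrt (D \<nu> y * trunc K (infdist A C))" .
    have q2: "G0 * \<beta> \<le> sqrt (G0 * K)"
    proof (rule real_le_rsqrt)
      have "G0 * \<beta> \<le> trunc K (infdist x C) * infdist x C"
        using GK Gpos \<beta> by (intro mult_mono) auto
      also have "\<dots> \<le> K" by (rule trunc_mult_le[OF K(1) infdist_nonneg])
      finally have "G0 * \<beta> \<le> K" .
      moreover have "\<beta> \<le> 1" using \<beta>(2) infdist_le_1[OF x01] by linarith
      ultimately have "G0 * (G0 * \<beta> * \<beta>) \<le> G0 * (K * 1)"
        using Gpos \<beta> K(1) by (intro mult_left_mono mult_mono) auto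
      then show "(G0 * \<beta>)^2 \<le> G0 * K" by (simp add: power2_eq_square algebra_simps)
    qed
    have "4 * D n x * mu = (4 * KL) * (G0 * \<beta>)" by (simp add: mu_def G0_def)
    also have "\<dots> \<le> (4 * KL) * (B * sqrt (D \<nu> y * trunc K (infdist A C)))"
      using q1 q2 KL by (intro mult_left_mono) auto
    also have "\<dots> = (4 * KL * B) * sqrt (D \<nu> y * trunc K (infdist A C))" by simp
    also have "\<dots> \<le> (M * \<bar>y - A\<bar>) * sqrt (D \<nu> y * trunc K (infdist A C))"
    proof (rule mult_right_mono)
      have "M * \<eta>' \<le> M * \<bar>y - A\<bar>" using yA L_M(4) by (intro mult_left_mono) auto
      then show "4 * KL * B \<le> M * \<bar>y - A\<bar>" using M(3) by linarith
      show "0 \<le> sqrt (D \<nu> y * trunc K (infdist A C))"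
        using trunc_pos[OF K(1), of "infdist A C"] by auto
    qed
    finally have q3: "4 * D n x * mu \<le> M * \<bar>y - A\<bar> * sqrt (D \<nu> y * trunc K (infdist A C))" .
    have q4: "\<exists>j<n. L * infdist (F j x) C \<le> \<gamma>A" if ex: "\<exists>j<\<nu>. L * infdist (F j y) C \<le> \<gamma>A"
    proof -
      obtain j where j: "j < \<nu>" "L * infdist (F j y) C \<le> \<gamma>A" using ex by blast
      have "F j y = F (s + j) x" by (simp add: y_def iter_add)
      then show ?thesis using j sn(4) by (metis nat_add_left_cancel_less)
    qed
    show "\<kappa> \<le> \<gamma>A \<or> (\<exists>j<n. L * infdist (F j x) C \<le> \<gamma>A) \<or> 4 * D n x * mu \<le> \<gamma>A"
      using A(5) q3 q4 unfolding yn \<gamma>A_def[symmetric] by (meson order_trans)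
  qed (use mu in auto)
  have pos: "0 < 4 * D n x * mu" using Gpos mu by (simp add: G0_def)
  have "1 / \<beta> \<le> KL * G0 * (1 / \<gamma>A + 1 / \<gamma>b)" by (rule lim)
  also have "\<dots> \<le> KL * G0 * (1 / (4 * D n x * mu) + 1 / (4 * D n x * mu))"
    using gA gb pos KL Gpos by (intro mult_left_mono add_mono frac_le) auto
  also have "\<dots> = 1 / (2 * \<beta>)" using Gpos KL \<beta> by (simp add: G0_def[symmetric] mu_def field_simps)
  finally show False using \<beta> by (simp add: field_simps)
qed

lemma bound_holds_all: "bound_holds n"
proof (induction n rule: less_induct)
  case (less n)
  have "trunc (tgt x) (infdist x C) \<le> D n x" if ad: "adm \<rho>s n x" for x
  proof (cases "n \<le> N + 2")
    case True
    show ?thesis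
    proof (cases "n = 0")
      case True
      then show ?thesis using trunc_le_1[OF tgt(1)] by simp
    next
      case False
      \<comment> \<open>Such short orbits start at distance at least \<eta>F from \<open>C\<close>,
        so K' <= \<omega>F \<eta>F keeps the target below the crude bound \<omega>F.\<close>
      have sh: "(\<forall>j<n. \<eta>F \<le> infdist (F j x) C) \<and> \<omega>F \<le> D n x"
        by (rule short[OF True adm_free[OF ad] adm_close[OF ad]])
      then have \<rho>: "\<eta>F \<le> infdist x C" using False by (metis funpow_0 neq0_conv)
      have "trunc (tgt x) (infdist x C) \<le> tgt x / infdist x C"
        using \<rho> \<eta>F by (intro trunc_le_divide tgt) auto
      also have "\<dots> \<le> K' / \<eta>F" using \<rho> \<eta>F tgt(2)[of x] K'(1) by (intro frac_le) auto
      also have "\<dots> \<le> \<omega>F" using K'(4) \<eta>F by (simp add: divide_le_eq)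
      finally show ?thesis using sh by linarith
    qed
  next
    case False
    then have n: "n \<ge> N" "n \<ge> 1" "n \<ge> 2" "n \<ge> N + 2" by auto
    show ?thesis
    proof (cases "\<exists>e. bad_end e \<and> free n (closed_segment x e)")
      case True
      then obtain e where e: "bad_end e" "free n (closed_segment x e)" by blast
      have V: "x \<in> V N" using e n(1) by (auto simp: V_def intro: free_le)
      show ?thesis
        using far_boundary_step[OF less.IH ad n(3) V] near_boundary_step[OF less.IH ad n(4) e]
        by (cases "\<eta> \<le> infdist x C") auto
    next
      case False
      then show ?thesis using interior_step[OF less.IH ad n(1,2)] by blast
    qed
  qed
  then show ?case by (simp add: bound_holds_def)
qed

lemma adm_derivative_bound:
  assumes "adm \<rho>s n x"
  shows "K \<le> D n x"
proof -
  have "K / 1 \<le> trunc K (infdist x C)"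
    by (rule trunc_ge) (use K infdist_le_1[OF adm_in[OF assms]] in auto)
  then show ?thesis using bound_holds_K[OF bound_holds_all assms] by simp
qed

end

section \<open>Choice of the constants and the bound at first entries\<close>

context classA_map
begin

lemma bad_ends_far: "\<exists>\<epsilon>>0. \<forall>e. bad_end e \<longrightarrow> \<epsilon> \<le> infdist e C"
proof -
  have "\<exists>\<epsilon>>0. \<forall>\<epsilon>'. 0 < \<epsilon>' \<and> \<epsilon>' \<le> \<epsilon> \<longrightarrow> (\<forall>e\<in>{e. bad_end e}. \<epsilon>' \<le> infdist e C)"
  proof (rule finite_uniform_threshold)
    show "finite {e. bad_end e}" by (rule finite_subset[of _ "{0, 1}"]) (auto simp: bad_end_def)
    fix e assume "e \<in> {e. bad_end e}"
    then have "free 1 {e}" by (simp add: bad_end_def)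
    then have "infdist e C > 0" using infdist_pos by (auto simp: free_singleton)
    then show "\<exists>\<epsilon>>0. \<forall>\<epsilon>'. 0 < \<epsilon>' \<and> \<epsilon>' \<le> \<epsilon> \<longrightarrow> \<epsilon>' \<le> infdist e C" by blast
  qed
  then show ?thesis by blast
qed

text \<open>By monotonicity the gap is smallest at distance exactly \<eta> from e, so one point has
  to be examined for each end point and each s.\<close>

lemma bad_end_image:
  assumes "\<eta> > 0"
  shows "\<exists>\<eta>'>0. \<forall>e x s. bad_end e \<longrightarrow> s \<in> {1, 2} \<longrightarrow> free s (closed_segment x e) \<longrightarrow> \<eta> \<le> \<bar>x - e\<bar> \<longrightarrow>
     \<eta>' \<le> \<bar>F s x - F s e\<bar>"
proof -
  have "\<exists>\<epsilon>>0. \<forall>\<epsilon>'. 0 < \<epsilon>' \<and> \<epsilon>' \<le> \<epsilon> \<longrightarrow> (\<forall>p\<in>{0, 1::real} \<times> {1, 2::nat}. bad_end (fst p) \<longrightarrow>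
     (\<forall>x. free (snd p) (closed_segment x (fst p)) \<longrightarrow> \<eta> \<le> \<bar>x - fst p\<bar> \<longrightarrow>
     \<epsilon>' \<le> \<bar>F (snd p) x - F (snd p) (fst p)\<bar>))"
  proof (rule finite_uniform_threshold)
    fix p :: "real \<times> nat" assume p: "p \<in> {0, 1} \<times> {1, 2}"
    obtain e s where ps: "p = (e, s)" by (cases p)
    define y where "y = (if e = 0 then \<eta> else 1 - \<eta>)"
    \<comment> \<open>If the two images coincide, no free segment reaches from e to y, and 1 is an
      arbitrary positive default.\<close>
    define \<epsilon> where "\<epsilon> = (if (f ^^ s) y = F s e then 1 else \<bar>F s y - F s e\<bar>)"
    have "\<epsilon> \<le> \<bar>F s x - F s e\<bar>"
      if fr: "free s (closed_segment x e)" and far: "\<eta> \<le> \<bar>x - e\<bar>" for x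
    proof -
      have "x \<in> {0..1}" using fr by (auto simp: free_def)
      then have y: "y \<in> closed_segment x e" "y \<noteq> e"
        using far p assms unfolding ps by (auto simp: y_def closed_segment_eq_real_ivl split: if_splits)
      then have "F s y \<noteq> F s e" using free_segment(1)[OF fr] by (auto dest: inj_onD)
      moreover have "F s y \<in> closed_segment (F s x) (F s e)"
        using free_segment(3)[OF fr] y(1) by blast
      ultimately show ?thesis
        by (auto simp: \<epsilon>_def closed_segment_eq_real_ivl split: if_splits)
    qed
    moreover have "\<epsilon> > 0" by (simp add: \<epsilon>_def)
    ultimately show "\<exists>\<epsilon>>0. \<forall>\<epsilon>'. 0 < \<epsilon>' \<and> \<epsilon>' \<le> \<epsilon> \<longrightarrow> bad_end (fst p) \<longrightarrow>
     (\<forall>x. free (snd p) (closed_segment x (fst p)) \<longrightarrow> \<eta> \<le> \<bar>x - fst p\<bar> \<longrightarrow>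
     \<epsilon>' \<le> \<bar>F (snd p) x - F (snd p) (fst p)\<bar>)"
      unfolding ps fst_conv snd_conv by (meson order_trans)
  qed simp
  then obtain \<eta>' where "\<eta>' > 0" and H: "\<forall>p\<in>{0, 1::real} \<times> {1, 2::nat}. bad_end (fst p) \<longrightarrow>
     (\<forall>x. free (snd p) (closed_segment x (fst p)) \<longrightarrow> \<eta> \<le> \<bar>x - fst p\<bar> \<longrightarrow>
     \<eta>' \<le> \<bar>F (snd p) x - F (snd p) (fst p)\<bar>)" by blast
  have "\<eta>' \<le> \<bar>F s x - F s e\<bar>"
    if "bad_end e" "s \<in> {1, 2}" "free s (closed_segment x e)" "\<eta> \<le> \<bar>x - e\<bar>" for e x s
  proof -
    have "(e, s) \<in> {0, 1} \<times> {1, 2}" using that by (auto simp: bad_end_def)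
    from bspec[OF H this] that show ?thesis by simp
  qed
  then show ?thesis using \<open>\<eta>' > 0\<close> by blast
qed

lemma adm_bound: "\<exists>K>0. \<exists>\<rho>>0. \<forall>n x. adm \<rho> n x \<longrightarrow> K \<le> D n x"
proof -
  obtain N0 where N0: "\<And>e p. bad_end e \<Longrightarrow> p \<in> {1, 2} \<Longrightarrow> \<not> free N0 (closed_segment e (F p e))"
    using bad_end_return by blast
  obtain N1 \<kappa>1 where \<kappa>1: "\<kappa>1 > 0"
    and N1: "\<And>e n. e \<in> {0, 1} \<Longrightarrow> free N1 {e} \<Longrightarrow> \<not> bad_end e \<Longrightarrow> \<kappa>1 \<le> infdist (F n e) C"
    using other_ends by blast
  define N where "N = N0 + 2 + N1"
  obtain \<eta>a Ka where a: "\<eta>a > 0" "Ka \<ge> 1" "\<And>c x u. c \<in> C \<Longrightarrow> x \<in> {0..1} \<Longrightarrow> x \<noteq> c \<Longrightarrow> \<bar>x - c\<bar> < \<eta>a \<Longrightarrow>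
      u \<in> open_segment x c \<Longrightarrow> \<bar>F (Suc 0) x - F (Suc 0) u\<bar> \<le> Ka * D (Suc 0) x * \<bar>x - u\<bar>"
    using near_critical_lipschitz[of 0] by blast
  obtain \<eta>b Kb where b: "\<eta>b > 0" "Kb \<ge> 1" "\<And>c x u. c \<in> C \<Longrightarrow> x \<in> {0..1} \<Longrightarrow> x \<noteq> c \<Longrightarrow> \<bar>x - c\<bar> < \<eta>b \<Longrightarrow>
      u \<in> open_segment x c \<Longrightarrow> \<bar>F (Suc 1) x - F (Suc 1) u\<bar> \<le> Kb * D (Suc 1) x * \<bar>x - u\<bar>"
    using near_critical_lipschitz[of 1] by blast
  obtain \<epsilon> where \<epsilon>: "\<epsilon> > 0" "\<And>e. bad_end e \<Longrightarrow> \<epsilon> \<le> infdist e C" using bad_ends_far by blast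
  define KL where "KL = max Ka Kb"
  \<comment> \<open>The entry \<epsilon>/2 keeps points within \<eta> of \<open>C\<close> at
    distance at least \<eta> from every bad end point.\<close>
  define \<eta> where "\<eta> = Min {\<eta>a, \<eta>b, \<epsilon> / 2, 1}"
  have \<eta>: "0 < \<eta>" "\<eta> \<le> 1" "\<eta> \<le> \<eta>a" "\<eta> \<le> \<eta>b" "2 * \<eta> \<le> \<epsilon>" using a b \<epsilon> by (auto simp: \<eta>_def min_def)
  have KL: "KL \<ge> 1" using a by (simp add: KL_def)
  obtain w1 where w1: "w1 > 0" "\<And>x. x \<in> {0..1} \<Longrightarrow> \<eta> \<le> infdist x C \<Longrightarrow> w1 \<le> \<bar>Df x\<bar>"
    using Df_lower_away[OF \<eta>(1)] by blast
  define \<omega>1 where "\<omega>1 = min 1 w1"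
  have \<omega>1: "0 < \<omega>1" "\<omega>1 \<le> 1" "\<omega>1 \<le> w1" using w1(1) by (auto simp: \<omega>1_def)
  have "0 < \<omega>1 * \<eta>" using \<omega>1 \<eta> by simp
  then obtain w2 where w2: "w2 > 0" "\<And>x. x \<in> {0..1} \<Longrightarrow> \<omega>1 * \<eta> \<le> infdist x C \<Longrightarrow> w2 \<le> \<bar>Df x\<bar>"
    using Df_lower_away by blast
  define \<omega>2 where "\<omega>2 = min 1 w2"
  have \<omega>2: "0 < \<omega>2" "\<omega>2 \<le> 1" "\<omega>2 \<le> w2" using w2(1) by (auto simp: \<omega>2_def)
  obtain \<eta>' where \<eta>': "\<eta>' > 0" "\<And>e x s. bad_end e \<Longrightarrow> s \<in> {1, 2} \<Longrightarrow> free s (closed_segment x e) \<Longrightarrow>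
      \<eta> \<le> \<bar>x - e\<bar> \<Longrightarrow> \<eta>' \<le> \<bar>F s x - F s e\<bar>"
    using bad_end_image[OF \<eta>(1)] by blast
  obtain B0 where B0: "B0 > 0" "\<And>x. x \<in> {0..1} - C \<Longrightarrow> \<bar>Df x\<bar> \<le> B0" using Df_bounded by blast
  define B where "B = max 1 B0"
  define S where "S = \<eta> * \<omega>1 * \<omega>2"
  have S: "S > 0" using \<eta> \<omega>1 \<omega>2 by (simp add: S_def)
  define L where "L = max 1 (4 * KL / S)"
  define M where "M = Max {8 / S, 4 * KL, 4 * KL * B / \<eta>'}"
  have Mge: "8 / S \<le> M" "4 * KL \<le> M" "4 * KL * B / \<eta>' \<le> M" by (auto simp: M_def)
  have "L \<ge> 1" by (simp add: L_def)
  moreover have "M > 0" using Mge(2) KL by linarith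
  ultimately obtain \<kappa>2 \<rho>2 where \<kappa>2: "\<kappa>2 > 0" "\<rho>2 > 0" and est: "\<And>x n b i. b \<noteq> x \<Longrightarrow> i < n \<Longrightarrow> F i b \<in> C \<Longrightarrow>
     free i (closed_segment x b) \<Longrightarrow> free n (closed_segment x b - {b}) \<Longrightarrow> adm \<rho>2 n x \<Longrightarrow>
     (\<exists>Y. is_end n x b Y \<and> (\<kappa>2 \<le> \<bar>F n x - Y\<bar> \<or> L * infdist (F i x) C \<le> \<bar>F n x - Y\<bar> \<or>
        M * \<bar>x - b\<bar> * sqrt (D n x * D i b) \<le> \<bar>F n x - Y\<bar>))"
    using end_estimate[of L M] by metis
  obtain \<eta>F \<omega>F where F: "\<eta>F > 0" "\<omega>F > 0" and short: "\<And>x n. n \<le> N + 2 \<Longrightarrow> free n {x} \<Longrightarrow>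
      infdist (F n x) C < \<eta>F \<Longrightarrow> (\<forall>j<n. \<eta>F \<le> infdist (F j x) C) \<and> \<omega>F \<le> D n x"
    using finite_time_bound[of "N + 2"] by metis
  \<comment> \<open>\<kappa> and \<rho>s each take half of \<kappa>1, the distance kept by the other
    end points; \<eta>F/2 in \<rho>s turns a weak inequality into the strict one required by
    \<open>short\<close>.\<close>
  define \<kappa> where "\<kappa> = min \<kappa>2 (\<kappa>1 / 2)"
  define \<rho>s where "\<rho>s = Min {\<rho>2, \<kappa>1 / 2, \<eta>F / 2}"
  have \<kappa>: "0 < \<kappa>" "\<kappa> \<le> \<kappa>2" "\<kappa> \<le> \<kappa>1 / 2" using \<kappa>1 \<kappa>2 by (auto simp: \<kappa>_def)
  have \<rho>s: "0 < \<rho>s" "\<rho>s \<le> \<rho>2" "\<rho>s \<le> \<kappa>1 / 2" "\<rho>s \<le> \<eta>F / 2" using \<kappa>1 \<kappa>2 F by (auto simp: \<rho>s_def)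
  define K' where "K' = Min {1, \<kappa> / (4 * KL), \<omega>F * \<eta>F, \<rho>s}"
  have K': "0 < K'" "K' \<le> 1" "K' \<le> \<kappa> / (4 * KL)" "K' \<le> \<omega>F * \<eta>F" "K' \<le> \<rho>s"
    using \<kappa> KL F \<rho>s by (auto simp: K'_def)
  have adm_mono: "adm \<rho>2 n x" if "adm \<rho>s n x" for n x
    using that \<rho>s(2) unfolding adm_def by (meson order_trans)
  interpret classA_consts f Df C l N N0 \<eta> \<eta>' \<omega>1 \<omega>2 B KL L M \<kappa> \<rho>s \<eta>F \<omega>F K'
  proof
    show "N \<ge> N0 + 2" by (simp add: N_def)
    show "\<And>e p. bad_end e \<Longrightarrow> p \<in> {1, 2} \<Longrightarrow> \<not> free N0 (closed_segment e (F p e))" by (rule N0)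
    show "\<kappa> + \<rho>s \<le> infdist (F n e) C" if "e \<in> {0, 1}" "free N {e}" "\<not> bad_end e" for e n
    proof -
      have "free N1 {e}" using free_le[OF that(2)] by (simp add: N_def)
      then have "\<kappa>1 \<le> infdist (F n e) C" using N1 that by blast
      then show ?thesis using \<kappa>(3) \<rho>s(3) by linarith
    qed
    show "\<bar>F s x - F s u\<bar> \<le> KL * D s x * \<bar>x - u\<bar>"
      if "c \<in> C" "x \<in> {0..1}" "x \<noteq> c" "\<bar>x - c\<bar> < \<eta>" "u \<in> open_segment x c" "s \<in> {1, 2}" for c x u s
    proof -
      have le: "Ka * z \<le> KL * z" "Kb * z \<le> KL * z" if "z \<ge> 0" for z
        using that by (auto simp: KL_def intro: mult_right_mono)
      from that(6) consider "s = Suc 0" | "s = Suc 1" by auto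
      then show ?thesis
      proof cases
        case 1
        then show ?thesis
          using a(3)[of c x u] that \<eta>(3) le(1)[of "D s x * \<bar>x - u\<bar>"] by (simp add: mult.assoc)
      next
        case 2
        then show ?thesis
          using b(3)[of c x u] that \<eta>(4) le(2)[of "D s x * \<bar>x - u\<bar>"] by (simp add: mult.assoc)
      qed
    qed
    show "2 * \<eta> \<le> infdist e C" if "bad_end e" for e using \<epsilon>(2)[OF that] \<eta>(5) by linarith
    show "\<omega>1 \<le> \<bar>Df x\<bar>" if "x \<in> {0..1}" "\<eta> \<le> infdist x C" for x using w1(2)[OF that] \<omega>1(3) by linarith
    show "\<omega>2 \<le> \<bar>Df x\<bar>" if "x \<in> {0..1}" "\<omega>1 * \<eta> \<le> infdist x C" for x using w2(2)[OF that] \<omega>2(3) by linarith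
    show "\<eta>' \<le> \<bar>F s x - F s e\<bar>"
      if "bad_end e" "s \<in> {1, 2}" "free s (closed_segment x e)" "infdist x C < \<eta>" for e x s
    proof -
      have "2 * \<eta> \<le> infdist e C" using \<epsilon>(2)[OF that(1)] \<eta>(5) by linarith
      then have "\<eta> \<le> \<bar>x - e\<bar>" using infdist_lipschitz[of e x] that(4) by linarith
      then show ?thesis using \<eta>'(2) that by blast
    qed
    show "\<bar>Df x\<bar> \<le> B" if "x \<in> {0..1} - C" for x using B0(2)[OF that] by (simp add: B_def)
    show "\<exists>Y. is_end n x b Y \<and> (\<kappa> \<le> \<bar>F n x - Y\<bar> \<or> L * infdist (F i x) C \<le> \<bar>F n x - Y\<bar> \<or>
          M * \<bar>x - b\<bar> * sqrt (D n x * D i b) \<le> \<bar>F n x - Y\<bar>)"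
      if "b \<noteq> x" "i < n" "F i b \<in> C" "free i (closed_segment x b)"
        "free n (closed_segment x b - {b})" "adm \<rho>s n x" for x n b i
      using est[OF that(1-5) adm_mono[OF that(6)]] \<kappa>(2) by (meson order_trans)
    show "(\<forall>j<n. \<eta>F \<le> infdist (F j x) C) \<and> \<omega>F \<le> D n x"
      if "n \<le> N + 2" "free n {x}" "infdist (F n x) C \<le> \<rho>s" for x n
      by (rule short[OF that(1,2)]) (use that(3) \<rho>s(4) F(1) in linarith)
    show "4 * KL \<le> L * (\<eta> * \<omega>1 * \<omega>2)"
      using S unfolding S_def[symmetric] by (simp add: L_def max_mult_distrib_right le_max_iff_disj)
    show "8 \<le> M * (\<eta> * \<omega>1 * \<omega>2)" using Mge(1) S unfolding S_def[symmetric] by (simp add: divide_le_eq)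
    show "4 * KL \<le> M" by (rule Mge(2))
    show "4 * KL * B \<le> M * \<eta>'" using Mge(3) \<eta>'(1) by (simp add: divide_le_eq)
    show "4 * KL * K' \<le> \<kappa>" using K'(3) KL by (simp add: le_divide_eq mult.commute)
  qed (use \<eta> \<eta>' \<omega>1 \<omega>2 KL \<kappa> \<rho>s F K' in \<open>auto simp: B_def\<close>)
  show ?thesis using adm_derivative_bound K(1) \<rho>s(1) by blast
qed

lemma Nbhd_side:
  assumes "c \<in> C" "x \<in> {0..1} - C"
  shows "x \<in> Nbhd f C \<delta> c \<longleftrightarrow> open_segment c x \<inter> C = {} \<and> depth c x < \<delta>"
proof -
  have "x \<noteq> c" using assms by auto
  then show ?thesis
    using assms unfolding Nbhd_def depth_def
    by (auto simp: open_segment_eq_real_ivl disjoint_iff not_less le_less split: if_splits)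
qed

text \<open>For small \<delta> a first entry is admissible: an earlier point is at least \<delta>
  deep at every critical point adjacent to it, and at least the minimal gap of \<open>C\<close> away
  from every other one. The constant K does not depend on \<delta>.\<close>

lemma first_entry_bound:
  "\<exists>K>0. \<exists>\<delta>1>0. \<forall>\<delta>. 0 < \<delta> \<longrightarrow> \<delta> < \<delta>1 \<longrightarrow> (\<forall>x\<in>{0..1}. \<forall>n. F n x \<in> Nset f C \<delta> \<and>
     (\<forall>i<n. F i x \<notin> Nset f C \<delta>) \<longrightarrow> K \<le> D n x)"
proof -
  obtain K \<rho>0 where K: "K > 0" "\<rho>0 > 0" "\<And>n x. adm \<rho>0 n x \<Longrightarrow> K \<le> D n x" using adm_bound by blast
  obtain A B where AB: "order_consts A B" using order_consts_exist by blast
  then have A: "A > 0" by (simp add: order_consts_def)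
  obtain \<Lambda> where \<Lambda>: "\<Lambda> \<ge> 1" "\<And>c r. (c, r) \<in> sides \<Longrightarrow> l c r \<le> \<Lambda>" using orders_bounded by blast
  obtain g where g: "g > 0" "\<And>c c'. c \<in> C \<Longrightarrow> c' \<in> C \<Longrightarrow> c \<noteq> c' \<Longrightarrow> g \<le> \<bar>c - c'\<bar>" using C_gap by blast
  define \<rho> where "\<rho> = Min {\<rho>0, g, 1}"
  have \<rho>: "0 < \<rho>" "\<rho> \<le> \<rho>0" "\<rho> \<le> g" "\<rho> \<le> 1" using K g by (auto simp: \<rho>_def)
  \<comment> \<open>A \<rho>^\<Lambda> is at most the depth of any point farther than \<rho> from an
    adjacent critical point, so entry forces |z - c| <= \<rho>.\<close>
  have "K \<le> D n x" if \<delta>: "0 < \<delta>" "\<delta> < A * \<rho> powr \<Lambda>" and x: "x \<in> {0..1}"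
    and entry: "F n x \<in> Nset f C \<delta>" and before: "\<And>i. i < n \<Longrightarrow> F i x \<notin> Nset f C \<delta>" for \<delta> x n
  proof (rule K(3))
    define z where "z = F n x"
    have z01: "z \<in> {0..1}" unfolding z_def by (rule iter_in[OF x])
    have CN: "c \<in> Nset f C \<delta>" if "c \<in> C" for c using that by (auto simp: Nset_def Nbhd_def)
    have notC: "F i x \<in> {0..1} - C" if "i < n" for i
      using before[OF that] CN iter_in[OF x] by blast
    have fr: "free n {x}" using x notC by (auto simp: free_singleton)
    obtain c where c: "c \<in> C" "\<bar>z - c\<bar> \<le> \<rho>" "z = c \<or> depth c z < \<delta>"
    proof (cases "z \<in> C")
      case True
      then show ?thesis using that[of z] \<rho> by simp
    next
      case False
      obtain c where cN: "c \<in> C" "z \<in> Nbhd f C \<delta> c" using entry by (auto simp: Nset_def z_def)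
      have zC: "z \<in> {0..1} - C" using z01 False by simp
      have adj: "open_segment c z \<inter> C = {}" and dep: "depth c z < \<delta>"
        using Nbhd_side[OF cN(1) zC] cN(2) by auto
      have zc: "z \<noteq> c" using False cN by auto
      define a where "a = l c (c < z)"
      have a: "1 \<le> a" "a \<le> \<Lambda>"
        using order_ge_1 \<Lambda>(2) side_of_point[OF cN(1) z01 zc] by (auto simp: a_def)
      have "\<bar>z - c\<bar> \<le> \<rho>"
      proof (rule ccontr)
        assume "\<not> ?thesis"
        then have "\<rho> powr a \<le> \<bar>z - c\<bar> powr a" using \<rho> a by (intro powr_mono2) auto
        moreover have "\<rho> powr \<Lambda> \<le> \<rho> powr a" using \<rho> a by (intro powr_mono') auto
        ultimately have "A * \<rho> powr \<Lambda> \<le> A * \<bar>z - c\<bar> powr a" using A by (intro mult_left_mono) auto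
        then show False
          using order_constsD(1)[OF AB cN(1) zC adj] dep \<delta>(2) unfolding depth_def a_def by linarith
      qed
      then show ?thesis using that cN(1) dep by blast
    qed
    have "\<bar>z - c\<bar> \<le> \<bar>F j x - c'\<bar> \<or> depth c z \<le> depth c' (F j x)"
      if j: "j < n" and c': "c' \<in> C" for j c'
    proof (cases "z = c")
      case False
      then have dep: "depth c z < \<delta>" using c(3) by blast
      define w where "w = F j x"
      have w: "w \<in> {0..1} - C" using notC[OF j] by (simp add: w_def)
      show ?thesis
      proof (cases "open_segment c' w \<inter> C = {}")
        case True
        have "w \<notin> Nbhd f C \<delta> c'" using before[OF j] c' by (auto simp: Nset_def w_def)
        then have "\<delta> \<le> depth c' w" using Nbhd_side[OF c' w] True by auto
        then show ?thesis using dep by (simp add: w_def)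
      next
        case False
        then obtain d where d: "d \<in> open_segment c' w" "d \<in> C" by blast
        have "d \<noteq> c'" "\<bar>d - c'\<bar> \<le> \<bar>w - c'\<bar>"
          using d(1) by (auto simp: open_segment_eq_real_ivl split: if_splits)
        then have "g \<le> \<bar>w - c'\<bar>" using g(2)[OF d(2) c'] by linarith
        then show ?thesis using c(2) \<rho>(3) unfolding w_def by linarith
      qed
    qed simp
    then show "adm \<rho>0 n x"
      using fr c(1,2) \<rho>(2) unfolding adm_def z_def by (meson order_trans)
  qed
  moreover have "A * \<rho> powr \<Lambda> > 0" using A \<rho> by simp
  ultimately show ?thesis using K(1) by blast
qed

end

theorem theoremC:
  assumes "classA f Df C l"
  shows "\<exists>K>0. \<forall>\<delta>0>0. \<exists>\<delta>. 0 < \<delta> \<and> \<delta> < \<delta>0 \<and>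
           (\<forall>x\<in>{0..1}. \<forall>n. (f ^^ n) x \<in> Nset f C \<delta> \<and> (\<forall>i<n. (f ^^ i) x \<notin> Nset f C \<delta>)
              \<longrightarrow> \<bar>Dfn f Df n x\<bar> \<ge> K)"
proof (cases "C = {}")
  case True
  then have empty: "Nset f C \<delta> = {}" for \<delta> by (simp add: Nset_def)
  show ?thesis
  proof (rule exI[of _ 1], intro conjI allI impI)
    fix \<delta>0 :: real assume "\<delta>0 > 0"
    then show "\<exists>\<delta>. 0 < \<delta> \<and> \<delta> < \<delta>0 \<and>
           (\<forall>x\<in>{0..1}. \<forall>n. (f ^^ n) x \<in> Nset f C \<delta> \<and> (\<forall>i<n. (f ^^ i) x \<notin> Nset f C \<delta>)
              \<longrightarrow> \<bar>Dfn f Df n x\<bar> \<ge> 1)"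
      using empty by (intro exI[of _ "\<delta>0 / 2"]) simp
  qed simp
next
  case False
  interpret classA_map f Df C l by unfold_locales (fact assms, fact False)
  obtain K \<delta>1 where K: "K > 0" "\<delta>1 > 0" and H: "\<And>\<delta> x n. 0 < \<delta> \<Longrightarrow> \<delta> < \<delta>1 \<Longrightarrow> x \<in> {0..1} \<Longrightarrow>
      (f ^^ n) x \<in> Nset f C \<delta> \<and> (\<forall>i<n. (f ^^ i) x \<notin> Nset f C \<delta>) \<Longrightarrow> K \<le> \<bar>Dfn f Df n x\<bar>"
    using first_entry_bound by blast
  show ?thesis
  proof (rule exI[of _ K], intro conjI allI impI)
    fix \<delta>0 :: real assume "\<delta>0 > 0"
    then have "0 < min \<delta>0 \<delta>1 / 2" "min \<delta>0 \<delta>1 / 2 < \<delta>0" "min \<delta>0 \<delta>1 / 2 < \<delta>1"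
      using K(2) by auto
    then show "\<exists>\<delta>. 0 < \<delta> \<and> \<delta> < \<delta>0 \<and>
           (\<forall>x\<in>{0..1}. \<forall>n. (f ^^ n) x \<in> Nset f C \<delta> \<and> (\<forall>i<n. (f ^^ i) x \<notin> Nset f C \<delta>)
              \<longrightarrow> \<bar>Dfn f Df n x\<bar> \<ge> K)"
      using H by blast
  qed (rule K(1))
qed

end
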